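(* Let $\{Q_n\}_{n\ge1}$ be a sequence of offspring generating functions $Q_n(s)=\sum_{k\ge0}q_n(k)s^k$ satisfying $Q_n(0)=0$ for all $n$, and let $\mathbf{P}_Q$ denote the law of the branching process in varying environment $\{Z_n\}$ (and of its family tree) defined by $\{Q_n\}$. Let $M_n=\prod_{j=1}^n Q_j'(1)$ be the $\mathbf{P}_Q$-expectation of $Z_n$. Let $\Delta$ be any infinite tree and denote the size of its $n$-th generation by $|\Delta_n|$. Assume that (i) $a:=\inf_n Q_n'(1)>1$; (ii) $V:=\sup_n Q_n''(1)<\infty$; (iii) $A_\Delta:=\sup_n |\Delta_n|/M_n<\infty$. Then for $\mathbf{P}_Q$-almost every tree $\Gamma$ there exists a constant $C_1\in(0,\infty)$, depending only on the trees $\Gamma$ and $\Delta$, such that for every label distribution $F$ and every closed set $B\subseteq\mathbb{R}^\infty$, $$P(\Gamma;B;F)\ \ge\ C_1\,P(\Delta;B;F).$$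
   Context: Branching process in varying environment: for each $n\ge1$, $\{q_n(k)\}_{k\ge0}$ is a probability distribution on the nonnegative integers. A random rooted tree $\Gamma$ is built so that, starting from a single root (generation $0$), every individual in generation $n-1$ has, independently of all others, $k$ children with probability $q_n(k)$; $Z_n$ is the number of individuals in generation $n$. All infinite trees are rooted, locally finite and have no leaves. For such a tree $\Gamma$ with root $\rho$, let $\{X(v)\}$ be IID real random variables with common distribution $F$ indexed by the vertices of $\Gamma$. For closed $B\subseteq\mathbb{R}^\infty$ (product topology), $P(\Gamma;B;F)$ is the probability that there exists an infinite non-self-intersecting path $\rho,v_1,v_2,\ldots$ from the root with $(X(v_1),X(v_2),\ldots)\in B$. *)

theory Defs
  imports "HOL-Probability.Probability"
begin

section \<open>Rooted trees\<close>

text \<open>Undirected graphs are given by a symmetric edge relation.\<close>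

record 'v rooted_graph =
  verts :: "'v set"
  edges :: "('v \<times> 'v) set"
  origin :: 'v

definition simple_path :: "'v rooted_graph \<Rightarrow> 'v \<Rightarrow> 'v list \<Rightarrow> 'v \<Rightarrow> bool" where
  "simple_path T u xs v \<longleftrightarrow>
     xs \<noteq> [] \<and> hd xs = u \<and> last xs = v \<and> set xs \<subseteq> verts T \<and> distinct xs \<and>
     successively (\<lambda>x y. (x, y) \<in> edges T) xs"

definition rooted_tree :: "'v rooted_graph \<Rightarrow> bool" where
  "rooted_tree T \<longleftrightarrow>
     origin T \<in> verts T \<and> edges T \<subseteq> verts T \<times> verts T \<and> sym (edges T) \<and> irrefl (edges T) \<and>
     (\<forall>u\<in>verts T. \<forall>v\<in>verts T. \<exists>!xs. simple_path T u xs v)"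

text \<open>Graph distance from the root; only meaningful for vertices connected to the root.\<close>

definition height :: "'v rooted_graph \<Rightarrow> 'v \<Rightarrow> nat" where
  "height T v = (LEAST n. (origin T, v) \<in> edges T ^^ n)"

definition generation :: "'v rooted_graph \<Rightarrow> nat \<Rightarrow> 'v set" where
  "generation T n = {v \<in> verts T. height T v = n}"

definition children :: "'v rooted_graph \<Rightarrow> 'v \<Rightarrow> 'v set" where
  "children T v = {w. (v, w) \<in> edges T \<and> height T w = Suc (height T v)}"

text \<open>A leaf is a vertex without children; in particular a root of degree one is not a leaf.\<close>

definition infinite_tree :: "'v rooted_graph \<Rightarrow> bool" where
  "infinite_tree T \<longleftrightarrow>
     rooted_tree T \<and> infinite (verts T) \<and>
     (\<forall>v\<in>verts T. finite {w. (v, w) \<in> edges T}) \<and>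
     (\<forall>v\<in>verts T. children T v \<noteq> {})"

section \<open>Paths with labels in a prescribed set\<close>

definition infinite_path :: "'v rooted_graph \<Rightarrow> (nat \<Rightarrow> 'v) \<Rightarrow> bool" where
  "infinite_path T p \<longleftrightarrow>
     p 0 = origin T \<and> inj p \<and> (\<forall>n. (p n, p (Suc n)) \<in> edges T)"

text \<open>The probability \<open>P(T;B;F)\<close>. The coordinates of the product measure are the IID labels.
  The root carries a label which is not used. For a locally finite tree \<open>T\<close>, the vertex set is
  countable and the space of infinite paths from the root is compact, so for closed \<open>B\<close> the event
  below is a closed, hence measurable, set of labellings.\<close>

definition path_prob :: "'v rooted_graph \<Rightarrow> (nat \<Rightarrow> real) set \<Rightarrow> real measure \<Rightarrow> real" where
  "path_prob T B F =
     measure (Pi\<^sub>M (verts T) (\<lambda>_. F))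
       {X \<in> space (Pi\<^sub>M (verts T) (\<lambda>_. F)).
          \<exists>p. infinite_path T p \<and> (\<lambda>n. X (p (Suc n))) \<in> B}"

section \<open>Branching processes in varying environment\<close>

definition gen_fun :: "nat pmf \<Rightarrow> real \<Rightarrow> real" where
  "gen_fun q s = (\<Sum>k. pmf q k * s ^ k)"

text \<open>The \<open>i\<close>-th derivative at \<open>1\<close> of a generating function. The power series need not converge
  to the right of \<open>1\<close>, so this is the limit from the left, which always exists in \<open>[0, \<infinity>]\<close> by
  monotonicity.\<close>

definition gen_fun_deriv_1 :: "nat \<Rightarrow> nat pmf \<Rightarrow> ereal" where
  "gen_fun_deriv_1 i q = Lim (at_left 1) (\<lambda>s. ereal ((deriv ^^ i) (gen_fun q) s))"

definition mean_size :: "(nat \<Rightarrow> nat pmf) \<Rightarrow> nat \<Rightarrow> ereal" where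
  "mean_size q n = (\<Prod>j = 1..n. gen_fun_deriv_1 1 (q j))"

text \<open>Individuals are labelled by finite words over \<open>nat\<close> (Ulam-Harris): the children of \<open>v\<close> are
  \<open>v @ [0], \<dots>, v @ [k - 1]\<close>, where \<open>k = K v\<close> is the number of children of \<open>v\<close>. The number \<open>K v\<close>
  is drawn for all words \<open>v\<close> and is irrelevant for words that are not individuals of the tree.\<close>

definition family_tree :: "(nat list \<Rightarrow> nat) \<Rightarrow> nat list rooted_graph" where
  "family_tree K =
     (let V = {v. \<forall>i<length v. v ! i < K (take i v)}
      in \<lparr>verts = V,
          edges = {(u, v). u \<in> V \<and> v \<in> V \<and> (\<exists>i. v = u @ [i] \<or> u = v @ [i])},
          origin = []\<rparr>)"

text \<open>An individual \<open>v\<close> belongs to generation \<open>length v\<close>, so its number of children has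
  distribution \<open>q (length v + 1)\<close>; \<open>q 0\<close> is never used.\<close>

definition offspring_measure :: "(nat \<Rightarrow> nat pmf) \<Rightarrow> (nat list \<Rightarrow> nat) measure" where
  "offspring_measure q = Pi\<^sub>M UNIV (\<lambda>v. measure_pmf (q (Suc (length v))))"

end

theory Submission
  imports Defs
begin

text \<open>
  Up to a fixed generation \<open>N\<close>, order the vertices of \<open>\<Delta>\<close> lexicographically and let \<open>\<phi>\<close> be the
  density, with respect to the law of the labels, of the label sequence of the first path that
  lies in \<open>B\<close>; its total mass is \<open>p = P(\<Delta>;B;F)\<close>. Let \<open>\<phi>\<^sub>k\<close> be the conditional expectation of \<open>\<phi>\<close>
  given the first \<open>k\<close> labels and \<open>e\<^sub>k = E \<phi>\<^sub>k\<^sup>2\<close>. Since the labels to the right of the first path are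
  fresh, its energy telescopes, and by the Cauchy-Schwarz inequality
  \<open>p\<^sup>2 + (\<Sum>k. (e\<^sub>k - e\<^sub>k\<^sub>-\<^sub>1) / card \<Delta>\<^sub>k) \<le> 2 p\<close>.

  On the other hand, let \<open>\<mu>\<close> be a unit flow on \<open>\<Gamma>\<close> with \<open>(\<Sum>v\<in>\<Gamma>\<^sub>k. \<mu> v\<^sup>2) \<le> C / M\<^sub>k\<close>. The second moment
  method for \<open>\<Sum>v\<in>\<Gamma>\<^sub>N. \<mu> v \<phi>(X\<^sub>v)\<close>, whose mean is \<open>p\<close> and whose second moment is
  \<open>p\<^sup>2 + (\<Sum>k. (\<Sum>v\<in>\<Gamma>\<^sub>k. \<mu> v\<^sup>2) (e\<^sub>k - e\<^sub>k\<^sub>-\<^sub>1))\<close>, then bounds \<open>P(\<Gamma>;B;F)\<close> from below by a multiple of \<open>p\<close>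
  that does not depend on \<open>B\<close> and \<open>F\<close>.

  Such a flow exists almost surely: take the one that is uniform on a late generation of the
  subtree below some vertex, after truncating the offspring numbers at a level that grows
  exponentially, but slowly compared with \<open>M\<^sub>n\<close>. This changes the means \<open>M\<^sub>n\<close> only by a bounded factor
  and makes the fluctuations of \<open>\<Sum>v\<in>\<Gamma>\<^sub>k. \<mu> v\<^sup>2\<close> summable over \<open>k\<close>. Each subtree has the required
  property with probability bounded below, so that almost surely one of them has it.
\<close>
section \<open>Averaging over one label\<close>

text \<open>The two trees share no probability space; \<open>\<phi>\<close> is the link. On
  \<open>\<Delta>\<close> it is a density of mass \<open>p\<close>, on \<open>\<Gamma>\<close> a
  test function. The choice of the first path keeps its energy of order \<open>p\<close>: with an
  energy of order 1 the second moment method would only give a bound of order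
  \<open>p\<^sup>2\<close>.

  The obstacle on the branching side is moments. The sum of \<open>(\<mu> v)\<^sup>2\<close> over a
  generation is already quadratic in the numbers of descendants, so controlling its variance would
  call for fourth moments of the offspring, whereas only second factorial moments are bounded. With
  at most \<open>L\<close> children, Cauchy-Schwarz over at most \<open>L\<^sup>2\<close> pairs of
  siblings replaces the missing moments by a factor \<open>L\<^sup>2\<close>, and the size of the
  generation is divided out. So \<open>L\<close> may grow exponentially at a small rate. It has to
  grow, since a truncation at level \<open>c\<close> may lower the mean by \<open>V / c\<close>, and
  these losses must be summable.

  The flows are obtained for infinitely many \<open>N\<close> with one constant, not for all
  \<open>N\<close>. This suffices because the finite-generation probabilities of both trees
  converge.\<close>

abbreviation seq_space :: "(nat \<Rightarrow> real) measure" where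
  "seq_space \<equiv> Pi\<^sub>M UNIV (\<lambda>_. borel)"

definition bdd_meas :: "((nat \<Rightarrow> real) \<Rightarrow> real) \<Rightarrow> bool" where
  "bdd_meas h \<longleftrightarrow> h \<in> borel_measurable seq_space \<and> (\<exists>c. \<forall>x. \<bar>h x\<bar> \<le> c)"

text \<open>On functions of the first \<open>k + 1\<close> entries this is the conditional
  expectation given the first \<open>k\<close>. Entry \<open>k\<close> is the label of a vertex of
  generation \<open>k + 1\<close>, since the label of the root does not enter.\<close>

definition avg :: "real measure \<Rightarrow> nat \<Rightarrow> ((nat \<Rightarrow> real) \<Rightarrow> real) \<Rightarrow> (nat \<Rightarrow> real) \<Rightarrow> real" where
  "avg F k h x = (\<integral>y. h (x(k := y)) \<partial>F)"

lemma bdd_measD: "bdd_meas h \<Longrightarrow> h \<in> borel_measurable seq_space"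
  by (simp add: bdd_meas_def)

lemma bdd_meas_const [intro, simp]: "bdd_meas (\<lambda>_. c)"
  by (auto simp: bdd_meas_def)

lemma bdd_meas_add [intro]:
  assumes "bdd_meas f" "bdd_meas g" shows "bdd_meas (\<lambda>x. f x + g x)"
proof -
  obtain a b where "\<And>x. \<bar>f x\<bar> \<le> a" "\<And>x. \<bar>g x\<bar> \<le> b"
    using assms by (auto simp: bdd_meas_def)
  hence "\<bar>f x + g x\<bar> \<le> a + b" for x
    by (meson abs_triangle_ineq add_mono order_trans)
  with assms show ?thesis unfolding bdd_meas_def by auto
qed

lemma bdd_meas_mult [intro]:
  assumes "bdd_meas f" "bdd_meas g" shows "bdd_meas (\<lambda>x. f x * g x)"
proof -
  obtain a b where "\<And>x. \<bar>f x\<bar> \<le> a" "\<And>x. \<bar>g x\<bar> \<le> b"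
    using assms by (auto simp: bdd_meas_def)
  hence "\<bar>f x * g x\<bar> \<le> a * b" for x
    by (simp add: abs_mult mult_mono')
  with assms show ?thesis unfolding bdd_meas_def by auto
qed

lemma bdd_meas_diff [intro]:
  assumes "bdd_meas f" "bdd_meas g" shows "bdd_meas (\<lambda>x. f x - g x)"
  using bdd_meas_add[OF assms(1) bdd_meas_mult[OF bdd_meas_const[of "-1"] assms(2)]] by simp

lemma bdd_meas_power2 [intro]: "bdd_meas f \<Longrightarrow> bdd_meas (\<lambda>x. (f x)\<^sup>2)"
  unfolding power2_eq_square by (rule bdd_meas_mult)

lemma bdd_meas_sum [intro]:
  "(\<And>i. i \<in> I \<Longrightarrow> bdd_meas (f i)) \<Longrightarrow> bdd_meas (\<lambda>x. \<Sum>i\<in>I. f i x)"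
  by (induction I rule: infinite_finite_induct) auto

lemma bdd_meas_prod [intro]:
  "(\<And>i. i \<in> I \<Longrightarrow> bdd_meas (f i)) \<Longrightarrow> bdd_meas (\<lambda>x. \<Prod>i\<in>I. f i x)"
  by (induction I rule: infinite_finite_induct) auto

context
  fixes F :: "real measure"
  assumes F: "real_distribution F"
begin

interpretation real_distribution F by (rule F)

lemma measurable_upd [measurable]: "(\<lambda>(x, y). x(k := y)) \<in> measurable (seq_space \<Otimes>\<^sub>M F) seq_space"
  unfolding split_beta' by (rule measurable_fun_upd[where J=UNIV]) auto

lemma measurable_upd' [measurable]: "(\<lambda>y. x(k := y)) \<in> measurable F seq_space"
  by (rule measurable_fun_upd[where J=UNIV]) (auto simp: space_PiM)

lemma integrable_upd:
  assumes "bdd_meas h" shows "integrable F (\<lambda>y. h (x(k := y)))"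
proof -
  obtain c where c: "\<And>x. \<bar>h x\<bar> \<le> c" using assms by (auto simp: bdd_meas_def)
  note [measurable] = bdd_measD[OF assms]
  show ?thesis by (rule integrable_const_bound[of _ c]) (auto simp: c)
qed

lemma bdd_meas_avg [intro]:
  assumes "bdd_meas h" shows "bdd_meas (avg F k h)"
proof -
  obtain c where c: "\<And>x. \<bar>h x\<bar> \<le> c" using assms by (auto simp: bdd_meas_def)
  note [measurable] = bdd_measD[OF assms]
  have "(\<lambda>x. \<integral>y. h (x(k := y)) \<partial>F) \<in> borel_measurable seq_space"
    by measurable
  hence "avg F k h \<in> borel_measurable seq_space" by (simp add: avg_def[abs_def])
  moreover have "\<bar>avg F k h x\<bar> \<le> c" for x
  proof -
    have "\<bar>avg F k h x\<bar> \<le> (\<integral>y. \<bar>h (x(k := y))\<bar> \<partial>F)"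
      unfolding avg_def by (rule integral_abs_bound)
    also have "\<dots> \<le> (\<integral>y. c \<partial>F)"
      by (intro integral_mono integrable_abs integrable_upd assms) (auto simp: c)
    finally show ?thesis by (simp add: prob_space[simplified])
  qed
  ultimately show ?thesis by (auto simp: bdd_meas_def)
qed

lemma avg_const [simp]: "avg F k (\<lambda>_. c) x = c"
  by (simp add: avg_def prob_space[simplified])

lemma avg_cmult [simp]: "avg F k (\<lambda>x. c * h x) x = c * avg F k h x"
  by (simp add: avg_def)

lemma avg_local_cmult:
  assumes "\<And>y. g (x(k := y)) = g x" shows "avg F k (\<lambda>x. g x * h x) x = g x * avg F k h x"
  by (simp add: avg_def assms)

lemma avg_add: "bdd_meas f \<Longrightarrow> bdd_meas g \<Longrightarrow> avg F k (\<lambda>x. f x + g x) x = avg F k f x + avg F k g x"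
  by (simp add: avg_def integrable_upd)

lemma avg_diff: "bdd_meas f \<Longrightarrow> bdd_meas g \<Longrightarrow> avg F k (\<lambda>x. f x - g x) x = avg F k f x - avg F k g x"
  by (simp add: avg_def integrable_upd)

lemma avg_sum: "(\<And>i. i \<in> I \<Longrightarrow> bdd_meas (f i)) \<Longrightarrow> avg F k (\<lambda>x. \<Sum>i\<in>I. f i x) x = (\<Sum>i\<in>I. avg F k (f i) x)"
  by (simp add: avg_def integrable_upd)

lemma avg_mono: "bdd_meas f \<Longrightarrow> bdd_meas g \<Longrightarrow> (\<And>x. f x \<le> g x) \<Longrightarrow> avg F k f x \<le> avg F k g x"
  unfolding avg_def by (intro integral_mono integrable_upd) auto

lemma avg_nonneg: "(\<And>x. 0 \<le> f x) \<Longrightarrow> 0 \<le> avg F k f x"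
  unfolding avg_def by (intro Bochner_Integration.integral_nonneg) auto

definition var :: "nat \<Rightarrow> ((nat \<Rightarrow> real) \<Rightarrow> real) \<Rightarrow> (nat \<Rightarrow> real) \<Rightarrow> real" where
  "var k f x = avg F k (\<lambda>x. (f x)\<^sup>2) x - (avg F k f x)\<^sup>2"

lemma var_altdef:
  assumes "bdd_meas f" shows "var k f x = avg F k (\<lambda>z. (f z - avg F k f x)\<^sup>2) x"
proof -
  let ?m = "avg F k f x"
  have "avg F k (\<lambda>z. (f z - ?m)\<^sup>2) x = avg F k (\<lambda>z. ((f z)\<^sup>2 - (2 * ?m) * f z) + ?m\<^sup>2) x"
    by (rule arg_cong[where f="\<lambda>h. avg F k h x"]) (auto simp: fun_eq_iff power2_eq_square algebra_simps)
  also have "\<dots> = (avg F k (\<lambda>z. (f z)\<^sup>2) x - (2 * ?m) * ?m) + ?m\<^sup>2"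
    using assms by (subst avg_add avg_diff; (auto intro!: bdd_meas_diff)?)+
  finally show ?thesis by (simp add: var_def power2_eq_square)
qed

lemma var_nonneg: "bdd_meas f \<Longrightarrow> 0 \<le> var k f x"
  by (simp add: var_altdef avg_nonneg F)

text \<open>Cauchy-Schwarz for the centred summands, which may be correlated. The factor
  \<open>card I\<close> will be the size of a generation of \<open>\<Delta>\<close>, to be absorbed
  by the spread of the flow on \<open>\<Gamma>\<close>.\<close>

lemma var_sum_le:
  assumes "finite I" "\<And>i. i \<in> I \<Longrightarrow> bdd_meas (f i)"
  shows "var k (\<lambda>x. \<Sum>i\<in>I. f i x) x \<le> card I * (\<Sum>i\<in>I. var k (f i) x)"
proof -
  define m where "m i = avg F k (f i) x" for i
  have "var k (\<lambda>x. \<Sum>i\<in>I. f i x) x = avg F k (\<lambda>z. (\<Sum>i\<in>I. f i z - m i)\<^sup>2) x"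
    using assms by (subst var_altdef) (auto simp: avg_sum m_def sum_subtractf)
  also have "\<dots> \<le> avg F k (\<lambda>z. card I * (\<Sum>i\<in>I. (f i z - m i)\<^sup>2)) x"
  proof (rule avg_mono)
    show "(\<Sum>i\<in>I. f i z - m i)\<^sup>2 \<le> card I * (\<Sum>i\<in>I. (f i z - m i)\<^sup>2)" for z
      using sum_squared_le_sum_of_squares[of "\<lambda>i. f i z - m i" I] assms(1)
      by (simp add: mult.commute)
  qed (use assms in \<open>auto intro!: bdd_meas_power2 bdd_meas_sum bdd_meas_diff bdd_meas_mult\<close>)
  also have "\<dots> = card I * (\<Sum>i\<in>I. var k (f i) x)"
    using assms by (simp add: avg_sum bdd_meas_power2 bdd_meas_diff var_altdef m_def)
  finally show ?thesis .
qed

text \<open>For every \<open>l\<close> the pointwise hypothesis yields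
  \<open>2 * l * f \<le> l\<^sup>2 * p + s\<close>, which survives averaging; it remains to choose
  \<open>l\<close>. If \<open>p\<close> has average 0, the right-hand side is constant in
  \<open>l\<close>, which forces the average of \<open>f\<close> to vanish.\<close>

lemma avg_cauchy_schwarz:
  assumes "bdd_meas f" "bdd_meas p" "bdd_meas s"
    and "\<And>x. (f x)\<^sup>2 \<le> p x * s x" "\<And>x. 0 \<le> p x" "\<And>x. 0 \<le> s x"
  shows "(avg F k f x)\<^sup>2 \<le> avg F k p x * avg F k s x"
proof -
  have *: "2 * l * avg F k f x \<le> l\<^sup>2 * avg F k p x + avg F k s x" for l
  proof -
    have "(2 * l) * f z \<le> l\<^sup>2 * p z + s z" for z
    proof -
      have "\<bar>f z\<bar> \<le> sqrt (p z) * sqrt (s z)"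
        using real_sqrt_le_mono[OF assms(4)[of z]] by (simp add: real_sqrt_mult)
      hence "\<bar>l\<bar> * \<bar>f z\<bar> \<le> \<bar>l\<bar> * (sqrt (p z) * sqrt (s z))" by (rule mult_left_mono) simp
      moreover have "l * f z \<le> \<bar>l\<bar> * \<bar>f z\<bar>" by (metis abs_ge_self abs_mult)
      moreover have "0 \<le> (\<bar>l\<bar> * sqrt (p z) - sqrt (s z))\<^sup>2" by simp
      hence "2 * (\<bar>l\<bar> * (sqrt (p z) * sqrt (s z))) \<le> l\<^sup>2 * p z + s z"
        using assms(5,6)[of z] by (simp add: power2_diff power_mult_distrib)
      ultimately show ?thesis by linarith
    qed
    hence "avg F k (\<lambda>z. (2 * l) * f z) x \<le> avg F k (\<lambda>z. l\<^sup>2 * p z + s z) x"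
      using assms by (intro avg_mono bdd_meas_add bdd_meas_mult bdd_meas_const)
    thus ?thesis using assms by (simp add: avg_add bdd_meas_mult)
  qed
  have t: "0 \<le> avg F k p x" using assms(5) by (rule avg_nonneg)
  show ?thesis
  proof (cases "avg F k p x = 0")
    case True
    have "avg F k f x = 0"
    proof (rule ccontr)
      assume nz: "avg F k f x \<noteq> 0"
      have "2 * ((avg F k s x + 1) / avg F k f x) * avg F k f x \<le> avg F k s x"
        using *[of "(avg F k s x + 1) / avg F k f x"] True by simp
      with nz have "avg F k s x + 2 \<le> 0" by simp
      moreover have "0 \<le> avg F k s x" using assms(6) by (rule avg_nonneg)
      ultimately show False by simp
    qed
    thus ?thesis using True by simp
  next
    case False
    with t have "0 < avg F k p x" by simp
    with *[of "avg F k f x / avg F k p x"] show ?thesis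
      by (simp add: field_simps power2_eq_square)
  qed
qed

end

section \<open>Comparison of two trees up to a finite generation\<close>

definition level :: "(nat list \<Rightarrow> nat) \<Rightarrow> nat \<Rightarrow> nat list set" where
  "level K n = {v \<in> verts (family_tree K). length v = n}"

lemma verts_family_tree: "verts (family_tree K) = {v. \<forall>i<length v. v ! i < K (take i v)}"
  by (simp add: family_tree_def Let_def)

lemma Nil_in_family_tree [simp]: "[] \<in> verts (family_tree K)"
  by (simp add: verts_family_tree)

lemma snoc_in_family_tree [simp]:
  "v @ [i] \<in> verts (family_tree K) \<longleftrightarrow> v \<in> verts (family_tree K) \<and> i < K v"
proof -
  have "(\<forall>j<Suc (length v). (v @ [i]) ! j < K (take j (v @ [i]))) \<longleftrightarrow>
     (\<forall>j<length v. (v @ [i]) ! j < K (take j (v @ [i]))) \<and> i < K v"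
    unfolding less_Suc_eq by auto
  thus ?thesis by (simp add: verts_family_tree nth_append)
qed

lemma level_0 [simp]: "level K 0 = {[]}"
  by (auto simp: level_def)

lemma level_Suc: "level K (Suc n) = (\<lambda>(v, i). v @ [i]) ` (SIGMA v:level K n. {..<K v})"
proof (intro equalityI subsetI)
  fix w assume w: "w \<in> level K (Suc n)"
  hence "w \<noteq> []" by (auto simp: level_def)
  then obtain v i where "w = v @ [i]" by (metis rev_exhaust)
  with w show "w \<in> (\<lambda>(v, i). v @ [i]) ` (SIGMA v:level K n. {..<K v})"
    by (auto simp: level_def)
qed (auto simp: level_def)

lemma length_level: "v \<in> level K n \<Longrightarrow> length v = n"
  by (simp add: level_def)

lemma finite_level [simp, intro]: "finite (level K n)"
  by (induction n) (auto simp: level_Suc)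

lemma sum_level_Suc: "(\<Sum>w\<in>level K (Suc n). f w) = (\<Sum>v\<in>level K n. \<Sum>i<K v. f (v @ [i]))"
proof -
  have "inj_on (\<lambda>(v, i). v @ [i]) (SIGMA v:level K n. {..<K v})"
    by (auto simp: inj_on_def)
  thus ?thesis
    by (simp add: level_Suc sum.reindex sum.Sigma case_prod_unfold)
qed

text \<open>For independent trials with success probabilities \<open>f i\<close>, this splits the
  event of some success according to the first one.\<close>

lemma one_minus_prod_telescope:
  fixes f :: "nat \<Rightarrow> 'a::comm_ring_1"
  shows "(\<Sum>i<n. (\<Prod>j<i. 1 - f j) * f i) = 1 - (\<Prod>i<n. 1 - f i)"
  by (induction n) (auto simp: algebra_simps)

lemma twice_le_add_of_square_le:
  fixes a b c :: real
  assumes "c\<^sup>2 \<le> a * b" "0 \<le> a" "0 \<le> b" shows "2 * c \<le> a + b"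
proof (rule power2_le_imp_le)
  have "(2 * c)\<^sup>2 \<le> 4 * (a * b)" using assms by (simp add: power_mult_distrib)
  also have "\<dots> \<le> (a + b)\<^sup>2"
    using zero_le_power2[of "a - b"] by (simp add: power2_diff power2_sum)
  finally show "(2 * c)\<^sup>2 \<le> (a + b)\<^sup>2" .
qed (use assms in auto)

text \<open>The second moment bound survives the passage from the children to the parent, where \<open>t i\<close> is
  the hitting probability below the \<open>i\<close>-th child, and \<open>\<zeta> i\<close> and \<open>\<sigma> i\<close> are the first two
  moments of the weight that it contributes.\<close>

lemma second_moment_union_step:
  fixes \<zeta> t \<sigma> :: "nat \<Rightarrow> real"
  assumes "\<And>i. i < n \<Longrightarrow> (\<zeta> i)\<^sup>2 \<le> t i * \<sigma> i"
    and t: "\<And>i. i < n \<Longrightarrow> 0 \<le> t i" "\<And>i. i < n \<Longrightarrow> t i \<le> 1" and "\<And>i. i < n \<Longrightarrow> 0 \<le> \<sigma> i"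
  shows "(\<Sum>i<n. \<zeta> i)\<^sup>2 \<le>
    (1 - (\<Prod>i<n. 1 - t i)) * ((\<Sum>i<n. \<zeta> i)\<^sup>2 + (\<Sum>i<n. \<sigma> i - (\<zeta> i)\<^sup>2)) \<and>
    0 \<le> (\<Sum>i<n. \<sigma> i - (\<zeta> i)\<^sup>2)"
  using assms
proof (induction n)
  case (Suc n)
  define p where "p = 1 - (\<Prod>i<n. 1 - t i)"
  define A where "A = (\<Sum>i<n. \<zeta> i)"
  define R where "R = (\<Sum>i<n. \<sigma> i - (\<zeta> i)\<^sup>2)"
  define r where "r = \<sigma> n - (\<zeta> n)\<^sup>2"
  let ?z = "\<zeta> n" and ?t = "t n"
  have p: "0 \<le> p" "p \<le> 1"
    unfolding p_def using Suc.prems by (auto intro!: prod_le_1 prod_nonneg)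
  have IH: "A\<^sup>2 \<le> p * (A\<^sup>2 + R)" "0 \<le> R"
    using Suc.IH Suc.prems by (auto simp: p_def A_def R_def)
  have t: "0 \<le> ?t" "?t \<le> 1" using Suc.prems by auto
  have "?t * \<sigma> n \<le> 1 * \<sigma> n" using t Suc.prems by (intro mult_right_mono) auto
  moreover have z: "?z\<^sup>2 \<le> ?t * \<sigma> n" using Suc.prems by auto
  ultimately have r: "0 \<le> r" by (simp add: r_def)
  \<comment> \<open>In this form a squared mean is compared with a variance, weighted by the
    probabilities of missing and of hitting. The union has hitting probability
    \<open>p + ?t - p * ?t\<close>, and the same form is to be shown for it.\<close>
  have 1: "(1 - p) * A\<^sup>2 \<le> p * R" using IH by (simp add: algebra_simps)
  have 2: "(1 - ?t) * ?z\<^sup>2 \<le> ?t * r" using z by (simp add: r_def algebra_simps)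
  \<comment> \<open>The product of \<open>1\<close> and \<open>2\<close> bounds the square of the
    mixed term by the product of the two terms on the right; the arithmetic-geometric mean
    inequality then turns the product into a sum.\<close>
  have cross: "2 * ((1 - p) * (1 - ?t) * (A * ?z)) \<le> ?t * (1 - p) * R + p * (1 - ?t) * r"
  proof -
    have "((1 - p) * (1 - ?t) * (A * ?z))\<^sup>2 = ((1 - p) * (1 - ?t)) * (((1 - p) * A\<^sup>2) * ((1 - ?t) * ?z\<^sup>2))"
      by (simp add: power2_eq_square algebra_simps)
    also have "\<dots> \<le> ((1 - p) * (1 - ?t)) * ((p * R) * (?t * r))"
      by (rule mult_left_mono[OF mult_mono[OF 1 2]]) (use p t IH r in auto)
    also have "\<dots> = (?t * (1 - p) * R) * (p * (1 - ?t) * r)" by (simp add: algebra_simps)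
    finally have *: "((1 - p) * (1 - ?t) * (A * ?z))\<^sup>2 \<le> (?t * (1 - p) * R) * (p * (1 - ?t) * r)" .
    thus ?thesis
      by (rule twice_le_add_of_square_le) (use p t IH r in auto)
  qed
  have q: "1 - (\<Prod>i<Suc n. 1 - t i) = p + ?t - p * ?t"
    by (simp add: p_def algebra_simps)
  have "(1 - p) * (1 - ?t) * (A + ?z)\<^sup>2 =
      (1 - ?t) * ((1 - p) * A\<^sup>2) + (1 - p) * ((1 - ?t) * ?z\<^sup>2) + 2 * ((1 - p) * (1 - ?t) * (A * ?z))"
    by (simp add: power2_eq_square algebra_simps)
  also have "\<dots> \<le> (1 - ?t) * (p * R) + (1 - p) * (?t * r) + (?t * (1 - p) * R + p * (1 - ?t) * r)"
    using 1 2 p t cross by (intro add_mono mult_left_mono) auto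
  also have "\<dots> = (p + ?t - p * ?t) * (R + r) - p * ?t * (R + r)"
    by (simp add: algebra_simps)
  also have "\<dots> \<le> (p + ?t - p * ?t) * (R + r)"
    using p t IH r by auto
  finally have "(A + ?z)\<^sup>2 \<le> (p + ?t - p * ?t) * ((A + ?z)\<^sup>2 + (R + r))"
    by (simp add: algebra_simps)
  thus ?case
    unfolding q using IH r by (simp add: A_def R_def r_def)
qed auto

text \<open>The weight \<open>M\<close> is a parameter because one flow is used with three of them:
  the means of the truncated process, the true means, and the generation sizes of
  \<open>\<Delta>\<close>. Words outside the tree also satisfy the flow equation; the flow
  constructed later vanishes there.\<close>

definition spreading_flow :: "(nat \<Rightarrow> real) \<Rightarrow> (nat list \<Rightarrow> nat) \<Rightarrow> real \<Rightarrow> nat \<Rightarrow> (nat list \<Rightarrow> real) \<Rightarrow> bool" where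
  "spreading_flow M K C N \<mu> \<longleftrightarrow> \<mu> [] = 1 \<and>
     (\<forall>v. length v < N \<longrightarrow> \<mu> v = (\<Sum>i<K v. \<mu> (v @ [i]))) \<and>
     (\<forall>j\<le>N. M j * (\<Sum>v\<in>level K j. (\<mu> v)\<^sup>2) \<le> C)"

text \<open>The probability that some path through \<open>v\<close> of length \<open>length v + n\<close> has its labels in \<open>D\<close>, given
  that the labels on the path to \<open>v\<close> are the first \<open>length v\<close> entries of \<open>x\<close>.\<close>

primrec hit :: "real measure \<Rightarrow> (nat \<Rightarrow> real) set \<Rightarrow> (nat list \<Rightarrow> nat) \<Rightarrow> nat \<Rightarrow> nat list \<Rightarrow> (nat \<Rightarrow> real) \<Rightarrow> real" where
  "hit F D K 0 v x = indicator D x"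
| "hit F D K (Suc n) v x = 1 - (\<Prod>i<K v. 1 - avg F (length v) (hit F D K n (v @ [i])) x)"

text \<open>The part of the energy of the flow \<open>\<psi>\<close> that is carried by the \<open>n\<close> generations below \<open>v\<close>.\<close>

primrec excess :: "real measure \<Rightarrow> (nat list \<Rightarrow> nat) \<Rightarrow> (nat list \<Rightarrow> (nat \<Rightarrow> real) \<Rightarrow> real) \<Rightarrow>
    nat \<Rightarrow> nat list \<Rightarrow> (nat \<Rightarrow> real) \<Rightarrow> real" where
  "excess F K \<psi> 0 v x = 0"
| "excess F K \<psi> (Suc n) v x =
     (\<Sum>i<K v. avg F (length v) (excess F K \<psi> n (v @ [i])) x + var F (length v) (\<psi> (v @ [i])) x)"

section \<open>Hitting probabilities and energy for an event of finitely many labels\<close>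

locale truncated_event =
  fixes F :: "real measure" and D :: "(nat \<Rightarrow> real) set" and N :: nat
  assumes F: "real_distribution F"
    and D_meas: "D \<in> sets seq_space"
    and D_local: "\<And>x y. (\<And>i. i < N \<Longrightarrow> x i = y i) \<Longrightarrow> x \<in> D \<Longrightarrow> y \<in> D"
begin

lemma hit_01: "0 \<le> hit F D K n v x \<and> hit F D K n v x \<le> 1" and bdd_meas_hit: "bdd_meas (hit F D K n v)"
proof -
  have "bdd_meas (hit F D K n v) \<and> (\<forall>x. 0 \<le> hit F D K n v x \<and> hit F D K n v x \<le> 1)"
  proof (induction n arbitrary: v)
    case 0
    have "indicator D \<in> borel_measurable seq_space" using D_meas by measurable
    moreover have "hit F D K 0 v = indicator D" by (simp add: fun_eq_iff)
    ultimately show ?case unfolding bdd_meas_def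
      by (auto simp: indicator_def intro!: exI[of _ 1])
  next
    case (Suc n)
    have "0 \<le> avg F k (hit F D K n w) x \<and> avg F k (hit F D K n w) x \<le> 1" for k w x
      using avg_nonneg[OF F, of "hit F D K n w" k x] avg_mono[OF F, of "hit F D K n w" "\<lambda>_. 1" k x] Suc.IH[of w]
        avg_const[OF F, of k 1 x]
      by auto
    hence "0 \<le> (\<Prod>i<K v. 1 - avg F (length v) (hit F D K n (v @ [i])) x) \<and>
        (\<Prod>i<K v. 1 - avg F (length v) (hit F D K n (v @ [i])) x) \<le> 1" for x
      by (auto intro!: prod_nonneg prod_le_1)
    moreover have "bdd_meas (hit F D K (Suc n) v)"
      unfolding hit.simps[abs_def]
      by (intro bdd_meas_diff bdd_meas_const bdd_meas_prod bdd_meas_avg F) (use Suc.IH in auto)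
    ultimately show ?case by (metis (no_types, lifting) diff_ge_0_iff_ge diff_le_eq hit.simps(2) le_add_same_cancel1)
  qed
  thus "0 \<le> hit F D K n v x \<and> hit F D K n v x \<le> 1" "bdd_meas (hit F D K n v)" by auto
qed

lemma avg_hit_01: "0 \<le> avg F k (hit F D K n v) x \<and> avg F k (hit F D K n v) x \<le> 1"
  using avg_nonneg[OF F, of "hit F D K n v" k x] avg_mono[OF F bdd_meas_hit bdd_meas_const, of K n v 1 k x] 
    avg_const[OF F, of k 1 x] hit_01[of K n v] by auto

text \<open>The recursion overwrites the entries from \<open>length v\<close> to
  \<open>N - 1\<close>. What remains of \<open>x\<close> are the entries above \<open>v\<close> and
  those from \<open>N\<close> on, and \<open>D\<close> ignores the latter.\<close>

lemma hit_local:
  "length v + n = N \<Longrightarrow> (\<And>i. i < length v \<Longrightarrow> x i = y i) \<Longrightarrow> hit F D K n v x = hit F D K n v y"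
proof (induction n arbitrary: v x y)
  case 0
  thus ?case using D_local[of x y] D_local[of y x] by (auto simp: indicator_def)
next
  case (Suc n)
  have "hit F D K n (v @ [i]) (x(length v := z)) = hit F D K n (v @ [i]) (y(length v := z))" for i z
    by (rule Suc.IH) (use Suc.prems in auto)
  thus ?case by (simp add: avg_def)
qed

lemma bdd_meas_excess: "(\<And>v. bdd_meas (\<psi> v)) \<Longrightarrow> bdd_meas (excess F K \<psi> n v)"
proof (induction n arbitrary: v)
  case 0
  have "excess F K \<psi> 0 v = (\<lambda>_. 0)" by (simp add: fun_eq_iff)
  thus ?case by simp
next
  case (Suc n)
  have "excess F K \<psi> (Suc n) v = (\<lambda>x. \<Sum>i<K v. avg F (length v) (excess F K \<psi> n (v @ [i])) x + 
      (avg F (length v) (\<lambda>x. (\<psi> (v @ [i]) x)\<^sup>2) x - (avg F (length v) (\<psi> (v @ [i])) x)\<^sup>2))"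
    by (simp add: fun_eq_iff var_def[OF F])
  thus ?case
    by (auto intro!: bdd_meas_sum bdd_meas_add bdd_meas_diff bdd_meas_power2 bdd_meas_avg F Suc)
qed

lemma excess_nonneg: "(\<And>v. bdd_meas (\<psi> v)) \<Longrightarrow> 0 \<le> excess F K \<psi> n v x"
  by (induction n arbitrary: v x) (auto intro!: sum_nonneg add_nonneg_nonneg avg_nonneg var_nonneg F)

lemma sum_excess_Suc:
  assumes "\<And>v. bdd_meas (\<psi> v)"
  shows "(\<Sum>v\<in>level K k. excess F K \<psi> (Suc n) v x) =
    avg F k (\<lambda>x. \<Sum>w\<in>level K (Suc k). excess F K \<psi> n w x) x + (\<Sum>w\<in>level K (Suc k). var F k (\<psi> w) x)"
proof -
  have "avg F k (\<lambda>x. \<Sum>w\<in>level K (Suc k). excess F K \<psi> n w x) x = (\<Sum>w\<in>level K (Suc k). avg F k (excess F K \<psi> n w) x)"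
    by (intro avg_sum F bdd_meas_excess assms)
  thus ?thesis
    by (simp add: sum_level_Suc sum.distrib length_level)
qed

section \<open>The first path with labels in the event\<close>

context
  fixes K :: "nat list \<Rightarrow> nat"
begin

abbreviation P where "P v \<equiv> hit F D K (N - length v) v"

text \<open>Entry \<open>length v - 1\<close> is the label of \<open>v\<close> itself, so this
  conditions only on the labels of the proper ancestors of \<open>v\<close>.\<close>

definition \<tau> where "\<tau> v = avg F (length v - 1) (P v)"

text \<open>The probability that no path to the left of \<open>v\<close> has its labels in \<open>D\<close>; the product is over the
  left siblings of \<open>v\<close> and of its ancestors. Hence \<open>first_path v\<close> is the probability that the
  first path with labels in \<open>D\<close> passes through \<open>v\<close>.\<close>

definition left_miss where
  "left_miss v x = (\<Prod>l<length v. \<Prod>j<v ! l. 1 - \<tau> (take l v @ [j]) x)"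

definition first_path where "first_path v x = left_miss v x * P v x"

lemma left_miss_Nil: "left_miss [] x = 1"
  by (simp add: left_miss_def)

lemma left_miss_snoc: "left_miss (v @ [i]) x = left_miss v x * (\<Prod>j<i. 1 - \<tau> (v @ [j]) x)"
proof -
  have "(\<Prod>l<length v. \<Prod>j<(v @ [i]) ! l. 1 - \<tau> (take l (v @ [i]) @ [j]) x) = left_miss v x"
    unfolding left_miss_def by (intro prod.cong) (auto simp: nth_append)
  thus ?thesis by (simp add: left_miss_def)
qed

lemma \<tau>_local:
  assumes "length w < N" "\<And>i. i < length w \<Longrightarrow> x i = y i"
  shows "\<tau> (w @ [j]) x = \<tau> (w @ [j]) y"
proof -
  have "P (w @ [j]) (x(length w := z)) = P (w @ [j]) (y(length w := z))" for z
    by (rule hit_local) (use assms in auto)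
  thus ?thesis by (simp add: \<tau>_def avg_def)
qed

text \<open>The left siblings of \<open>v\<close> hang from its parent, so their
  \<open>\<tau>\<close> sees only labels strictly above \<open>v\<close>. Hence
  \<open>left_miss\<close> may be taken out of the average over the label of
  \<open>v\<close>.\<close>

lemma left_miss_local:
  assumes "length v \<le> N" "\<And>i. i < length v - 1 \<Longrightarrow> x i = y i"
  shows "left_miss v x = left_miss v y"
  unfolding left_miss_def
proof (intro prod.cong refl, goal_cases)
  case (1 l j)
  thus ?case using \<tau>_local[of "take l v" x y j] assms by simp
qed

lemma bdd_meas_first_path: "bdd_meas (first_path v)"
  unfolding first_path_def[abs_def] left_miss_def \<tau>_def
  by (intro bdd_meas_mult bdd_meas_prod bdd_meas_diff bdd_meas_const bdd_meas_avg F bdd_meas_hit)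

lemma P_eq: "length v < N \<Longrightarrow> P v x = 1 - (\<Prod>i<K v. 1 - \<tau> (v @ [i]) x)"
  by (simp add: \<tau>_def Suc_diff_Suc[symmetric] del: Suc_diff_Suc)

lemma avg_left_miss:
  "length v < N \<Longrightarrow> avg F (length v) (\<lambda>x. left_miss (v @ [i]) x * h x) x = left_miss (v @ [i]) x * avg F (length v) h x"
  by (rule avg_local_cmult[OF F]) (rule left_miss_local, auto)

lemma avg_first_path:
  assumes "length v < N"
  shows "avg F (length v) (first_path (v @ [i])) x = left_miss (v @ [i]) x * \<tau> (v @ [i]) x"
  using avg_left_miss[OF assms, of i "P (v @ [i])" x] by (simp add: first_path_def[abs_def] \<tau>_def)

text \<open>A first path through \<open>v\<close> continues through exactly one child, the leftmost
  one whose subtree succeeds; this makes the first-path weights a flow.\<close>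

lemma sum_avg_first_path:
  assumes "length v < N"
  shows "(\<Sum>i<K v. avg F (length v) (first_path (v @ [i])) x) = first_path v x"
  using one_minus_prod_telescope[of "\<lambda>i. \<tau> (v @ [i]) x" "K v"] 
  by (simp add: avg_first_path[OF assms] left_miss_snoc mult.assoc sum_distrib_left[symmetric]
      first_path_def P_eq[OF assms])

text \<open>The terms are differences of squares, so that the sum over the children telescopes.\<close>

lemma excess_first_path_le:
  "length v + n = N \<Longrightarrow> excess F K first_path n v x \<le> (left_miss v x)\<^sup>2 * (2 * P v x - (P v x)\<^sup>2)"
proof (induction n arbitrary: v x)
  case 0
  thus ?case by (auto simp: indicator_def)
next
  case (Suc n)
  have v: "length v < N" using Suc.prems by simp
  let ?k = "length v" and ?t = "\<lambda>i. \<tau> (v @ [i]) x" and ?a = "\<lambda>i. left_miss (v @ [i]) x"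
  have "excess F K first_path (Suc n) v x \<le> (\<Sum>i<K v. (?a i)\<^sup>2 * (2 * ?t i - (?t i)\<^sup>2))"
    unfolding excess.simps
  proof (rule sum_mono)
    fix i
    let ?w = "v @ [i]"
    have b: "bdd_meas (P ?w)" by (rule bdd_meas_hit)
    have a: "avg F ?k (\<lambda>x. (left_miss ?w x)\<^sup>2 * h x) x = (?a i)\<^sup>2 * avg F ?k h x" for h
      by (rule avg_local_cmult[OF F], rule arg_cong[where f="\<lambda>a. a\<^sup>2"], rule left_miss_local) (use v in auto)
    have "avg F ?k (excess F K first_path n ?w) x \<le> 
        avg F ?k (\<lambda>x. (left_miss ?w x)\<^sup>2 * (2 * P ?w x - (P ?w x)\<^sup>2)) x"
    proof (rule avg_mono[OF F])
      show "bdd_meas (\<lambda>x. (left_miss ?w x)\<^sup>2 * (2 * P ?w x - (P ?w x)\<^sup>2))"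
        unfolding left_miss_def \<tau>_def
        by (intro bdd_meas_mult bdd_meas_power2 bdd_meas_prod bdd_meas_diff bdd_meas_const bdd_meas_avg F bdd_meas_hit)
      show "excess F K first_path n ?w x \<le> (left_miss ?w x)\<^sup>2 * (2 * P ?w x - (P ?w x)\<^sup>2)" for x
        by (rule Suc.IH) (use Suc.prems in simp)
    qed (intro bdd_meas_excess bdd_meas_first_path)
    also have "\<dots> = (?a i)\<^sup>2 * avg F ?k (\<lambda>x. 2 * P ?w x - (P ?w x)\<^sup>2) x" by (rule a)
    also have "avg F ?k (\<lambda>x. 2 * P ?w x - (P ?w x)\<^sup>2) x = 2 * ?t i - avg F ?k (\<lambda>x. (P ?w x)\<^sup>2) x"
      using b by (subst avg_diff[OF F]) (auto simp: \<tau>_def avg_cmult[OF F] intro!: bdd_meas_mult bdd_meas_power2)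
    finally have 1: "avg F ?k (excess F K first_path n ?w) x \<le> (?a i)\<^sup>2 * (2 * ?t i - avg F ?k (\<lambda>x. (P ?w x)\<^sup>2) x)" .
    have "avg F ?k (\<lambda>x. (first_path ?w x)\<^sup>2) x = (?a i)\<^sup>2 * avg F ?k (\<lambda>x. (P ?w x)\<^sup>2) x"
      using a[of "\<lambda>x. (P ?w x)\<^sup>2"] by (simp add: first_path_def power_mult_distrib)
    hence 2: "var F ?k (first_path ?w) x = (?a i)\<^sup>2 * avg F ?k (\<lambda>x. (P ?w x)\<^sup>2) x - (?a i)\<^sup>2 * (?t i)\<^sup>2"
      by (simp add: var_def[OF F] avg_first_path[OF v] power_mult_distrib)
    \<comment> \<open>The second moment of \<open>P ?w\<close>, on which no bound is available,
      cancels between \<open>1\<close> and \<open>2\<close>. The form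
      \<open>2 * P - P\<^sup>2\<close> of the claim is made for this.\<close>
    show "avg F ?k (excess F K first_path n ?w) x + var F ?k (first_path ?w) x \<le> (?a i)\<^sup>2 * (2 * ?t i - (?t i)\<^sup>2)"
      using 1 2 by (simp add: algebra_simps)
  qed
  \<comment> \<open>Replacing a success probability \<open>t\<close> by
    \<open>2 * t - t\<^sup>2\<close> squares the failure probability \<open>1 - t\<close>, so the
    squared weights telescope in the same way as the weights.\<close>
  also have "\<dots> = (left_miss v x)\<^sup>2 * (\<Sum>i<K v. (\<Prod>j<i. 1 - (2 * ?t j - (?t j)\<^sup>2)) * (2 * ?t i - (?t i)\<^sup>2))"
  proof -
    have "1 - (2 * ?t j - (?t j)\<^sup>2) = (1 - ?t j)\<^sup>2" for j by (simp add: power2_eq_square algebra_simps)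
    thus ?thesis
      by (simp add: left_miss_snoc power_mult_distrib prod_power_distrib sum_distrib_left mult.assoc)
  qed
  also have "(\<Sum>i<K v. (\<Prod>j<i. 1 - (2 * ?t j - (?t j)\<^sup>2)) * (2 * ?t i - (?t i)\<^sup>2)) =
      1 - (\<Prod>j<K v. 1 - (2 * ?t j - (?t j)\<^sup>2))"
    by (rule one_minus_prod_telescope)
  also have "\<dots> = 1 - (\<Prod>j<K v. 1 - ?t j)\<^sup>2"
  proof -
    have "1 - (2 * ?t j - (?t j)\<^sup>2) = (1 - ?t j)\<^sup>2" for j by (simp add: power2_eq_square algebra_simps)
    thus ?thesis by (simp add: prod_power_distrib)
  qed
  also have "(\<Prod>j<K v. 1 - ?t j) = 1 - P v x" using P_eq[OF v] by simp
  also have "1 - (1 - P v x)\<^sup>2 = 2 * P v x - (P v x)\<^sup>2" by (simp add: power2_eq_square algebra_simps)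
  finally show ?case .
qed

text \<open>All vertices of the generation are evaluated at the same sequence \<open>x\<close>. This
  forgets which path carried the labels, so that the density can be used on another tree.\<close>

definition flow_density where "flow_density k x = (\<Sum>v\<in>level K k. first_path v x)"

lemma bdd_meas_flow_density: "bdd_meas (flow_density k)"
  unfolding flow_density_def[abs_def] by (intro bdd_meas_sum bdd_meas_first_path)

lemma avg_flow_density:
  assumes "k < N" shows "avg F k (flow_density (Suc k)) x = flow_density k x"
proof -
  have "avg F k (flow_density (Suc k)) x = (\<Sum>w\<in>level K (Suc k). avg F k (first_path w) x)"
    unfolding flow_density_def[abs_def] by (intro avg_sum F bdd_meas_first_path)
  also have "\<dots> = (\<Sum>v\<in>level K k. \<Sum>i<K v. avg F (length v) (first_path (v @ [i])) x)"
    by (simp add: sum_level_Suc length_level)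
  also have "\<dots> = flow_density k x"
    unfolding flow_density_def using assms by (intro sum.cong sum_avg_first_path) (auto simp: length_level)
  finally show ?thesis .
qed

lemma flow_density_0: "flow_density 0 x = hit F D K N [] x"
  by (simp add: flow_density_def first_path_def left_miss_Nil)

lemma flow_density_N: "x \<notin> D \<Longrightarrow> flow_density N x = 0"
  by (simp add: flow_density_def first_path_def length_level)

end

text \<open>The second moment method for the sum of \<open>\<psi>\<close> over the vertices of
  generation \<open>N\<close> below \<open>v\<close>, by recursion on the generations.
  Cauchy-Schwarz deals with the label of each child, \<open>second_moment_union_step\<close> with
  the independence of the subtrees; \<open>(\<psi> v x)\<^sup>2 + excess\<close> is the second
  moment of the sum.\<close>

lemma hit_second_moment:
  fixes \<psi> :: "nat list \<Rightarrow> (nat \<Rightarrow> real) \<Rightarrow> real"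
  assumes b: "\<And>v. bdd_meas (\<psi> v)"
    and flow: "\<And>v x. length v < N \<Longrightarrow> \<psi> v x = (\<Sum>i<K v. avg F (length v) (\<psi> (v @ [i])) x)"
    and D: "\<And>v x. length v = N \<Longrightarrow> x \<notin> D \<Longrightarrow> \<psi> v x = 0"
  shows "length v + n = N \<Longrightarrow> (\<psi> v x)\<^sup>2 \<le> hit F D K n v x * ((\<psi> v x)\<^sup>2 + excess F K \<psi> n v x)"
proof (induction n arbitrary: v x)
  case 0
  thus ?case using D[of v x] by (auto simp: indicator_def)
next
  case (Suc n)
  have v: "length v < N" using Suc.prems by simp
  let ?k = "length v"
  let ?S = "\<lambda>i x. (\<psi> (v @ [i]) x)\<^sup>2 + excess F K \<psi> n (v @ [i]) x"
  have bS: "bdd_meas (?S i)" for i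
    by (intro bdd_meas_add bdd_meas_power2 b bdd_meas_excess)
  have "(avg F ?k (\<psi> (v @ [i])) x)\<^sup>2 \<le> avg F ?k (hit F D K n (v @ [i])) x * avg F ?k (?S i) x" for i
    by (rule avg_cauchy_schwarz[OF F]) (use Suc.IH Suc.prems hit_01 excess_nonneg[OF b] in 
        \<open>auto intro!: b bdd_meas_hit bS add_nonneg_nonneg\<close>)
  moreover have "0 \<le> avg F ?k (?S i) x" for i
    by (intro avg_nonneg F add_nonneg_nonneg excess_nonneg b) auto
  ultimately have "(\<Sum>i<K v. avg F ?k (\<psi> (v @ [i])) x)\<^sup>2 \<le> hit F D K (Suc n) v x * 
     ((\<Sum>i<K v. avg F ?k (\<psi> (v @ [i])) x)\<^sup>2 + (\<Sum>i<K v. avg F ?k (?S i) x - (avg F ?k (\<psi> (v @ [i])) x)\<^sup>2))"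
    using second_moment_union_step[of "K v" "\<lambda>i. avg F ?k (\<psi> (v @ [i])) x" "\<lambda>i. avg F ?k (hit F D K n (v @ [i])) x"
        "\<lambda>i. avg F ?k (?S i) x"] avg_hit_01 by simp
  moreover have "avg F ?k (?S i) x = avg F ?k (\<lambda>x. (\<psi> (v @ [i]) x)\<^sup>2) x + avg F ?k (excess F K \<psi> n (v @ [i])) x" for i
    by (intro avg_add F bdd_meas_power2 b bdd_meas_excess)
  ultimately show ?case
    by (simp add: flow[OF v] var_def[OF F] algebra_simps)
qed

text \<open>In each generation the energy of \<open>\<psi>\<close> is the sum of
  \<open>\<mu>\<^sup>2\<close> times a variance of \<open>\<phi>\<close>. Splitting that variance
  over the vertices of \<open>K\<^sub>1\<close> costs their number, and \<open>C\<close> bounds the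
  product. As the energy of the first path is at most \<open>2 * p\<close>, one factor
  \<open>p\<close> cancels and the comparison is linear; the 2 in the conclusion is this 2.\<close>

lemma hit_comparison:
  fixes K\<^sub>1 K\<^sub>2 :: "nat list \<Rightarrow> nat" and \<mu> :: "nat list \<Rightarrow> real"
  assumes \<mu>: "spreading_flow (\<lambda>k. real (card (level K\<^sub>1 k))) K\<^sub>2 C N \<mu>" and C: "1 \<le> C"
  shows "hit F D K\<^sub>1 N [] x \<le> 2 * C * hit F D K\<^sub>2 N [] x"
proof -
  have \<mu>_Nil: "\<mu> [] = 1" and \<mu>_flow: "\<And>v. length v < N \<Longrightarrow> \<mu> v = (\<Sum>i<K\<^sub>2 v. \<mu> (v @ [i]))"
    and \<mu>_card: "\<And>k. k \<le> N \<Longrightarrow> card (level K\<^sub>1 k) * (\<Sum>v\<in>level K\<^sub>2 k. (\<mu> v)\<^sup>2) \<le> C"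
    using \<mu> unfolding spreading_flow_def by blast+
  define \<phi> where "\<phi> = flow_density K\<^sub>1"
  define \<psi> where "\<psi> v x = \<mu> v * \<phi> (length v) x" for v x
  have b: "bdd_meas (\<psi> v)" for v
    unfolding \<psi>_def \<phi>_def by (intro bdd_meas_mult bdd_meas_const bdd_meas_flow_density)
  have flow: "\<psi> v x = (\<Sum>i<K\<^sub>2 v. avg F (length v) (\<psi> (v @ [i])) x)" if "length v < N" for v x
  proof -
    have "avg F (length v) (\<psi> (v @ [i])) x = \<mu> (v @ [i]) * \<phi> (length v) x" for i
      using that by (simp add: \<psi>_def[abs_def] avg_cmult[OF F] \<phi>_def avg_flow_density)
    thus ?thesis using that by (simp add: \<psi>_def \<mu>_flow sum_distrib_right)
  qed
  have level: "(\<Sum>v\<in>level K\<^sub>2 k. excess F K\<^sub>2 \<psi> n v x) \<le> C * (\<Sum>v\<in>level K\<^sub>1 k. excess F K\<^sub>1 (first_path K\<^sub>1) n v x)"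
    if "k + n = N" for k n x
    using that
  proof (induction n arbitrary: k x)
    case (Suc n)
    let ?s = "\<Sum>w\<in>level K\<^sub>2 (Suc k). (\<mu> w)\<^sup>2"
    note b1 = bdd_meas_first_path[of K\<^sub>1]
    have "avg F k (\<lambda>x. \<Sum>w\<in>level K\<^sub>2 (Suc k). excess F K\<^sub>2 \<psi> n w x) x \<le> 
        avg F k (\<lambda>x. C * (\<Sum>w\<in>level K\<^sub>1 (Suc k). excess F K\<^sub>1 (first_path K\<^sub>1) n w x)) x"
      by (intro avg_mono F bdd_meas_sum bdd_meas_mult bdd_meas_const bdd_meas_excess b b1 Suc.IH)
        (use Suc.prems in auto)
    also have "\<dots> = C * avg F k (\<lambda>x. \<Sum>w\<in>level K\<^sub>1 (Suc k). excess F K\<^sub>1 (first_path K\<^sub>1) n w x) x"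
      by (rule avg_cmult[OF F])
    finally have 1: "avg F k (\<lambda>x. \<Sum>w\<in>level K\<^sub>2 (Suc k). excess F K\<^sub>2 \<psi> n w x) x \<le> \<dots>" .
    have "(\<Sum>w\<in>level K\<^sub>2 (Suc k). var F k (\<psi> w) x) = ?s * var F k (\<phi> (Suc k)) x"
    proof -
      have "var F k (\<psi> w) x = (\<mu> w)\<^sup>2 * var F k (\<phi> (Suc k)) x" if "w \<in> level K\<^sub>2 (Suc k)" for w
        using length_level[OF that] unfolding \<psi>_def[abs_def] var_def[OF F]
        by (simp add: power_mult_distrib avg_cmult[OF F] algebra_simps)
      thus ?thesis by (simp add: sum_distrib_right)
    qed
    also have "\<dots> \<le> ?s * (card (level K\<^sub>1 (Suc k)) * (\<Sum>w\<in>level K\<^sub>1 (Suc k). var F k (first_path K\<^sub>1 w) x))"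
      unfolding \<phi>_def flow_density_def[abs_def]
      by (intro mult_left_mono var_sum_le F b1 sum_nonneg) auto
    also have "\<dots> = (card (level K\<^sub>1 (Suc k)) * ?s) * (\<Sum>w\<in>level K\<^sub>1 (Suc k). var F k (first_path K\<^sub>1 w) x)"
      by simp
    also have "\<dots> \<le> C * (\<Sum>w\<in>level K\<^sub>1 (Suc k). var F k (first_path K\<^sub>1 w) x)"
      using Suc.prems by (intro mult_right_mono \<mu>_card sum_nonneg var_nonneg F b1) auto
    finally show ?case using 1
      unfolding sum_excess_Suc[of \<psi>, OF b] sum_excess_Suc[of "first_path K\<^sub>1", OF b1] by (simp add: distrib_left)
  qed auto
  let ?p = "hit F D K\<^sub>1 N [] x" and ?q = "hit F D K\<^sub>2 N [] x"
  have p: "0 \<le> ?p" "?p \<le> 1" and q: "0 \<le> ?q" using hit_01 by auto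
  have "(\<psi> [] x)\<^sup>2 \<le> ?q * ((\<psi> [] x)\<^sup>2 + excess F K\<^sub>2 \<psi> N [] x)"
    by (rule hit_second_moment[OF b flow]) (auto simp: \<psi>_def \<phi>_def flow_density_N)
  also have "\<psi> [] x = ?p" by (simp add: \<psi>_def \<mu>_Nil \<phi>_def flow_density_0)
  finally have "?p\<^sup>2 \<le> ?q * (?p\<^sup>2 + excess F K\<^sub>2 \<psi> N [] x)" .
  also have "\<dots> \<le> ?q * (C * (2 * ?p))"
  proof (rule mult_left_mono[OF _ q])
    have "excess F K\<^sub>1 (first_path K\<^sub>1) N [] x \<le> 2 * ?p - ?p\<^sup>2"
      using excess_first_path_le[of "[]" N K\<^sub>1 x] by (simp add: left_miss_Nil)
    hence "C * excess F K\<^sub>1 (first_path K\<^sub>1) N [] x \<le> C * (2 * ?p - ?p\<^sup>2)" using C by simp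
    \<comment> \<open>The squared mean is absorbed by the negative term of the energy bound, which
      is the purpose of \<open>1 \<le> C\<close>.\<close>
    moreover have "1 * ?p\<^sup>2 \<le> C * ?p\<^sup>2" using C by (intro mult_right_mono) auto
    ultimately show "?p\<^sup>2 + excess F K\<^sub>2 \<psi> N [] x \<le> C * (2 * ?p)"
      using level[of 0 N x] by (simp add: algebra_simps)
  qed
  finally have "?p * ?p \<le> (2 * C * ?q) * ?p" by (simp add: power2_eq_square algebra_simps)
  thus ?thesis using p C q by (cases "?p = 0") (auto simp: mult_le_cancel_right)
qed

end

section \<open>Hitting probabilities of finite trees\<close>

definition depends_on :: "'i set \<Rightarrow> (('i \<Rightarrow> 'a) \<Rightarrow> 'b) \<Rightarrow> bool" where
  "depends_on A f \<longleftrightarrow> (\<forall>x y. (\<forall>i\<in>A. x i = y i) \<longrightarrow> f x = f y)"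

lemma depends_onD: "depends_on A f \<Longrightarrow> (\<And>i. i \<in> A \<Longrightarrow> x i = y i) \<Longrightarrow> f x = f y"
  by (auto simp: depends_on_def)

lemma depends_on_mono: "depends_on A f \<Longrightarrow> A \<subseteq> B \<Longrightarrow> depends_on B f"
  unfolding depends_on_def by blast

lemma depends_on_compose2:
  assumes "depends_on A f" "depends_on A g" shows "depends_on A (\<lambda>x. h (f x) (g x))"
  using depends_onD[OF assms(1)] depends_onD[OF assms(2)]
  unfolding depends_on_def by (intro allI impI arg_cong2[where f=h]) blast+

section \<open>Independence of functions of disjoint sets of coordinates\<close>

locale full_product =
  fixes M :: "'i \<Rightarrow> 'a measure"
  assumes prob: "\<And>i. prob_space (M i)" and space_M [simp]: "\<And>i. space (M i) = UNIV"
begin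

abbreviation "\<Omega> \<equiv> Pi\<^sub>M UNIV M"

sublocale prob_space \<Omega>
  by (rule prob_space_PiM) (rule prob)

lemma space_\<Omega> [simp]: "space \<Omega> = UNIV"
  by (auto simp: space_PiM)

lemma indep_coordinates: "indep_vars M (\<lambda>i \<omega>. \<omega> i) UNIV"
proof (subst indep_vars_iff_distr_eq_PiM')
  have "distr \<Omega> (M i) (\<lambda>\<omega>. \<omega> i) = M i" for i
    using distr_PiM_component[of UNIV M i] prob by auto
  thus "distr \<Omega> \<Omega> (\<lambda>x. \<lambda>i\<in>UNIV. x i) = Pi\<^sub>M UNIV (\<lambda>i. distr \<Omega> (M i) (\<lambda>\<omega>. \<omega> i))"
    by (simp add: restrict_def)
qed auto

lemma expectation_mult_disjoint:
  fixes f g :: "('i \<Rightarrow> 'a) \<Rightarrow> real"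
  assumes f: "integrable \<Omega> f" "depends_on A f" and g: "integrable \<Omega> g" "depends_on B g"
    and AB: "A \<inter> B = {}"
  shows "expectation (\<lambda>x. f x * g x) = expectation f * expectation g"
proof -
  \<comment> \<open>Filling the missing coordinates with an arbitrary value lets a function that
    depends only on \<open>C\<close> factor through the restriction to \<open>C\<close>, to which
    independence of restrictions applies.\<close>
  define extend where "extend C y = (\<lambda>i. if i \<in> C then y i else undefined)" for C :: "'i set" and y :: "'i \<Rightarrow> 'a"
  have extend: "extend C \<in> measurable (Pi\<^sub>M C M) \<Omega>" for C
  proof (rule measurable_PiM_single')
    show "(\<lambda>y. extend C y i) \<in> measurable (Pi\<^sub>M C M) (M i)" for i
      by (cases "i \<in> C") (auto simp: extend_def)
  qed (auto simp: space_PiM)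
  have [measurable]: "f \<in> borel_measurable \<Omega>" "g \<in> borel_measurable \<Omega>"
    using f g by auto
  have "indep_var borel (\<lambda>x. (f \<circ> extend A) (restrict x A)) borel (\<lambda>x. (g \<circ> extend B) (restrict x B))"
    using indep_var_compose[OF indep_var_restrict[OF indep_coordinates AB], of "f \<circ> extend A" borel "g \<circ> extend B" borel]
      measurable_comp[OF extend, of f borel A] measurable_comp[OF extend, of g borel B]
    by (simp add: o_def)
  moreover have "(\<lambda>x. (f \<circ> extend A) (restrict x A)) = f" "(\<lambda>x. (g \<circ> extend B) (restrict x B)) = g"
    by (rule ext, simp, rule depends_onD[OF f(2)], simp add: extend_def)
      (rule ext, simp, rule depends_onD[OF g(2)], simp add: extend_def)
  ultimately have "indep_var borel f borel g" by simp
  thus ?thesis using f(1) g(1) by (rule indep_var_lebesgue_integral)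
qed

lemma integrable_bounded:
  "f \<in> borel_measurable \<Omega> \<Longrightarrow> (\<And>x. \<bar>f x\<bar> \<le> c) \<Longrightarrow> integrable \<Omega> (f :: _ \<Rightarrow> real)"
  by (rule integrable_const_bound[of _ c]) auto

lemma expectation_prod_disjoint:
  fixes f :: "nat \<Rightarrow> ('i \<Rightarrow> 'a) \<Rightarrow> real"
  assumes "\<And>i. f i \<in> borel_measurable \<Omega>" "\<And>i x. \<bar>f i x\<bar> \<le> 1" "\<And>i. depends_on (A i) (f i)"
    and "\<And>i j. i \<noteq> j \<Longrightarrow> A i \<inter> A j = {}"
  shows "expectation (\<lambda>x. \<Prod>i<n. f i x) = (\<Prod>i<n. expectation (f i))"
proof (induction n)
  case (Suc n)
  have [measurable]: "f i \<in> borel_measurable \<Omega>" for i by fact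
  have "expectation (\<lambda>x. (\<Prod>i<n. f i x) * f n x) = expectation (\<lambda>x. \<Prod>i<n. f i x) * expectation (f n)"
  proof (rule expectation_mult_disjoint)
    show "integrable \<Omega> (\<lambda>x. \<Prod>i<n. f i x)"
      by (rule integrable_bounded[of _ 1]) (measurable, simp add: abs_prod assms(2) prod_le_1)
    show "integrable \<Omega> (f n)" by (rule integrable_bounded[of _ 1]) (auto simp: assms)
    show "depends_on (\<Union>i<n. A i) (\<lambda>x. \<Prod>i<n. f i x)"
      unfolding depends_on_def
    proof (intro allI impI prod.cong refl)
      fix x y :: "'i \<Rightarrow> 'a" and i assume *: "\<forall>j\<in>\<Union>i<n. A i. x j = y j" and i: "i \<in> {..<n}"
      show "f i x = f i y" by (rule depends_onD[OF assms(3)[of i]]) (use * i in auto)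
    qed
    have "A i \<inter> A n = {}" if "i < n" for i using assms(4)[of i n] that by simp
    thus "(\<Union>i<n. A i) \<inter> A n = {}" by blast
  qed (rule assms)
  with Suc show ?case by simp
qed (use prob_space in simp)

text \<open>Fubini for one coordinate: overwriting entry \<open>c\<close> by an independent draw
  from \<open>M c\<close> does not change the product law.\<close>

lemma expectation_resample:
  fixes h :: "'a \<Rightarrow> ('i \<Rightarrow> 'a) \<Rightarrow> real"
  assumes [measurable]: "(\<lambda>(y, X). h y X) \<in> borel_measurable (M c \<Otimes>\<^sub>M \<Omega>)"
    and b: "\<And>y X. \<bar>h y X\<bar> \<le> b" and dep: "\<And>y. depends_on (- {c}) (h y)"
  shows "expectation (\<lambda>X. h (X c) X) = (\<integral>y. expectation (h y) \<partial>M c)"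
proof -
  interpret Mc: prob_space "M c" by (rule prob)
  interpret Q: pair_prob_space "M c" \<Omega> ..
  have upd [measurable]: "(\<lambda>(x, X). X(c := x)) \<in> measurable (M c \<Otimes>\<^sub>M \<Omega>) \<Omega>"
    unfolding split_beta' by (rule measurable_fun_upd[where J=UNIV]) auto
  have "expectation (\<lambda>X. h (X c) X) =
      (\<integral>X. h (X c) X \<partial>distr (M c \<Otimes>\<^sub>M \<Omega>) \<Omega> (\<lambda>(x, X). X(c := x)))"
    using distr_pair_PiM_eq_PiM[of UNIV M c] prob by simp
  also have "\<dots> = (\<integral>z. h (fst z) ((snd z)(c := fst z)) \<partial>(M c \<Otimes>\<^sub>M \<Omega>))"
    by (subst integral_distr) (auto simp: split_beta')
  also have "\<dots> = (\<integral>(y, X). h y X \<partial>(M c \<Otimes>\<^sub>M \<Omega>))"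
  proof (intro Bochner_Integration.integral_cong refl)
    fix z :: "'a \<times> ('i \<Rightarrow> 'a)"
    have "h (fst z) ((snd z)(c := fst z)) = h (fst z) (snd z)"
      by (rule depends_onD[OF dep]) simp
    thus "h (fst z) ((snd z)(c := fst z)) = (case z of (y, X) \<Rightarrow> h y X)" by (simp add: split_beta)
  qed
  also have "\<dots> = (\<integral>y. expectation (h y) \<partial>M c)"
    by (subst Q.integral_fst'[symmetric]) (auto intro!: Q.P.integrable_const_bound[of _ b] simp: b)
  finally show ?thesis .
qed

end

text \<open>The indicator counterpart of \<open>hit\<close> for a fixed labelling \<open>X\<close>.
  It follows the same recursion, so that its expectation can be computed one generation at a
  time.\<close>

primrec found :: "(nat \<Rightarrow> real) set \<Rightarrow> (nat list \<Rightarrow> nat) \<Rightarrow> (nat list \<Rightarrow> real) \<Rightarrow> nat \<Rightarrow> nat list \<Rightarrow> (nat \<Rightarrow> real) \<Rightarrow> real" where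
  "found D K X 0 v x = indicator D x"
| "found D K X (Suc n) v x = 1 - (\<Prod>i<K v. 1 - found D K X n (v @ [i]) (x(length v := X (v @ [i]))))"

context truncated_event
begin

interpretation F: real_distribution F by (rule F)

interpretation L: full_product "\<lambda>_::nat list. F"
  by unfold_locales (auto simp: F.prob_space_axioms F.space_eq_univ intro: F.prob_space)

lemma found_01: "found D K X n v x \<in> {0, 1}"
proof (induction n arbitrary: v x)
  case (Suc n)
  have "(\<Prod>i<m. 1 - f i) \<in> {0, 1}" if "\<And>i. f i \<in> {0, 1}" for m and f :: "nat \<Rightarrow> real"
  proof (induction m)
    case (Suc m)
    thus ?case using that[of m] by auto
  qed simp
  from this[OF Suc.IH] have "(\<Prod>i<K v. 1 - found D K X n (v @ [i]) (x(length v := X (v @ [i])))) \<in> {0, 1}" .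
  thus ?case by (simp only: found.simps) auto
qed (auto simp: indicator_def)

lemma measurable_found:
  "(\<lambda>(x, X). found D K X n v x) \<in> borel_measurable (seq_space \<Otimes>\<^sub>M L.\<Omega>)"
proof (induction n arbitrary: v)
  case 0
  have [measurable]: "D \<in> sets seq_space" by (rule D_meas)
  show ?case by (simp add: split_beta')
next
  case (Suc n)
  have "(\<lambda>z. (\<lambda>(x, X). found D K X n (v @ [i]) x) ((fst z)(length v := snd z (v @ [i])), snd z))
      \<in> borel_measurable (seq_space \<Otimes>\<^sub>M L.\<Omega>)" for i
  proof (rule measurable_compose[OF _ Suc])
    have "(\<lambda>z. (fst z)(length v := snd z (v @ [i]))) \<in> measurable (seq_space \<Otimes>\<^sub>M L.\<Omega>) seq_space"
      by (rule measurable_fun_upd[where J=UNIV]) auto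
    thus "(\<lambda>z. ((fst z)(length v := snd z (v @ [i])), snd z)) \<in> measurable (seq_space \<Otimes>\<^sub>M L.\<Omega>) (seq_space \<Otimes>\<^sub>M L.\<Omega>)"
      by measurable
  qed
  thus ?case by (simp add: split_beta')
qed

lemma measurable_found' [measurable]: "(\<lambda>X. found D K X n v x) \<in> borel_measurable L.\<Omega>"
  using measurable_compose[OF _ measurable_found, of "\<lambda>X. (x, X)" L.\<Omega> K n v] by (simp add: space_PiM)

lemma found_depends: "depends_on {w. length v < length w \<and> take (length v) w = v} (\<lambda>X. found D K X n v x)"
proof (induction n arbitrary: v x)
  case (Suc n)
  show ?case
    unfolding depends_on_def found.simps
  proof (intro allI impI arg_cong[where f="\<lambda>a. 1 - a"] prod.cong refl)
    fix X Y :: "nat list \<Rightarrow> real" and i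
    assume *: "\<forall>w\<in>{w. length v < length w \<and> take (length v) w = v}. X w = Y w"
    have "X (v @ [i]) = Y (v @ [i])" using * by simp
    moreover have "found D K X n (v @ [i]) z = found D K Y n (v @ [i]) z" for z
    proof (rule depends_onD[OF Suc.IH])
      fix w assume "w \<in> {w. length (v @ [i]) < length w \<and> take (length (v @ [i])) w = v @ [i]}"
      hence "length v < length w" "take (length v) (take (Suc (length v)) w) = take (length v) (v @ [i])" by auto
      thus "X w = Y w" using * by (simp add: min_def)
    qed
    ultimately show "found D K X n (v @ [i]) (x(length v := X (v @ [i]))) = found D K Y n (v @ [i]) (x(length v := Y (v @ [i])))"
      by simp
  qed
qed (auto simp: depends_on_def)

text \<open>The branches through different children read labels at disjoint sets of words, so the
  expectation of the product is the product of the expectations; within one branch the label of the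
  child is integrated separately from the labels below it.\<close>

lemma expectation_found: "L.expectation (\<lambda>X. found D K X n v x) = hit F D K n v x"
proof (induction n arbitrary: v x)
  case 0
  thus ?case using L.prob_space by simp
next
  case (Suc n)
  let ?f = "\<lambda>i X. found D K X n (v @ [i]) (x(length v := X (v @ [i])))"
  let ?A = "\<lambda>i. {w. length v < length w \<and> take (Suc (length v)) w = v @ [i]}"
  have b: "\<bar>found D K X n w y\<bar> \<le> 1" "\<bar>1 - found D K X n w y\<bar> \<le> 1" for X w y using found_01[of K X n w y] by auto
  have meas: "(\<lambda>(y, X). found D K X n (v @ [i]) (x(length v := y))) \<in> borel_measurable (F \<Otimes>\<^sub>M L.\<Omega>)" for i
  proof -
    have "(\<lambda>z. (x(length v := fst z), snd z)) \<in> measurable (F \<Otimes>\<^sub>M L.\<Omega>) (seq_space \<Otimes>\<^sub>M L.\<Omega>)"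
      by (intro measurable_Pair measurable_fun_upd[where J=UNIV]) (auto simp: space_PiM)
    from measurable_compose[OF this measurable_found] show ?thesis by (simp add: split_beta')
  qed
  have meas' [measurable]: "?f i \<in> borel_measurable L.\<Omega>" for i
    using measurable_compose[OF _ meas, of "\<lambda>X. (X (v @ [i]), X)" L.\<Omega> i] by simp
  have E: "L.expectation (?f i) = avg F (length v) (hit F D K n (v @ [i])) x" for i
  proof -
    have "L.expectation (?f i) = (\<integral>y. L.expectation (\<lambda>X. found D K X n (v @ [i]) (x(length v := y))) \<partial>F)"
    proof (rule L.expectation_resample[OF meas, where b=1])
      show "depends_on (- {v @ [i]}) (\<lambda>X. found D K X n (v @ [i]) (x(length v := y)))" for y
        by (rule depends_on_mono[OF found_depends]) auto
    qed (rule b)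
    thus ?thesis unfolding Suc avg_def .
  qed
  have "L.expectation (\<lambda>X. \<Prod>i<K v. 1 - ?f i X) = (\<Prod>i<K v. L.expectation (\<lambda>X. 1 - ?f i X))"
  proof (rule L.expectation_prod_disjoint[where A="?A"])
    fix i
    show "depends_on (?A i) (\<lambda>X. 1 - ?f i X)"
      unfolding depends_on_def
    proof (intro allI impI)
      fix X Y :: "nat list \<Rightarrow> real" assume *: "\<forall>w\<in>?A i. X w = Y w"
      have "X (v @ [i]) = Y (v @ [i])" using * by simp
      moreover have "found D K X n (v @ [i]) z = found D K Y n (v @ [i]) z" for z
        by (rule depends_onD[OF found_depends]) (use * in auto)
      ultimately show "1 - ?f i X = 1 - ?f i Y" by simp
    qed
  qed (use b in auto)
  also have "\<dots> = (\<Prod>i<K v. 1 - avg F (length v) (hit F D K n (v @ [i])) x)"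
  proof (intro prod.cong refl)
    fix i
    have "integrable L.\<Omega> (?f i)" by (rule L.integrable_bounded[OF meas' b(1)])
    hence "L.expectation (\<lambda>X. 1 - ?f i X) = 1 - L.expectation (?f i)"
      using L.prob_space by simp
    thus "L.expectation (\<lambda>X. 1 - ?f i X) = 1 - avg F (length v) (hit F D K n (v @ [i])) x"
      by (simp add: E)
  qed
  finally have 1: "L.expectation (\<lambda>X. \<Prod>i<K v. 1 - ?f i X) = \<dots>" .
  have "integrable L.\<Omega> (\<lambda>X. \<Prod>i<K v. 1 - ?f i X)"
    by (rule L.integrable_bounded[of _ 1]) (use b in \<open>auto simp: abs_prod intro!: prod_le_1\<close>)
  thus ?case using L.prob_space by (simp add: 1)
qed

lemma found_iff:
  "v \<in> verts (family_tree K) \<Longrightarrow> length v + n = N \<Longrightarrow> found D K X n v x = 1 \<longleftrightarrow>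
    (\<exists>w\<in>level K N. take (length v) w = v \<and> (\<lambda>i. if i < length v then x i else X (take (Suc i) w)) \<in> D)"
proof (induction n arbitrary: v x)
  case 0
  have "x \<in> D \<longleftrightarrow> (\<lambda>i. if i < length v then x i else X (take (Suc i) w)) \<in> D" for w
    by (rule iffI; erule D_local[rotated]) (use 0 in auto)
  moreover have "v \<in> level K N" using 0 by (auto simp: level_def)
  ultimately show ?case using 0 by (auto simp: level_def indicator_def)
next
  case (Suc n)
  let ?f = "\<lambda>i. found D K X n (v @ [i]) (x(length v := X (v @ [i])))"
  have "found D K X (Suc n) v x = 1 \<longleftrightarrow> (\<exists>i<K v. ?f i = 1)"
    by auto
  also have "\<dots> \<longleftrightarrow> (\<exists>i<K v. \<exists>w\<in>level K N. take (Suc (length v)) w = v @ [i] \<and>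
     (\<lambda>j. if j < length v then x j else X (take (Suc j) w)) \<in> D)"
  proof (intro ex_cong1 conj_cong refl)
    fix i assume i: "i < K v"
    have "?f i = 1 \<longleftrightarrow> (\<exists>w\<in>level K N. take (length (v @ [i])) w = v @ [i] \<and>
        (\<lambda>j. if j < length (v @ [i]) then (x(length v := X (v @ [i]))) j else X (take (Suc j) w)) \<in> D)"
      by (rule Suc.IH) (use Suc.prems i in auto)
    moreover have "(\<lambda>j. if j < length (v @ [i]) then (x(length v := X (v @ [i]))) j else X (take (Suc j) w)) =
      (\<lambda>j. if j < length v then x j else X (take (Suc j) w))" if "take (Suc (length v)) w = v @ [i]" for w
      using that by (auto simp: fun_eq_iff less_Suc_eq)
    ultimately show "?f i = 1 \<longleftrightarrow> (\<exists>w\<in>level K N. take (Suc (length v)) w = v @ [i] \<and>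
       (\<lambda>j. if j < length v then x j else X (take (Suc j) w)) \<in> D)" by auto
  qed
  also have "\<dots> \<longleftrightarrow> (\<exists>w\<in>level K N. take (length v) w = v \<and> (\<lambda>j. if j < length v then x j else X (take (Suc j) w)) \<in> D)"
  proof safe
    fix i w assume "take (Suc (length v)) w = v @ [i]" "w \<in> level K N" 
      "(\<lambda>j. if j < length v then x j else X (take (Suc j) w)) \<in> D"
    moreover from this have "take (length v) (take (Suc (length v)) w) = take (length v) (v @ [i])" by simp
    hence "take (length v) w = v" by (simp add: min_def)
    ultimately show "\<exists>w\<in>level K N. take (length v) w = v \<and> (\<lambda>j. if j < length v then x j else X (take (Suc j) w)) \<in> D"
      by blast
  next
    fix w assume w: "w \<in> level K N" "take (length v) w = v" "(\<lambda>j. if j < length v then x j else X (take (Suc j) w)) \<in> D"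
    have "length v < length w" using w Suc.prems by (auto simp: level_def)
    moreover from this have "w ! length v < K (take (length v) w)" using w(1) by (auto simp: level_def verts_family_tree)
    ultimately show "\<exists>i<K v. \<exists>w\<in>level K N. take (Suc (length v)) w = v @ [i] \<and> (\<lambda>j. if j < length v then x j else X (take (Suc j) w)) \<in> D"
      using w by (intro exI[of _ "w ! length v"] conjI bexI[of _ w]) (auto simp: take_Suc_conv_app_nth)
  qed
  finally show ?case .
qed

lemma level_hit_sets: "{X. \<exists>w\<in>level K N. (\<lambda>i. X (take (Suc i) w)) \<in> D} \<in> sets L.\<Omega>"
proof -
  have "{X. found D K X N [] (\<lambda>_. 0) = 1} \<in> sets L.\<Omega>"
    using measurable_sets[OF measurable_found'[of K N "[]" "\<lambda>_. 0"], of "{1}"] by (simp add: vimage_def)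
  thus ?thesis using found_iff[of "[]" K N _ "\<lambda>_. 0"] by simp
qed

lemma prob_level_hit:
  "measure L.\<Omega> {X. \<exists>w\<in>level K N. (\<lambda>i. X (take (Suc i) w)) \<in> D} = hit F D K N [] x"
proof -
  have "(\<lambda>X. found D K X N [] x) = indicator {X. \<exists>w\<in>level K N. (\<lambda>i. X (take (Suc i) w)) \<in> D}"
    using found_iff[of "[]" K N _ x] found_01[of K _ N "[]" x] by (auto simp: fun_eq_iff indicator_def)
  thus ?thesis using level_hit_sets expectation_found[of K N "[]" x] by simp
qed

end

section \<open>Passage to infinite paths\<close>

text \<open>Open sets decreasing to \<open>B\<close>, the \<open>N\<close>-th one depending on \<open>N\<close> coordinates only. The projections
  of \<open>B\<close> itself need not be measurable cylinders.\<close>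

definition thicken :: "(nat \<Rightarrow> real) set \<Rightarrow> nat \<Rightarrow> (nat \<Rightarrow> real) set" where
  "thicken B N = {x. \<exists>y\<in>B. \<forall>i<N. \<bar>x i - y i\<bar> < 1 / Suc N}"

lemma thicken_local: "(\<And>i. i < N \<Longrightarrow> x i = y i) \<Longrightarrow> x \<in> thicken B N \<Longrightarrow> y \<in> thicken B N"
  unfolding thicken_def by auto

lemma thicken_antimono: "m \<le> n \<Longrightarrow> thicken B n \<subseteq> thicken B m"
proof
  fix x assume "m \<le> n" "x \<in> thicken B n"
  then obtain y where y: "y \<in> B" "\<And>i. i < n \<Longrightarrow> \<bar>x i - y i\<bar> < 1 / Suc n" by (auto simp: thicken_def)
  have "1 / real (Suc n) \<le> 1 / real (Suc m)" using \<open>m \<le> n\<close> by (simp add: frac_le)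
  hence "\<bar>x i - y i\<bar> < 1 / Suc m" if "i < m" for i
    using y(2)[of i] that \<open>m \<le> n\<close> by linarith
  thus "x \<in> thicken B m" using y(1) by (auto simp: thicken_def)
qed

text \<open>This is where closedness enters: a point of all the thickenings is the coordinatewise
  limit of points of \<open>B\<close>.\<close>

lemma Inter_thicken:
  assumes "closed B" shows "(\<Inter>N. thicken B N) = B"
proof
  show "B \<subseteq> (\<Inter>N. thicken B N)" unfolding thicken_def by (auto intro!: bexI)
  show "(\<Inter>N. thicken B N) \<subseteq> B"
  proof
    fix x assume x: "x \<in> (\<Inter>N. thicken B N)"
    hence "\<forall>N. \<exists>y\<in>B. \<forall>i<N. \<bar>x i - y i\<bar> < 1 / Suc N" by (auto simp: thicken_def)
    then obtain y where y: "\<And>N. y N \<in> B" "\<And>N i. i < N \<Longrightarrow> \<bar>x i - y N i\<bar> < 1 / Suc N"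
      by metis
    have *: "\<bar>x i - y (N + Suc i) i\<bar> < 1 / Suc (N + Suc i)" for i N
      using y(2)[of i "N + Suc i"] by simp
    have "(\<lambda>N. y N i) \<longlonglongrightarrow> x i" for i
    proof (rule LIMSEQ_offset[where k="Suc i"], rule tendsto_sandwich)
      show "\<forall>\<^sub>F N in sequentially. x i - 1 / Suc (N + Suc i) \<le> y (N + Suc i) i"
        using *[of i] by (intro always_eventually allI) (simp add: abs_less_iff, smt (verit))
      show "\<forall>\<^sub>F N in sequentially. y (N + Suc i) i \<le> x i + 1 / Suc (N + Suc i)"
        using *[of i] by (intro always_eventually allI) (simp add: abs_less_iff, smt (verit))
      have "(\<lambda>N. 1 / Suc N) \<longlonglongrightarrow> 0" using LIMSEQ_inverse_real_of_nat by (simp add: inverse_eq_divide)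
      from LIMSEQ_ignore_initial_segment[OF this, of "Suc i"]
      show "(\<lambda>N. x i - 1 / Suc (N + Suc i)) \<longlonglongrightarrow> x i" "(\<lambda>N. x i + 1 / Suc (N + Suc i)) \<longlonglongrightarrow> x i"
        by (auto intro: tendsto_eq_intros)
    qed
    hence "y \<longlonglongrightarrow> x"
      using limitin_componentwise[of "\<lambda>_::nat. euclidean :: real topology" UNIV y x sequentially]
      by (simp add: euclidean_product_topology)
    with y(1) assms show "x \<in> B" by (metis closed_sequentially)
  qed
qed

lemma open_thicken: "open (thicken B N)"
proof -
  have "open {x :: nat \<Rightarrow> real. \<forall>i<N. \<bar>x i - y i\<bar> < 1 / Suc N}" for y
  proof -
    have "open (\<Inter>i\<in>{..<N}. {x :: nat \<Rightarrow> real. \<bar>x i - y i\<bar> < 1 / Suc N})"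
      by (intro open_INT open_Collect_less finite_lessThan ballI continuous_intros continuous_on_product_coordinates)
    also have "(\<Inter>i\<in>{..<N}. {x :: nat \<Rightarrow> real. \<bar>x i - y i\<bar> < 1 / Suc N}) = {x. \<forall>i<N. \<bar>x i - y i\<bar> < 1 / Suc N}"
      by auto
    finally show ?thesis .
  qed
  moreover have "thicken B N = (\<Union>y\<in>B. {x. \<forall>i<N. \<bar>x i - y i\<bar> < 1 / Suc N})"
    by (auto simp: thicken_def)
  ultimately show ?thesis by auto
qed

lemma thicken_truncated_event: "real_distribution F \<Longrightarrow> truncated_event F (thicken B N) N"
  by (rule truncated_event.intro) (auto simp: sets_PiM_equal_borel open_thicken elim: thicken_local[rotated])

text \<open>A step towards the root would return to the parent that the path has just left, so
  injectivity forces every step to lead to a child.\<close>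

lemma infinite_path_family_tree:
  "infinite_path (family_tree K) p \<longleftrightarrow> p 0 = [] \<and> (\<forall>n. \<exists>i<K (p n). p (Suc n) = p n @ [i])"
proof safe
  assume p: "infinite_path (family_tree K) p"
  have edge: "p n \<in> verts (family_tree K) \<and> p (Suc n) \<in> verts (family_tree K) \<and>
      (\<exists>i. p (Suc n) = p n @ [i] \<or> p n = p (Suc n) @ [i])" for n
    using p by (auto simp: infinite_path_def family_tree_def Let_def)
  show p0: "p 0 = []" using p by (simp add: infinite_path_def family_tree_def Let_def)
  have inj: "inj p" using p by (simp add: infinite_path_def)
  fix n
  show "\<exists>i<K (p n). p (Suc n) = p n @ [i]"
  proof (induction n)
    case 0
    show ?case using edge[of 0] p0 by (metis Nil_is_append_conv not_Cons_self2 snoc_in_family_tree)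
  next
    case (Suc n)
    then obtain j where j: "p (Suc n) = p n @ [j]" by auto
    have "p (Suc (Suc n)) \<noteq> p n" using injD[OF inj, of "Suc (Suc n)" n] by auto
    hence "p (Suc n) \<noteq> p (Suc (Suc n)) @ [i]" for i using j by auto
    with edge[of "Suc n"] show ?case by (metis snoc_in_family_tree)
  qed
next
  assume p: "p 0 = []" "\<forall>n. \<exists>i<K (p n). p (Suc n) = p n @ [i]"
  have v: "p n \<in> verts (family_tree K)" and l: "length (p n) = n" for n
  proof (induction n)
    case (Suc n)
    { case 1 show ?case using Suc p(2) by (metis snoc_in_family_tree) }
    { case 2 show ?case using Suc p(2) by (metis length_append_singleton) }
  qed (auto simp: p)
  have "inj p" using l by (metis injI)
  moreover have "(p n, p (Suc n)) \<in> edges (family_tree K)" for n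
  proof -
    have "edges (family_tree K) = {(u, v). u \<in> verts (family_tree K) \<and> v \<in> verts (family_tree K) \<and> (\<exists>i. v = u @ [i] \<or> u = v @ [i])}"
      by (simp add: family_tree_def Let_def)
    thus ?thesis using v[of n] v[of "Suc n"] p(2) by auto
  qed
  ultimately show "infinite_path (family_tree K) p"
    using p(1) by (simp add: infinite_path_def family_tree_def Let_def)
qed

lemma path_in_level:
  assumes "infinite_path (family_tree K) p"
  shows "p n \<in> level K n" and "m \<le> n \<Longrightarrow> take m (p n) = p m"
proof -
  have p: "p 0 = []" "\<And>n. \<exists>i<K (p n). p (Suc n) = p n @ [i]"
    using assms by (auto simp: infinite_path_family_tree)
  show l: "p n \<in> level K n" for n
  proof (induction n)
    case (Suc n)
    thus ?case using p(2)[of n] by (auto simp: level_def)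
  qed (simp add: p)
  show "m \<le> n \<Longrightarrow> take m (p n) = p m"
  proof (induction n)
    case (Suc n)
    thus ?case using p(2)[of n] length_level[OF l, of n] length_level[OF l, of "Suc n"]
      by (cases "m = Suc n") auto
  qed (simp add: p)
qed

text \<open>Koenig's lemma, applied to the vertices having descendants in infinitely many of the
  approximating events.\<close>

lemma path_event_eq:
  assumes B: "closed B"
  shows "(\<exists>p. infinite_path (family_tree K) p \<and> (\<lambda>n. X (p (Suc n))) \<in> B) \<longleftrightarrow>
    (\<forall>N. \<exists>w\<in>level K N. (\<lambda>i. X (take (Suc i) w)) \<in> thicken B N)"
proof safe
  fix p N assume p: "infinite_path (family_tree K) p" "(\<lambda>n. X (p (Suc n))) \<in> B"
  have "(\<lambda>n. X (p (Suc n))) \<in> thicken B N" using p(2) Inter_thicken[OF B] by auto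
  hence "(\<lambda>i. X (take (Suc i) (p N))) \<in> thicken B N"
    by (rule thicken_local[rotated]) (use path_in_level[OF p(1)] in auto)
  thus "\<exists>w\<in>level K N. (\<lambda>i. X (take (Suc i) w)) \<in> thicken B N"
    using path_in_level(1)[OF p(1)] by blast
next
  assume *: "\<forall>N. \<exists>w\<in>level K N. (\<lambda>i. X (take (Suc i) w)) \<in> thicken B N"
  define good where "good v \<longleftrightarrow> (\<forall>m. \<exists>N\<ge>m. \<exists>w\<in>level K N. take (length v) w = v \<and>
      (\<lambda>i. X (take (Suc i) w)) \<in> thicken B N)" for v
  have step: "\<exists>i<K v. good (v @ [i])" if v: "good v" for v
  proof (rule ccontr)
    assume "\<not> (\<exists>i<K v. good (v @ [i]))"
    hence "\<forall>i<K v. \<exists>m. \<forall>N\<ge>m. \<forall>w\<in>level K N. take (length (v @ [i])) w = v @ [i] \<longrightarrow> 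
        (\<lambda>i. X (take (Suc i) w)) \<notin> thicken B N"
      unfolding good_def by auto
    then obtain m where m: "\<And>i N w. i < K v \<Longrightarrow> m i \<le> N \<Longrightarrow> w \<in> level K N \<Longrightarrow> 
        take (length (v @ [i])) w = v @ [i] \<Longrightarrow> (\<lambda>i. X (take (Suc i) w)) \<notin> thicken B N"
      by metis
    \<comment> \<open>The generation is beyond \<open>v\<close> and beyond every threshold
      \<open>m i\<close>, so whichever child \<open>w\<close> passes through contradicts its own
      threshold.\<close>
    from v obtain N w where N: "N \<ge> Suc (length v) + (\<Sum>i<K v. m i)" "w \<in> level K N" "take (length v) w = v"
        "(\<lambda>i. X (take (Suc i) w)) \<in> thicken B N"
      unfolding good_def by blast
    have len: "length v < length w" using N length_level[OF N(2)] by simp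
    define i where "i = w ! length v"
    have i: "i < K v" using N(2,3) len by (auto simp: level_def verts_family_tree i_def)
    have "m i \<le> (\<Sum>i<K v. m i)" using i by (intro member_le_sum) auto
    moreover have "take (length (v @ [i])) w = v @ [i]"
      using len N(3) by (simp add: take_Suc_conv_app_nth i_def)
    ultimately show False using m[OF i _ N(2)] N by auto
  qed
  have "good []" unfolding good_def using * by auto
  hence "\<exists>p. p 0 = [] \<and> (\<forall>n. good (p n) \<and> (\<exists>i<K (p n). p (Suc n) = p n @ [i]))"
    using dependent_nat_choice[of "\<lambda>n v. good v \<and> (n = 0 \<longrightarrow> v = [])" "\<lambda>n v w. \<exists>i<K v. w = v @ [i]"] step
    by blast
  then obtain p where p: "p 0 = []" "\<And>n. good (p n)" "\<And>n. \<exists>i<K (p n). p (Suc n) = p n @ [i]" by blast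
  hence path: "infinite_path (family_tree K) p" by (simp add: infinite_path_family_tree)
  have "(\<lambda>n. X (p (Suc n))) \<in> thicken B n" for n
  proof -
    obtain N w where N: "N \<ge> n" "w \<in> level K N" "take (length (p n)) w = p n"
        "(\<lambda>i. X (take (Suc i) w)) \<in> thicken B N"
      using p(2)[of n] unfolding good_def by blast
    have ln: "length (p n) = n" using path_in_level(1)[OF path] by (rule length_level)
    have "(\<lambda>i. X (take (Suc i) w)) \<in> thicken B n" using N(1,4) thicken_antimono by blast
    thus ?thesis
    proof (rule thicken_local[rotated])
      fix i assume i: "i < n"
      have "take (Suc i) w = take (Suc i) (take n w)" using i by (simp add: min_def)
      also have "take n w = p n" using N(3) ln by simp
      also have "take (Suc i) (p n) = p (Suc i)" using path_in_level(2)[OF path, of "Suc i" n] i by simp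
      finally show "X (take (Suc i) w) = X (p (Suc i))" by simp
    qed
  qed
  hence "(\<lambda>n. X (p (Suc n))) \<in> B" using Inter_thicken[OF B] by auto
  with path show "\<exists>p. infinite_path (family_tree K) p \<and> (\<lambda>n. X (p (Suc n))) \<in> B" by blast
qed

lemma take_in_family_tree: "w \<in> verts (family_tree K) \<Longrightarrow> take n w \<in> verts (family_tree K)"
  by (auto simp: verts_family_tree min_def)

lemma path_event_measurable:
  assumes F: "real_distribution F" and B: "closed B"
  shows "{X \<in> space (Pi\<^sub>M (verts (family_tree K)) (\<lambda>_. F)).
     \<exists>p. infinite_path (family_tree K) p \<and> (\<lambda>n. X (p (Suc n))) \<in> B} \<in> sets (Pi\<^sub>M (verts (family_tree K)) (\<lambda>_. F))"
    (is "?E \<in> sets ?P")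
proof -
  interpret F: real_distribution F by (rule F)
  have "(\<lambda>X i. X (take (Suc i) w)) \<in> measurable ?P seq_space" if "w \<in> level K N" for w N
  proof (rule measurable_PiM_single')
    fix i
    have "take (Suc i) w \<in> verts (family_tree K)" using that by (auto simp: level_def take_in_family_tree)
    thus "(\<lambda>X. X (take (Suc i) w)) \<in> borel_measurable ?P"
      using measurable_component_singleton[of "take (Suc i) w" "verts (family_tree K)" "\<lambda>_. F"] by simp
  qed (auto simp: space_PiM)
  moreover have "thicken B N \<in> sets seq_space" for N
    by (simp add: sets_PiM_equal_borel open_thicken)
  ultimately have "(\<lambda>X i. X (take (Suc i) w)) -` thicken B N \<inter> space ?P \<in> sets ?P" if "w \<in> level K N" for w N
    using that by (intro measurable_sets) auto
  hence "(\<Inter>N. \<Union>w\<in>level K N. (\<lambda>X i. X (take (Suc i) w)) -` thicken B N \<inter> space ?P) \<in> sets ?P"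
    by (intro sets.countable_INT image_subsetI sets.finite_UN finite_level) blast+
  also have "(\<Inter>N. \<Union>w\<in>level K N. (\<lambda>X i. X (take (Suc i) w)) -` thicken B N \<inter> space ?P) = ?E"
    unfolding path_event_eq[OF B] by auto
  finally show ?thesis .
qed

text \<open>By \<open>path_event_eq\<close> the finite-generation events decrease to the path event,
  so continuity from above applies. Labelling all words puts every \<open>N\<close> on one space;
  the marginal on the vertices is the measure in \<open>path_prob\<close>.\<close>

lemma path_prob_limit:
  assumes F: "real_distribution F" and B: "closed B"
  shows "(\<lambda>N. hit F (thicken B N) K N [] x) \<longlonglongrightarrow> path_prob (family_tree K) B F"
proof -
  interpret F: real_distribution F by (rule F)
  interpret L: full_product "\<lambda>_::nat list. F"
    by unfold_locales (auto simp: F.space_eq_univ intro: F.prob_space)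
  let ?V = "verts (family_tree K)"
  let ?PV = "Pi\<^sub>M ?V (\<lambda>_. F)"
  let ?ev = "\<lambda>X. \<exists>p. infinite_path (family_tree K) p \<and> (\<lambda>n. X (p (Suc n))) \<in> B"
  define E where "E N = {X :: nat list \<Rightarrow> real. \<exists>w\<in>level K N. (\<lambda>i. X (take (Suc i) w)) \<in> thicken B N}" for N
  have E: "measure L.\<Omega> (E N) = hit F (thicken B N) K N [] x" "E N \<in> sets L.\<Omega>" for N
  proof -
    interpret truncated_event F "thicken B N" N by (rule thicken_truncated_event[OF F])
    show "measure L.\<Omega> (E N) = hit F (thicken B N) K N [] x" "E N \<in> sets L.\<Omega>"
      unfolding E_def by (rule prob_level_hit level_hit_sets)+
  qed
  have "decseq E"
  proof (rule decseq_SucI, rule subsetI)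
    fix N X assume "X \<in> E (Suc N)"
    then obtain w where w: "w \<in> level K (Suc N)" "(\<lambda>i. X (take (Suc i) w)) \<in> thicken B (Suc N)"
      by (auto simp: E_def)
    have "(\<lambda>i. X (take (Suc i) w)) \<in> thicken B N" using w(2) thicken_antimono[of N "Suc N" B] by auto
    hence "(\<lambda>i. X (take (Suc i) (take N w))) \<in> thicken B N"
      by (rule thicken_local[rotated]) (simp add: min_def)
    moreover have "take N w \<in> level K N" using w(1) by (auto simp: level_def take_in_family_tree)
    ultimately show "X \<in> E N" unfolding E_def by blast
  qed
  hence "(\<lambda>N. measure L.\<Omega> (E N)) \<longlonglongrightarrow> measure L.\<Omega> (\<Inter>N. E N)"
    using E(2) by (intro L.finite_Lim_measure_decseq) auto
  moreover have "path_prob (family_tree K) B F = measure L.\<Omega> (\<Inter>N. E N)"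
  proof -
    have d: "distr L.\<Omega> ?PV (\<lambda>X. \<lambda>v\<in>?V. X v) = ?PV"
      using distr_PiM_reindex[of UNIV "\<lambda>_. F" "\<lambda>v. v" ?V] F.prob_space_axioms by simp
    have "path_prob (family_tree K) B F = measure (distr L.\<Omega> ?PV (\<lambda>X. \<lambda>v\<in>?V. X v)) {X \<in> space ?PV. ?ev X}"
      by (simp add: d path_prob_def)
    also have "\<dots> = measure L.\<Omega> ((\<lambda>X. \<lambda>v\<in>?V. X v) -` {X \<in> space ?PV. ?ev X} \<inter> space L.\<Omega>)"
      by (rule measure_distr) (auto intro: path_event_measurable[OF F B])
    also have "(\<lambda>X. \<lambda>v\<in>?V. X v) -` {X \<in> space ?PV. ?ev X} \<inter> space L.\<Omega> = {X. ?ev X}"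
    proof -
      have "(\<lambda>n. (\<lambda>v\<in>?V. X v) (p (Suc n))) = (\<lambda>n. X (p (Suc n)))" if "infinite_path (family_tree K) p" for p and X :: "nat list \<Rightarrow> real"
        using path_in_level(1)[OF that] by (auto simp: level_def fun_eq_iff)
      thus ?thesis by (auto simp: space_PiM F.space_eq_univ)
    qed
    also have "{X. ?ev X} = (\<Inter>N. E N)" unfolding path_event_eq[OF B] E_def by auto
    finally show ?thesis .
  qed
  ultimately show ?thesis by (simp add: E(1))
qed

section \<open>Infinite trees as family trees\<close>

lemma successively_relpow:
  "xs \<noteq> [] \<Longrightarrow> successively (\<lambda>x y. (x, y) \<in> E) xs \<Longrightarrow> (hd xs, last xs) \<in> E ^^ (length xs - 1)"
proof (induction xs rule: induct_list012)
  case (3 x y zs)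
  hence "(x, y) \<in> E" "(y, last (y # zs)) \<in> E ^^ length zs" by auto
  hence "(x, last (y # zs)) \<in> E ^^ Suc (length zs)" by (rule relpow_Suc_I2)
  thus ?case by simp
qed auto

locale inf_tree =
  fixes T :: "'v rooted_graph"
  assumes T: "infinite_tree T"
begin

abbreviation "V \<equiv> verts T"
abbreviation "E \<equiv> edges T"
abbreviation "r \<equiv> origin T"
abbreviation "h \<equiv> height T"

lemma r_in_V [simp]: "r \<in> V" and E_sub: "(u, v) \<in> E \<Longrightarrow> u \<in> V \<and> v \<in> V"
  and E_sym: "(u, v) \<in> E \<Longrightarrow> (v, u) \<in> E" and E_irrefl: "(u, u) \<notin> E"
  and simple_path_unique: "v \<in> V \<Longrightarrow> simple_path T r xs v \<Longrightarrow> simple_path T r ys v \<Longrightarrow> xs = ys"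
  and simple_path_ex: "v \<in> V \<Longrightarrow> \<exists>xs. simple_path T r xs v"
  using T unfolding infinite_tree_def rooted_tree_def sym_def irrefl_def by blast+

lemma finite_children: "v \<in> V \<Longrightarrow> finite (children T v)"
proof -
  assume "v \<in> V"
  hence "finite {w. (v, w) \<in> E}" using T by (simp add: infinite_tree_def)
  thus "finite (children T v)" by (rule rev_finite_subset) (auto simp: children_def)
qed

lemma children_sub: "w \<in> children T v \<Longrightarrow> w \<in> V" and h_children: "w \<in> children T v \<Longrightarrow> h w = Suc (h v)"
  using E_sub by (auto simp: children_def)

lemma h_relpow: "v \<in> V \<Longrightarrow> (r, v) \<in> E ^^ h v"
proof -
  assume "v \<in> V"
  then obtain xs where "simple_path T r xs v" using simple_path_ex by blast
  hence "(r, v) \<in> E ^^ (length xs - 1)" using successively_relpow[of xs E] by (auto simp: simple_path_def)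
  thus ?thesis unfolding height_def by (rule LeastI)
qed

lemma h_le: "(r, v) \<in> E ^^ n \<Longrightarrow> h v \<le> n"
  unfolding height_def by (rule Least_le)

lemma h_r [simp]: "h r = 0"
  using h_le[of r 0] by simp

lemma h_0: "v \<in> V \<Longrightarrow> h v = 0 \<Longrightarrow> v = r"
  using h_relpow[of v] by simp

lemma h_edge: "(u, v) \<in> E \<Longrightarrow> h v \<le> Suc (h u)"
  using h_relpow[of u] E_sub by (intro h_le) auto

lemma parent_ex:
  assumes v: "v \<in> V" "h v = Suc n" shows "\<exists>u\<in>V. h u = n \<and> v \<in> children T u"
proof -
  obtain u where u: "(r, u) \<in> E ^^ n" "(u, v) \<in> E" using h_relpow[OF v(1)] v(2) by auto
  have "h u = n" using h_le[OF u(1)] h_edge[OF u(2)] v(2) by simp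
  thus ?thesis using u v E_sub by (auto simp: children_def)
qed

text \<open>Prolonging the path to a parent keeps it simple, because everything on it is lower than
  the new end. The known length and the heights make this the path against which others are compared
  by uniqueness.\<close>

lemma geodesic:
  "v \<in> V \<Longrightarrow> \<exists>xs. simple_path T r xs v \<and> length xs = Suc (h v) \<and> (\<forall>x\<in>set (butlast xs). h x < h v)"
proof (induction "h v" arbitrary: v)
  case 0
  hence "v = r" using h_0 by simp
  thus ?case by (intro exI[of _ "[r]"]) (auto simp: simple_path_def)
next
  case (Suc n)
  then obtain u where u: "u \<in> V" "h u = n" "v \<in> children T u" using parent_ex[of v n] by auto
  then obtain xs where xs: "simple_path T r xs u" "length xs = Suc n" "\<And>x. x \<in> set (butlast xs) \<Longrightarrow> h x < n"
    using Suc(1)[of u] by auto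
  have le: "h x \<le> n" if "x \<in> set xs" for x
  proof -
    have "xs = butlast xs @ [u]" using xs(1) by (auto simp: simple_path_def intro: append_butlast_last_id[symmetric])
    hence "x \<in> set (butlast xs) \<or> x = u" using that by (metis Un_iff empty_iff insert_iff list.set set_append)
    thus ?thesis using xs(3) u(2) by (auto intro: less_imp_le)
  qed
  have "simple_path T r (xs @ [v]) v"
    using xs(1) le Suc(2,3) u(3) by (fastforce simp: simple_path_def successively_append_iff children_def)
  moreover have "h x < h v" if "x \<in> set xs" for x using le[OF that] Suc(2) by simp
  ultimately show ?case using xs(2) Suc(2) by (intro exI[of _ "xs @ [v]"]) simp
qed

section \<open>Consequences of the uniqueness of simple paths\<close>

lemma simple_path_extend:
  assumes "simple_path T r xs u" "(u, v) \<in> E" "v \<notin> set xs"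
  shows "simple_path T r (xs @ [v]) v"
  using assms E_sub by (fastforce simp: simple_path_def successively_append_iff)

lemma not_in_geodesic:
  assumes "simple_path T r xs u" "\<forall>x\<in>set (butlast xs). h x < h u" "(u, v) \<in> E" "h u \<le> h v"
  shows "v \<notin> set xs"
proof
  assume "v \<in> set xs"
  moreover have "xs = butlast xs @ [u]" using assms(1) by (auto simp: simple_path_def intro: append_butlast_last_id[symmetric])
  ultimately have "v \<in> set (butlast xs) \<or> v = u" by (metis Un_iff empty_iff insert_iff list.set set_append)
  thus False using assms E_irrefl by auto
qed

text \<open>Otherwise the geodesic to \<open>v\<close>, and the one to \<open>u\<close> prolonged by
  the edge, would be simple paths from the root to \<open>v\<close> of different lengths.\<close>

lemma h_edge_neq: assumes e: "(u, v) \<in> E" shows "h u \<noteq> h v"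
proof
  assume eq: "h u = h v"
  have V: "u \<in> V" "v \<in> V" using e E_sub by auto
  obtain xs where xs: "simple_path T r xs u" "length xs = Suc (h u)" "\<forall>x\<in>set (butlast xs). h x < h u"
    using geodesic[OF V(1)] by blast
  obtain ys where ys: "simple_path T r ys v" "length ys = Suc (h v)" using geodesic[OF V(2)] by blast
  have "simple_path T r (xs @ [v]) v" using not_in_geodesic[OF xs(1,3) e] eq by (intro simple_path_extend[OF xs(1) e]) auto
  with ys(1) have "ys = xs @ [v]" using simple_path_unique V(2) by blast
  thus False using xs(2) ys(2) eq by simp
qed

text \<open>Each parent is the last vertex but one of a simple path from the root to
  \<open>v\<close>, and there is only one such path.\<close>

lemma parent_unique:
  assumes "v \<in> children T u" "v \<in> children T u'" shows "u = u'"
proof -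
  have *: "\<exists>xs. simple_path T r (xs @ [v]) v \<and> last xs = w \<and> xs \<noteq> []" if w: "v \<in> children T w" for w
  proof -
    have e: "(w, v) \<in> E" "h w \<le> h v" using w by (auto simp: children_def)
    obtain xs where xs: "simple_path T r xs w" "\<forall>x\<in>set (butlast xs). h x < h w"
      using geodesic[of w] E_sub e by blast
    have "simple_path T r (xs @ [v]) v" using not_in_geodesic[OF xs e] by (rule simple_path_extend[OF xs(1) e(1)])
    thus ?thesis using xs(1) by (intro exI[of _ xs]) (simp add: simple_path_def)
  qed
  obtain xs ys where "simple_path T r (xs @ [v]) v" "last xs = u" "simple_path T r (ys @ [v]) v" "last ys = u'"
    using *[OF assms(1)] *[OF assms(2)] by blast
  moreover have "v \<in> V" using assms children_sub by blast
  ultimately show ?thesis using simple_path_unique by blast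
qed

text \<open>Heights of neighbours differ by exactly one, so an upward step leads to the unique
  parent, which the path has just visited.\<close>

lemma infinite_path_iff: "infinite_path T p \<longleftrightarrow> p 0 = r \<and> (\<forall>n. p (Suc n) \<in> children T (p n))"
proof safe
  assume p: "infinite_path T p"
  show p0: "p 0 = r" using p by (simp add: infinite_path_def)
  have e: "(p n, p (Suc n)) \<in> E" for n using p by (simp add: infinite_path_def)
  have inj: "inj p" using p by (simp add: infinite_path_def)
  have cases: "p (Suc n) \<in> children T (p n) \<or> p n \<in> children T (p (Suc n))" for n
    using e[of n] E_sym[OF e[of n]] h_edge[OF e[of n]] h_edge[OF E_sym[OF e[of n]]] h_edge_neq[OF e[of n]]
    by (auto simp: children_def)
  fix n show "p (Suc n) \<in> children T (p n)"
  proof (induction n)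
    case 0
    show ?case using cases[of 0] p0 h_children[of r] by fastforce
  next
    case (Suc n)
    have "p (Suc (Suc n)) \<noteq> p n" using injD[OF inj, of "Suc (Suc n)" n] by auto
    with cases[of "Suc n"] parent_unique[OF Suc] show ?case by auto
  qed
next
  assume p: "p 0 = r" "\<forall>n. p (Suc n) \<in> children T (p n)"
  have "h (p n) = n" for n
    by (induction n) (use p h_children[OF p(2)[rule_format]] in simp_all)
  hence "inj p" by (metis injI)
  thus "infinite_path T p" using p by (auto simp: infinite_path_def children_def)
qed

section \<open>Coding of the vertices by words\<close>

definition child where "child v = (SOME f. bij_betw f {..<card (children T v)} (children T v))"

lemma child: "v \<in> V \<Longrightarrow> bij_betw (child v) {..<card (children T v)} (children T v)"
  unfolding child_def using ex_bij_betw_nat_finite[OF finite_children] 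
  by (metis (no_types, lifting) lessThan_atLeast0 someI_ex)

definition vertex :: "nat list \<Rightarrow> 'v" where "vertex w = foldl child r w"

definition degree :: "nat list \<Rightarrow> nat" where "degree w = card (children T (vertex w))"

abbreviation "W \<equiv> verts (family_tree degree)"

lemma vertex_Nil [simp]: "vertex [] = r" and vertex_snoc: "vertex (w @ [i]) = child (vertex w) i"
  by (auto simp: vertex_def)

lemma vertex_in_V: "w \<in> W \<Longrightarrow> vertex w \<in> V \<and> h (vertex w) = length w"
proof (induction w rule: rev_induct)
  case (snoc i w)
  hence w: "w \<in> W" "i < degree w" "vertex w \<in> V" "h (vertex w) = length w" by auto
  have "child (vertex w) i \<in> children T (vertex w)"
    using bij_betwE[OF child[OF w(3)]] w(2) by (auto simp: degree_def)
  thus ?case using w children_sub h_children by (auto simp: vertex_snoc)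
qed auto

lemma child_in: "w \<in> W \<Longrightarrow> i < degree w \<Longrightarrow> vertex (w @ [i]) \<in> children T (vertex w)"
  using bij_betwE[OF child, of "vertex w"] vertex_in_V[of w] by (auto simp: degree_def vertex_snoc)

lemma vertex_inj: "inj_on vertex W"
proof (rule inj_onI)
  fix w w' assume "w \<in> W" "w' \<in> W" "vertex w = vertex w'"
  thus "w = w'"
  proof (induction w arbitrary: w' rule: rev_induct)
    case Nil
    thus ?case using vertex_in_V[of w'] by (auto simp: vertex_def)
  next
    case (snoc i w)
    have "length w' = Suc (length w)" using vertex_in_V[of "w @ [i]"] vertex_in_V[of w'] snoc.prems by simp
    then obtain u j where w': "w' = u @ [j]" by (metis length_Suc_conv_rev)
    have in_W: "w \<in> W" "i < degree w" "u \<in> W" "j < degree u" using snoc.prems w' by auto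
    have c: "vertex (w @ [i]) \<in> children T (vertex w)" "vertex (w @ [i]) \<in> children T (vertex u)"
      using child_in[OF in_W(1,2)] child_in[OF in_W(3,4)] snoc.prems(3) w' by auto
    hence "w = u" using parent_unique snoc.IH in_W by blast
    moreover have "i = j"
      using child[of "vertex w"] vertex_in_V[OF in_W(1)] in_W snoc.prems(3) w' \<open>w = u\<close>
      by (auto simp: bij_betw_def inj_on_def vertex_snoc degree_def)
    ultimately show ?case by (simp add: w')
  qed
qed

lemma vertex_child_surj:
  assumes "w \<in> W" "v \<in> children T (vertex w)" obtains i where "i < degree w" "v = vertex (w @ [i])"
proof -
  have "v \<in> child (vertex w) ` {..<degree w}"
    using child[of "vertex w"] vertex_in_V[OF assms(1)] assms(2) by (simp add: bij_betw_def degree_def)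
  thus ?thesis using that by (auto simp: vertex_snoc)
qed

lemma vertex_surj: "v \<in> V \<Longrightarrow> \<exists>w\<in>W. vertex w = v"
proof (induction "h v" arbitrary: v)
  case 0
  thus ?case using h_0[of v] by (intro bexI[of _ "[]"]) auto
next
  case (Suc n)
  then obtain u where "u \<in> V" "h u = n" "v \<in> children T u" using parent_ex[of v n] by auto
  with Suc(1)[of u] obtain w where w: "w \<in> W" "v \<in> children T (vertex w)" by auto
  from vertex_child_surj[OF this] obtain i where "i < degree w" "v = vertex (w @ [i])" .
  thus ?case using w by (intro bexI[of _ "w @ [i]"]) auto
qed

lemma card_level: "card (level degree n) = card (generation T n)"
proof (rule bij_betw_same_card)
  have "vertex ` level degree n = generation T n"
    using vertex_surj vertex_in_V by (fastforce simp: level_def generation_def image_iff)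
  moreover have "inj_on vertex (level degree n)"
    by (rule inj_on_subset[OF vertex_inj]) (auto simp: level_def)
  ultimately show "bij_betw vertex (level degree n) (generation T n)" by (simp add: bij_betw_def)
qed

lemma path_ex_iff:
  "(\<exists>p. infinite_path T p \<and> Q (\<lambda>n. p (Suc n))) \<longleftrightarrow>
    (\<exists>p. infinite_path (family_tree degree) p \<and> Q (\<lambda>n. vertex (p (Suc n))))"
proof safe
  fix p assume p: "infinite_path T p" "Q (\<lambda>n. p (Suc n))"
  hence p': "p 0 = r" "\<And>n. p (Suc n) \<in> children T (p n)" by (auto simp: infinite_path_iff)
  have "p n \<in> V" for n by (cases n) (use p' children_sub in auto)
  hence "\<exists>w\<in>W. vertex w = p n" for n using vertex_surj by blast
  then obtain q where q: "\<And>n. q n \<in> W" "\<And>n. vertex (q n) = p n" by metis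
  have "q 0 = []" using vertex_in_V[OF q(1)[of 0]] q(2)[of 0] p' by simp
  moreover have "\<exists>i<degree (q n). q (Suc n) = q n @ [i]" for n
  proof -
    have "p (Suc n) \<in> children T (vertex (q n))" using p' q(2) by simp
    from vertex_child_surj[OF q(1) this] obtain i where i: "i < degree (q n)" "p (Suc n) = vertex (q n @ [i])" .
    have "q (Suc n) = q n @ [i]"
      by (rule inj_onD[OF vertex_inj]) (use i q in auto)
    thus ?thesis using i by auto
  qed
  ultimately have "infinite_path (family_tree degree) q" by (simp add: infinite_path_family_tree)
  moreover have "Q (\<lambda>n. vertex (q (Suc n)))" using p(2) q(2) by simp
  ultimately show "\<exists>p. infinite_path (family_tree degree) p \<and> Q (\<lambda>n. vertex (p (Suc n)))" by blast
next
  fix p assume p: "infinite_path (family_tree degree) p" "Q (\<lambda>n. vertex (p (Suc n)))"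
  have "p n \<in> W" for n using path_in_level(1)[OF p(1)] by (auto simp: level_def)
  hence "vertex (p (Suc n)) \<in> children T (vertex (p n))" for n
    using p(1) child_in unfolding infinite_path_family_tree by metis
  moreover have "vertex (p 0) = r" using p(1) by (simp add: infinite_path_family_tree)
  ultimately have "infinite_path T (\<lambda>n. vertex (p n))" by (simp add: infinite_path_iff)
  with p(2) show "\<exists>p. infinite_path T p \<and> Q (\<lambda>n. p (Suc n))" by blast
qed

lemma path_prob_degree:
  assumes F: "real_distribution F" and B: "closed B"
  shows "path_prob (family_tree degree) B F = path_prob T B F"
proof -
  interpret F: real_distribution F by (rule F)
  let ?PW = "Pi\<^sub>M W (\<lambda>_. F)" and ?PV = "Pi\<^sub>M V (\<lambda>_. F)"
  let ?t = "\<lambda>X. \<lambda>w\<in>W. X (vertex w)"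
  let ?ev = "\<lambda>X. \<exists>p. infinite_path (family_tree degree) p \<and> (\<lambda>n. X (p (Suc n))) \<in> B"
  have V: "vertex \<in> W \<rightarrow> V" using vertex_in_V by auto
  have d: "distr ?PV ?PW ?t = ?PW"
    using distr_PiM_reindex[of V "\<lambda>_. F" vertex W] F.prob_space_axioms vertex_inj V by simp
  have t: "?t \<in> measurable ?PV ?PW"
    by (intro measurable_restrict measurable_component_singleton) (use V in auto)
  have "path_prob (family_tree degree) B F = measure (distr ?PV ?PW ?t) {X \<in> space ?PW. ?ev X}"
    by (simp add: d path_prob_def)
  also have "\<dots> = measure ?PV (?t -` {X \<in> space ?PW. ?ev X} \<inter> space ?PV)"
    by (rule measure_distr[OF t path_event_measurable[OF F B]])
  also have "?t -` {X \<in> space ?PW. ?ev X} \<inter> space ?PV =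
     {X \<in> space ?PV. \<exists>p. infinite_path T p \<and> (\<lambda>n. X (p (Suc n))) \<in> B}"
  proof -
    have *: "?ev (?t X) \<longleftrightarrow> (\<exists>p. infinite_path (family_tree degree) p \<and> (\<lambda>n. X (vertex (p (Suc n)))) \<in> B)" for X :: "'v \<Rightarrow> real"
    proof (intro ex_cong1 conj_cong refl)
      fix p assume p: "infinite_path (family_tree degree) p"
      have "p (Suc n) \<in> W" for n using path_in_level(1)[OF p] by (auto simp: level_def)
      thus "(\<lambda>n. ?t X (p (Suc n))) \<in> B \<longleftrightarrow> (\<lambda>n. X (vertex (p (Suc n)))) \<in> B" by simp
    qed
    have "?ev (?t X) \<longleftrightarrow> (\<exists>p. infinite_path T p \<and> (\<lambda>n. X (p (Suc n))) \<in> B)" for X :: "'v \<Rightarrow> real"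
      unfolding * using path_ex_iff[of "\<lambda>p. (\<lambda>n. X (p n)) \<in> B"] by simp
    thus ?thesis using measurable_space[OF t] by auto
  qed
  finally show ?thesis by (simp add: path_prob_def)
qed

end

section \<open>Moments of generating functions\<close>

text \<open>Monotone convergence, with a possibly infinite limit: the values are bounded above term
  by term, and below by partial sums, which are continuous at 1.\<close>

lemma power_series_tendsto_at_left_1:
  fixes d :: "nat \<Rightarrow> real"
  assumes nonneg: "\<And>n. 0 \<le> d n" and summable: "\<And>s. \<bar>s\<bar> < 1 \<Longrightarrow> summable (\<lambda>n. d n * s ^ n)"
  shows "((\<lambda>s. ereal (\<Sum>n. d n * s ^ n)) \<longlongrightarrow> (\<Sum>n. ereal (d n))) (at_left 1)"
proof (rule order_tendstoI)
  have ev: "\<forall>\<^sub>F s :: real in at_left 1. 0 < s \<and> s < 1"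
    by (auto simp: eventually_at_left[of 0] intro!: exI[of _ 0])
  fix y assume y: "(\<Sum>n. ereal (d n)) < y"
  show "\<forall>\<^sub>F s in at_left 1. ereal (\<Sum>n. d n * s ^ n) < y"
    using ev
  proof eventually_elim
    case (elim s)
    have "ereal (\<Sum>n. d n * s ^ n) = (\<Sum>n. ereal (d n * s ^ n))"
      using summable[of s] elim by (intro suminf_ereal'[symmetric]) auto
    also have "\<dots> \<le> (\<Sum>n. ereal (d n))"
      using elim nonneg by (intro suminf_le_pos) (auto intro!: mult_left_le power_le_one)
    finally show ?case using y by simp
  qed
next
  have ev: "\<forall>\<^sub>F s :: real in at_left 1. 0 < s \<and> s < 1"
    by (auto simp: eventually_at_left[of 0] intro!: exI[of _ 0])
  fix y assume "y < (\<Sum>n. ereal (d n))"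
  also have "(\<Sum>n. ereal (d n)) = (SUP n. \<Sum>i<n. ereal (d i))"
    using nonneg by (intro suminf_ereal_eq_SUP) auto
  finally obtain n where n: "y < ereal (\<Sum>i<n. d i)" by (auto simp: less_SUP_iff)
  have "((\<lambda>s. ereal (\<Sum>i<n. d i * s ^ i)) \<longlongrightarrow> ereal (\<Sum>i<n. d i * 1 ^ i)) (at_left 1)"
    by (intro tendsto_intros)
  hence "\<forall>\<^sub>F s in at_left 1. y < ereal (\<Sum>i<n. d i * s ^ i)"
    using n by (auto intro: order_tendstoD)
  thus "\<forall>\<^sub>F s in at_left 1. y < ereal (\<Sum>n. d n * s ^ n)"
    using ev
  proof eventually_elim
    case (elim s)
    have "(\<Sum>i<n. d i * s ^ i) \<le> (\<Sum>n. d n * s ^ n)"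
      using elim nonneg summable[of s] by (intro sum_le_suminf) auto
    with elim show ?case by (metis ereal_less_eq(3) less_le_trans)
  qed
qed

lemma gen_fun_derivs:
  shows "gen_fun_deriv_1 1 q = (\<Sum>n. ereal (diffs (pmf q) n))"
    and "gen_fun_deriv_1 2 q = (\<Sum>n. ereal (diffs (diffs (pmf q)) n))"
proof -
  let ?c = "pmf q"
  have s0: "summable (\<lambda>n. ?c n * s ^ n)" if "\<bar>s\<bar> < 1" for s :: real
  proof (rule summable_comparison_test')
    show "summable (\<lambda>n. \<bar>s\<bar> ^ n)" using that by (intro summable_geometric) auto
    show "norm (?c n * s ^ n) \<le> \<bar>s\<bar> ^ n" for n
      by (auto simp: abs_mult power_abs intro!: mult_left_le_one_le pmf_le_1)
  qed
  have s1: "summable (\<lambda>n. diffs ?c n * s ^ n)" if "\<bar>s\<bar> < 1" for s :: real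
    using that by (intro termdiff_converges[of s 1]) (auto intro: s0)
  have s2: "summable (\<lambda>n. diffs (diffs ?c) n * s ^ n)" if "\<bar>s\<bar> < 1" for s :: real
    using that by (intro termdiff_converges[of s 1]) (auto intro: s1)
  have d1: "deriv (gen_fun q) s = (\<Sum>n. diffs ?c n * s ^ n)" if "\<bar>s\<bar> < 1" for s
    unfolding gen_fun_def[abs_def] using that
    by (intro DERIV_imp_deriv termdiffs_strong'[where K=1]) (auto intro: s0)
  have d2: "deriv (deriv (gen_fun q)) s = (\<Sum>n. diffs (diffs ?c) n * s ^ n)" if "\<bar>s\<bar> < 1" for s
  proof (rule DERIV_imp_deriv)
    have "((\<lambda>s. \<Sum>n. diffs ?c n * s ^ n) has_field_derivative (\<Sum>n. diffs (diffs ?c) n * s ^ n)) (at s)"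
      using that by (intro termdiffs_strong'[where K=1]) (auto intro: s1)
    thus "(deriv (gen_fun q) has_field_derivative (\<Sum>n. diffs (diffs ?c) n * s ^ n)) (at s)"
      by (rule has_field_derivative_transform_within_open[of _ _ _ "{-1<..<1}"])
        (use that d1 in \<open>auto simp: abs_less_iff\<close>)
  qed
  have ev: "\<forall>\<^sub>F s :: real in at_left 1. \<bar>s\<bar> < 1"
    by (auto simp: eventually_at_left[of 0] intro!: exI[of _ 0])
  have n1: "0 \<le> diffs ?c n" and n2: "0 \<le> diffs (diffs ?c) n" for n by (auto simp: diffs_def)
  show "gen_fun_deriv_1 1 q = (\<Sum>n. ereal (diffs ?c n))"
    unfolding gen_fun_deriv_1_def
  proof (rule tendsto_Lim[OF trivial_limit_at_left_real])
    show "((\<lambda>s. ereal ((deriv ^^ 1) (gen_fun q) s)) \<longlongrightarrow> (\<Sum>n. ereal (diffs ?c n))) (at_left 1)"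
      using power_series_tendsto_at_left_1[OF n1 s1]
      by (rule Lim_transform_eventually) (use ev d1 in \<open>auto elim!: eventually_mono\<close>)
  qed
  show "gen_fun_deriv_1 2 q = (\<Sum>n. ereal (diffs (diffs ?c) n))"
    unfolding gen_fun_deriv_1_def
  proof (rule tendsto_Lim[OF trivial_limit_at_left_real])
    show "((\<lambda>s. ereal ((deriv ^^ 2) (gen_fun q) s)) \<longlongrightarrow> (\<Sum>n. ereal (diffs (diffs ?c) n))) (at_left 1)"
      using power_series_tendsto_at_left_1[OF n2 s2]
      by (rule Lim_transform_eventually) (use ev d2 in \<open>auto elim!: eventually_mono simp: numeral_2_eq_2\<close>)
  qed
qed

lemma expectation_nat_pmf:
  fixes f :: "nat \<Rightarrow> real"
  assumes nonneg: "\<And>k. 0 \<le> f k" and s: "summable (\<lambda>k. pmf q k * f k)"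
  shows "integrable (measure_pmf q) f" "measure_pmf.expectation q f = (\<Sum>k. pmf q k * f k)"
proof -
  have i: "integrable (count_space UNIV) (\<lambda>k. pmf q k * f k)"
    using s nonneg by (subst integrable_count_space_nat_iff) (simp add: abs_mult)
  show "integrable (measure_pmf q) f"
    using i by (simp add: measure_pmf_eq_density integrable_density)
  show "measure_pmf.expectation q f = (\<Sum>k. pmf q k * f k)"
    using integral_count_space_nat[OF i] by (simp add: measure_pmf_eq_density integral_density)
qed

text \<open>Finiteness of the mean is a consequence: \<open>(k - 1)\<^sup>2 \<ge> 0\<close> bounds
  \<open>k\<close> by \<open>1 + k * (k - 1)\<close>.\<close>

lemma gen_fun_moments:
  assumes "gen_fun_deriv_1 2 q < \<infinity>"
  shows "integrable (measure_pmf q) (\<lambda>k. real k * (real k - 1))"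
    and "gen_fun_deriv_1 2 q = ereal (measure_pmf.expectation q (\<lambda>k. real k * (real k - 1)))"
    and "integrable (measure_pmf q) real"
    and "gen_fun_deriv_1 1 q = ereal (measure_pmf.expectation q real)"
proof -
  have n1: "0 \<le> diffs (pmf q) n" and n2: "0 \<le> diffs (diffs (pmf q)) n" for n by (auto simp: diffs_def)
  have s: "summable (diffs (diffs (pmf q)))"
    using assms n2 by (intro summable_ereal) (auto simp: gen_fun_derivs)
  have nonneg: "0 \<le> real k * (real k - 1)" for k by (cases k) auto
  have eq: "pmf q (k + 2) * (real (k + 2) * (real (k + 2) - 1)) = diffs (diffs (pmf q)) k" for k
    by (simp add: diffs_def algebra_simps)
  have s': "summable (\<lambda>k. pmf q k * (real k * (real k - 1)))"
    by (subst summable_iff_shift[of _ 2, symmetric], subst eq) (rule s)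
  show i: "integrable (measure_pmf q) (\<lambda>k. real k * (real k - 1))"
    by (rule expectation_nat_pmf(1)[OF nonneg s'])
  have "(\<Sum>k. pmf q k * (real k * (real k - 1))) = (\<Sum>k. diffs (diffs (pmf q)) k)"
    using suminf_split_initial_segment[OF s', of 2] by (simp only: eq) (simp add: numeral_2_eq_2)
  thus "gen_fun_deriv_1 2 q = ereal (measure_pmf.expectation q (\<lambda>k. real k * (real k - 1)))"
    by (simp add: expectation_nat_pmf(2)[OF nonneg s'] gen_fun_derivs suminf_ereal'[OF s])
  have le: "real k \<le> 1 + real k * (real k - 1)" for k
    using zero_le_square[of "real k - 1"] by (simp add: algebra_simps)
  show i1: "integrable (measure_pmf q) real"
  proof (rule Bochner_Integration.integrable_bound)
    show "integrable (measure_pmf q) (\<lambda>k. 1 + real k * (real k - 1))" using i by simp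
  qed (use le nonneg in \<open>auto intro!: AE_I2 order_trans[OF le]\<close>)
  have "integrable (count_space UNIV) (\<lambda>k. pmf q k * real k)"
    using i1 by (simp add: measure_pmf_eq_density integrable_density)
  hence s1: "summable (\<lambda>k. pmf q k * real k)"
    by (subst (asm) integrable_count_space_nat_iff) (simp add: abs_mult)
  have eq1: "pmf q (k + 1) * real (k + 1) = diffs (pmf q) k" for k
    by (simp add: diffs_def algebra_simps)
  have s1': "summable (diffs (pmf q))"
    using s1 by (subst (asm) summable_iff_shift[of _ 1, symmetric]) (simp only: eq1)
  have "(\<Sum>k. pmf q k * real k) = (\<Sum>k. diffs (pmf q) k)"
    using suminf_split_initial_segment[OF s1, of 1] by (simp only: eq1) simp
  thus "gen_fun_deriv_1 1 q = ereal (measure_pmf.expectation q real)"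
    by (simp add: expectation_nat_pmf(2)[OF _ s1] gen_fun_derivs(1)[unfolded One_nat_def] suminf_ereal'[OF s1'])
qed

section \<open>Second moments of branching processes with bounded offspring\<close>

text \<open>The subtree below \<open>v\<close> depends on the offspring numbers at these words.\<close>

definition cone :: "nat list \<Rightarrow> nat list set" where
  "cone v = {w. take (length v) w = v}"

lemma cone_self [simp]: "v \<in> cone v"
  by (simp add: cone_def)

lemma cone_snoc: "cone (v @ [i]) \<subseteq> cone v - {v}"
proof
  fix w assume w: "w \<in> cone (v @ [i])"
  hence "take (length v) (take (Suc (length v)) w) = take (length v) (v @ [i])" by (simp add: cone_def)
  thus "w \<in> cone v - {v}" using w by (auto simp: cone_def min_def)
qed

lemma cone_disjoint: "i \<noteq> j \<Longrightarrow> cone (v @ [i]) \<inter> cone (v @ [j]) = {}"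
  by (auto simp: cone_def)

lemma sum_square_off_diagonal:
  "(\<Sum>i\<in>I. c i)\<^sup>2 - (\<Sum>i\<in>I. (c i)\<^sup>2) = (\<Sum>i\<in>I. \<Sum>j\<in>I - {i}. c i * c j)" if "finite I" for c :: "nat \<Rightarrow> real"
proof -
  have "(\<Sum>i\<in>I. c i)\<^sup>2 = (\<Sum>i\<in>I. \<Sum>j\<in>I. c i * c j)" by (simp add: power2_eq_square sum_product)
  also have "\<dots> = (\<Sum>i\<in>I. (c i)\<^sup>2 + (\<Sum>j\<in>I - {i}. c i * c j))"
    using that by (intro sum.cong refl) (simp add: sum.remove power2_eq_square)
  finally show ?thesis by (simp add: sum.distrib)
qed

text \<open>The process under study has offspring numbers \<open>\<xi> v (K v)\<close>, a truncation
  of the number drawn at \<open>v\<close>. Keeping the original \<open>K\<close> as the sample point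
  allows the truncated tree to be realised inside the original one. The last assumption balances the
  truncation level against the growth of the generations.\<close>

locale bounded_branching = full_product M for M :: "nat list \<Rightarrow> nat measure" +
  fixes \<xi> :: "nat list \<Rightarrow> nat \<Rightarrow> nat" and m :: "nat \<Rightarrow> real" and L :: "nat \<Rightarrow> nat" and a V :: real
  assumes sets_M: "\<And>v. sets (M v) = UNIV"
    and \<xi>_pos: "\<And>v k. 1 \<le> \<xi> v k"
    and \<xi>_le: "\<And>v k. \<xi> v k \<le> L (length v)"
    and mean: "\<And>v. (\<integral>k. real (\<xi> v k) \<partial>M v) = m (length v)"
    and second: "\<And>v. (\<integral>k. real (\<xi> v k) * (real (\<xi> v k) - 1) \<partial>M v) \<le> V"
    and a: "1 < a" "\<And>n. a \<le> m n"
    and summable_L: "\<And>k. summable (\<lambda>j. (real (L (k + j)))\<^sup>2 / (\<Prod>i<j. m (k + i)))"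
begin

abbreviation X :: "nat list \<Rightarrow> (nat list \<Rightarrow> nat) \<Rightarrow> nat" where "X v K \<equiv> \<xi> v (K v)"

definition pair_mean :: "nat list \<Rightarrow> real" where "pair_mean v = (\<integral>k. real (\<xi> v k) * (real (\<xi> v k) - 1) \<partial>M v)"

text \<open>Everything is bounded because the offspring numbers are, so that integrability needs no
  separate argument.\<close>

definition adm :: "nat list set \<Rightarrow> ((nat list \<Rightarrow> nat) \<Rightarrow> real) \<Rightarrow> bool" where
  "adm A f \<longleftrightarrow> f \<in> borel_measurable \<Omega> \<and> (\<exists>c. \<forall>K. \<bar>f K\<bar> \<le> c) \<and> depends_on A f"

lemma prob_UNIV [simp]: "prob UNIV = 1"
  using prob_space by simp

lemma adm_integrable: "adm A f \<Longrightarrow> integrable \<Omega> f"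
  unfolding adm_def using integrable_bounded by blast

lemma adm_mono: "adm A f \<Longrightarrow> A \<subseteq> B \<Longrightarrow> adm B f"
  unfolding adm_def using depends_on_mono by blast

lemma adm_cone_snoc: "adm (cone (v @ [i])) f \<Longrightarrow> adm (cone v) f"
  using adm_mono cone_snoc by blast

lemma adm_const [intro, simp]: "adm A (\<lambda>_. c)"
  by (auto simp: adm_def depends_on_def)

lemma adm_add [intro]: assumes "adm A f" "adm A g" shows "adm A (\<lambda>K. f K + g K)"
proof -
  obtain c d where "\<And>K. \<bar>f K\<bar> \<le> c" "\<And>K. \<bar>g K\<bar> \<le> d" using assms by (auto simp: adm_def)
  hence "\<bar>f K + g K\<bar> \<le> c + d" for K by (meson abs_triangle_ineq add_mono order_trans)
  with assms show ?thesis unfolding adm_def by (auto intro: depends_on_compose2)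
qed

lemma adm_mult [intro]: assumes "adm A f" "adm A g" shows "adm A (\<lambda>K. f K * g K)"
proof -
  obtain c d where "\<And>K. \<bar>f K\<bar> \<le> c" "\<And>K. \<bar>g K\<bar> \<le> d" using assms by (auto simp: adm_def)
  hence "\<bar>f K * g K\<bar> \<le> c * d" for K by (simp add: abs_mult mult_mono')
  with assms show ?thesis unfolding adm_def by (auto intro: depends_on_compose2)
qed

lemma adm_diff [intro]: assumes "adm A f" "adm A g" shows "adm A (\<lambda>K. f K - g K)"
  using adm_add[OF assms(1) adm_mult[OF adm_const[of A "-1"] assms(2)]] by simp

lemma adm_power2 [intro]: "adm A f \<Longrightarrow> adm A (\<lambda>K. (f K)\<^sup>2)"
  unfolding power2_eq_square by (rule adm_mult)

lemma adm_divide [intro]: "adm A f \<Longrightarrow> adm A (\<lambda>K. f K / c)"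
  using adm_mult[OF _ adm_const[of A "1 / c"]] by simp

lemma adm_sum [intro]: "(\<And>i. i \<in> I \<Longrightarrow> adm A (f i)) \<Longrightarrow> adm A (\<lambda>K. \<Sum>i\<in>I. f i K)"
  by (induction I rule: infinite_finite_induct) auto

lemma measurable_coord: "(\<lambda>K. g (K v)) \<in> borel_measurable \<Omega>" for g :: "nat \<Rightarrow> real"
proof -
  have "g \<in> borel_measurable (M v)" by (auto simp: measurable_def sets_M)
  from measurable_compose[OF _ this, of "\<lambda>K. K v" \<Omega>] show ?thesis by simp
qed

lemma adm_offspring: "adm {v} (\<lambda>K. g (X v K))" for g :: "nat \<Rightarrow> real"
proof -
  have "\<bar>g (X v K)\<bar> \<le> (\<Sum>k\<le>L (length v). \<bar>g k\<bar>)" for K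
    using \<xi>_le[of v "K v"] by (intro member_le_sum) auto
  thus ?thesis
    using measurable_coord[of "\<lambda>k. g (\<xi> v k)" v] by (auto simp: adm_def depends_on_def)
qed

lemma expectation_coord: "expectation (\<lambda>K. g (K v)) = (\<integral>k. g k \<partial>M v)" for g :: "nat \<Rightarrow> real"
proof -
  have g: "g \<in> borel_measurable (M v)" by (auto simp: measurable_def sets_M)
  have d: "distr \<Omega> (M v) (\<lambda>K. K v) = M v" using distr_PiM_component[of UNIV M v] prob by auto
  have "(\<integral>k. g k \<partial>M v) = (\<integral>k. g k \<partial>distr \<Omega> (M v) (\<lambda>K. K v))" by (simp add: d)
  also have "\<dots> = expectation (\<lambda>K. g (K v))" by (rule integral_distr) (auto simp: g)
  finally show ?thesis by simp
qed

lemma E_mult: "adm A f \<Longrightarrow> adm B g \<Longrightarrow> A \<inter> B = {} \<Longrightarrow> expectation (\<lambda>K. f K * g K) = expectation f * expectation g"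
  using expectation_mult_disjoint[of f A g B] adm_integrable[of A f] adm_integrable[of B g]
  unfolding adm_def by blast

lemma E_sum: "(\<And>i. i \<in> I \<Longrightarrow> adm A (f i)) \<Longrightarrow> expectation (\<lambda>K. \<Sum>i\<in>I. f i K) = (\<Sum>i\<in>I. expectation (f i))"
  by (intro Bochner_Integration.integral_sum adm_integrable)

lemma E_add: "adm A f \<Longrightarrow> adm A g \<Longrightarrow> expectation (\<lambda>K. f K + g K) = expectation f + expectation g"
  by (intro Bochner_Integration.integral_add adm_integrable)

lemma E_diff: "adm A f \<Longrightarrow> adm A g \<Longrightarrow> expectation (\<lambda>K. f K - g K) = expectation f - expectation g"
  by (intro Bochner_Integration.integral_diff adm_integrable)

lemma E_mono: "adm A f \<Longrightarrow> adm A g \<Longrightarrow> (\<And>K. f K \<le> g K) \<Longrightarrow> expectation f \<le> expectation g"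
  by (intro integral_mono adm_integrable)

lemma mean_eq: "expectation (\<lambda>K. real (X v K)) = m (length v)"
  using expectation_coord[of "\<lambda>k. real (\<xi> v k)" v] mean by simp

lemma pair_mean_eq: "expectation (\<lambda>K. real (X v K) * (real (X v K) - 1)) = pair_mean v"
  using expectation_coord[of "\<lambda>k. real (\<xi> v k) * (real (\<xi> v k) - 1)" v] by (simp add: pair_mean_def)

lemma pair_mean_bounds: "0 \<le> pair_mean v" "pair_mean v \<le> V"
proof -
  have "0 \<le> real (\<xi> v k) * (real (\<xi> v k) - 1)" for k using \<xi>_pos[of v k] by simp
  thus "0 \<le> pair_mean v" unfolding pair_mean_def by (intro Bochner_Integration.integral_nonneg)
  show "pair_mean v \<le> V" unfolding pair_mean_def by (rule second)
qed

lemma V_nonneg: "0 \<le> V" using pair_mean_bounds[of "[]"] by simp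

lemma m_pos: "0 < m n" using a(1) a(2)[of n] by simp

text \<open>With a deterministic range the random number of children becomes an indicator factor,
  which is independent of the subtrees below the children. This gives Wald-type identities for sums
  over the children.\<close>

lemma offspring_sum: "(\<Sum>i<X v K. f i) = (\<Sum>i<L (length v). of_bool (i < X v K) * f i)" for f :: "nat \<Rightarrow> real"
  using \<xi>_le[of v "K v"] by (intro sum.mono_neutral_cong_left) auto

lemma adm_offspring_sum:
  assumes "\<And>i. adm (cone (v @ [i])) (f i)" shows "adm (cone v) (\<lambda>K. \<Sum>i<X v K. f i K)"
  unfolding offspring_sum
  by (intro adm_sum adm_mult adm_cone_snoc[OF assms] adm_mono[OF adm_offspring[of v "\<lambda>x. of_bool (_ < x)"]]) auto

lemma E_offspring_sum:
  assumes f: "\<And>i. adm (cone (v @ [i])) (f i)"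
  shows "expectation (\<lambda>K. \<Sum>i<X v K. f i K) =
    (\<Sum>i<L (length v). expectation (\<lambda>K. of_bool (i < X v K)) * expectation (f i))"
proof -
  have i: "adm {v} (\<lambda>K. of_bool (i < X v K))" for i by (rule adm_offspring)
  have d: "{v} \<inter> cone (v @ [i]) = {}" for i using cone_snoc[of v i] by auto
  show ?thesis
    unfolding offspring_sum E_mult[OF i f d, symmetric]
    by (rule E_sum[of _ "cone v"]) (intro adm_mult adm_cone_snoc[OF f] adm_mono[OF i], simp)
qed

lemma sum_prob_offspring: "(\<Sum>i<L (length v). expectation (\<lambda>K. of_bool (i < X v K))) = m (length v)"
proof -
  have "expectation (\<lambda>K. \<Sum>i<L (length v). of_bool (i < X v K) :: real) =
      (\<Sum>i<L (length v). expectation (\<lambda>K. of_bool (i < X v K)))"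
    by (rule E_sum[of _ "{v}"]) (rule adm_offspring)
  moreover have "(\<Sum>i<L (length v). of_bool (i < X v K)) = real (X v K)" for K
    using offspring_sum[of "\<lambda>_. 1" v K] by simp
  ultimately show ?thesis by (simp add: mean_eq)
qed

lemma E_offspring_sum_eq:
  assumes f: "\<And>i. adm (cone (v @ [i])) (f i)" and E: "\<And>i. expectation (f i) = y"
  shows "expectation (\<lambda>K. \<Sum>i<X v K. f i K) = m (length v) * y"
  unfolding E_offspring_sum[of v f, OF f] E sum_distrib_right[symmetric] sum_prob_offspring ..

lemma E_offspring_sum_le:
  assumes f: "\<And>i. adm (cone (v @ [i])) (f i)" and E: "\<And>i. expectation (f i) \<le> y"
  shows "expectation (\<lambda>K. \<Sum>i<X v K. f i K) \<le> m (length v) * y"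
  unfolding E_offspring_sum[of v f, OF f] sum_prob_offspring[symmetric] sum_distrib_right
  by (intro sum_mono mult_left_mono E Bochner_Integration.integral_nonneg) auto

text \<open>The sum of \<open>f i * f j\<close> over ordered pairs of distinct children of
  \<open>v\<close>.\<close>

definition cross :: "nat list \<Rightarrow> (nat \<Rightarrow> (nat list \<Rightarrow> nat) \<Rightarrow> real) \<Rightarrow> (nat list \<Rightarrow> nat) \<Rightarrow> real" where
  "cross v f K = (\<Sum>i<X v K. f i K)\<^sup>2 - (\<Sum>i<X v K. (f i K)\<^sup>2)"

lemma adm_cross: "(\<And>i. adm (cone (v @ [i])) (f i)) \<Longrightarrow> adm (cone v) (cross v f)"
  unfolding cross_def[abs_def] by (intro adm_diff adm_power2 adm_offspring_sum)

lemma E_cross: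
  assumes f: "\<And>i. adm (cone (v @ [i])) (f i)"
  shows "expectation (cross v f) = (\<Sum>i<L (length v). \<Sum>j\<in>{..<L (length v)} - {i}.
     expectation (\<lambda>K. of_bool (i < X v K \<and> j < X v K)) * (expectation (f i) * expectation (f j)))"
proof -
  have c: "cross v f K = (\<Sum>i<L (length v). \<Sum>j\<in>{..<L (length v)} - {i}. of_bool (i < X v K \<and> j < X v K) * (f i K * f j K))" for K
  proof -
    define c where "c i = of_bool (i < X v K) * f i K" for i
    have "cross v f K = (\<Sum>i<L (length v). c i)\<^sup>2 - (\<Sum>i<L (length v). (c i)\<^sup>2)"
    proof -
      have "(c i)\<^sup>2 = of_bool (i < X v K) * (f i K)\<^sup>2" for i by (simp add: c_def)
      thus ?thesis unfolding cross_def offspring_sum by (simp add: c_def)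
    qed
    also have "\<dots> = (\<Sum>i<L (length v). \<Sum>j\<in>{..<L (length v)} - {i}. c i * c j)"
      by (rule sum_square_off_diagonal) simp
    finally show ?thesis by (simp add: c_def of_bool_conj algebra_simps)
  qed
  have i: "adm {v} (\<lambda>K. of_bool (i < X v K \<and> j < X v K))" for i j
    by (rule adm_offspring[of v "\<lambda>x. of_bool (i < x \<and> j < x)"])
  have ff: "adm (cone (v @ [i]) \<union> cone (v @ [j])) (\<lambda>K. f i K * f j K)" for i j
    by (intro adm_mult adm_mono[OF f]) auto
  have d: "{v} \<inter> (cone (v @ [i]) \<union> cone (v @ [j])) = {}" for i j using cone_snoc[of v] by auto
  have A: "adm (cone v) (\<lambda>K. of_bool (i < X v K \<and> j < X v K) * (f i K * f j K))" for i j
    by (intro adm_mult adm_cone_snoc[OF f] adm_mono[OF i]) auto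
  have "expectation (cross v f) = (\<Sum>i<L (length v). \<Sum>j\<in>{..<L (length v)} - {i}. 
      expectation (\<lambda>K. of_bool (i < X v K \<and> j < X v K) * (f i K * f j K)))"
    unfolding c[abs_def] by (subst E_sum[of _ "cone v"], (intro adm_sum A)[1])+ simp
  also have "\<dots> = (\<Sum>i<L (length v). \<Sum>j\<in>{..<L (length v)} - {i}.
     expectation (\<lambda>K. of_bool (i < X v K \<and> j < X v K)) * (expectation (f i) * expectation (f j)))"
  proof (intro sum.cong refl)
    fix i j assume "j \<in> {..<L (length v)} - {i}"
    hence "expectation (\<lambda>K. f i K * f j K) = expectation (f i) * expectation (f j)"
      by (intro E_mult[OF f f] cone_disjoint) auto
    thus "expectation (\<lambda>K. of_bool (i < X v K \<and> j < X v K) * (f i K * f j K)) = 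
       expectation (\<lambda>K. of_bool (i < X v K \<and> j < X v K)) * (expectation (f i) * expectation (f j))"
      using E_mult[OF i ff d] by simp
  qed
  finally show ?thesis .
qed

lemma sum_prob_pairs: "(\<Sum>i<L (length v). \<Sum>j\<in>{..<L (length v)} - {i}. expectation (\<lambda>K. of_bool (i < X v K \<and> j < X v K))) = pair_mean v"
proof -
  have "cross v (\<lambda>_ _. 1) = (\<lambda>K. real (X v K) * (real (X v K) - 1))"
    by (simp add: fun_eq_iff cross_def power2_eq_square algebra_simps)
  thus ?thesis using E_cross[of v "\<lambda>_ _. 1"] pair_mean_eq[of v] by (simp add: prob_space)
qed

lemma E_cross_eq:
  assumes f: "\<And>i. adm (cone (v @ [i])) (f i)" and E: "\<And>i. expectation (f i) = y"
  shows "expectation (cross v f) = pair_mean v * y\<^sup>2"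
  unfolding E_cross[of v f, OF f] E sum_distrib_right[symmetric] sum_prob_pairs power2_eq_square ..

lemma E_cross_le:
  assumes f: "\<And>i. adm (cone (v @ [i])) (f i)" and E: "\<And>i. 0 \<le> expectation (f i)" "\<And>i. expectation (f i) \<le> y"
  shows "expectation (cross v f) \<le> pair_mean v * y\<^sup>2"
  unfolding E_cross[of v f, OF f] sum_prob_pairs[symmetric] sum_distrib_right power2_eq_square
proof (intro sum_mono mult_left_mono)
  show "expectation (f i) * expectation (f j) \<le> y * y" for i j
    by (rule mult_mono) (use E order_trans[OF E] in auto)
qed (auto intro!: Bochner_Integration.integral_nonneg)

text \<open>Cauchy-Schwarz over at most \<open>L\<^sup>2\<close> pairs. The right-hand side is again
  a sum over pairs of distinct children, whose subtrees are independent, so second moments of the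
  \<open>f i\<close> suffice. This is the gain from the truncation.\<close>

lemma cross_square_le: "(cross v f K)\<^sup>2 \<le> (real (L (length v)))\<^sup>2 * cross v (\<lambda>i K. (f i K)\<^sup>2) K"
proof -
  define I where "I = {..<X v K}"
  define P where "P = Sigma I (\<lambda>i. I - {i})"
  have fin: "finite I" by (simp add: I_def)
  have P: "cross v g K = (\<Sum>(i, j)\<in>P. g i K * g j K)" for g
    unfolding cross_def I_def[symmetric] P_def using fin 
    by (subst sum_square_off_diagonal) (simp_all add: sum.Sigma)
  have "card P \<le> card (I \<times> I)" unfolding P_def by (rule card_mono) (auto simp: fin)
  also have "\<dots> \<le> L (length v) * L (length v)"
    using \<xi>_le[of v "K v"] by (simp add: I_def card_cartesian_product mult_le_mono)
  finally have card: "real (card P) \<le> (real (L (length v)))\<^sup>2" by (metis of_nat_le_iff of_nat_mult power2_eq_square)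
  have "(cross v f K)\<^sup>2 \<le> real (card P) * (\<Sum>(i, j)\<in>P. (f i K * f j K)\<^sup>2)"
    unfolding P using sum_squared_le_sum_of_squares[of "\<lambda>(i, j). f i K * f j K" P] 
    by (simp add: case_prod_unfold mult.commute)
  also have "(\<Sum>(i, j)\<in>P. (f i K * f j K)\<^sup>2) = cross v (\<lambda>i K. (f i K)\<^sup>2) K"
    unfolding P by (simp add: power_mult_distrib case_prod_unfold)
  also have "real (card P) * \<dots> \<le> (real (L (length v)))\<^sup>2 * cross v (\<lambda>i K. (f i K)\<^sup>2) K"
    using card by (rule mult_right_mono) (auto simp: P intro!: sum_nonneg)
  finally show ?thesis .
qed

lemma E_offspring_sum_square_le:
  assumes f: "\<And>i. adm (cone (v @ [i])) (f i)" and E: "\<And>i. expectation (f i) = y" 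
    and s: "\<And>i. expectation (\<lambda>K. (f i K)\<^sup>2) \<le> s"
  shows "expectation (\<lambda>K. (\<Sum>i<X v K. f i K)\<^sup>2) \<le> m (length v) * s + pair_mean v * y\<^sup>2"
proof -
  have f2: "adm (cone (v @ [i])) (\<lambda>K. (f i K)\<^sup>2)" for i by (rule adm_power2[OF f])
  have "expectation (\<lambda>K. (\<Sum>i<X v K. f i K)\<^sup>2) = expectation (\<lambda>K. (\<Sum>i<X v K. (f i K)\<^sup>2) + cross v f K)"
    by (simp add: cross_def)
  also have "\<dots> = expectation (\<lambda>K. \<Sum>i<X v K. (f i K)\<^sup>2) + expectation (cross v f)"
    by (rule E_add[of "cone v"]) (intro adm_offspring_sum f2 adm_cross f)+
  finally show ?thesis
    using E_offspring_sum_le[of v "\<lambda>i K. (f i K)\<^sup>2", OF f2 s] E_cross_eq[of v f, OF f E] by simp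
qed

section \<open>Sums over the descendants in a given generation\<close>

primrec gen_sum :: "(nat list \<Rightarrow> (nat list \<Rightarrow> nat) \<Rightarrow> real) \<Rightarrow> nat \<Rightarrow> nat list \<Rightarrow> (nat list \<Rightarrow> nat) \<Rightarrow> real" where
  "gen_sum Y 0 v K = Y v K"
| "gen_sum Y (Suc n) v K = (\<Sum>i<X v K. gen_sum Y n (v @ [i]) K)"

text \<open>The mean number of descendants that an individual of generation \<open>k\<close> has
  \<open>n\<close> generations later.\<close>

definition growth :: "nat \<Rightarrow> nat \<Rightarrow> real" where "growth k n = (\<Prod>i<n. m (k + i))"

lemma growth_0 [simp]: "growth k 0 = 1" by (simp add: growth_def)

lemma growth_Suc: "growth k (Suc n) = m k * growth (Suc k) n"
  by (simp only: growth_def prod.lessThan_Suc_shift) simp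

lemma growth_Suc': "growth k (Suc n) = growth k n * m (k + n)" by (simp add: growth_def)

lemma growth_add: "growth k (i + j) = growth k i * growth (k + i) j"
  by (induction j) (simp_all add: growth_Suc' add.assoc)

lemma growth_pos: "0 < growth k n" unfolding growth_def by (intro prod_pos) (auto simp: m_pos)

lemma growth_nonneg: "0 \<le> growth k n" using growth_pos[of k n] by simp

text \<open>The definition splits off the first generation below \<open>v\<close>; comparing two
  consecutive generations below a fixed \<open>v\<close> requires splitting off the last.\<close>

lemma gen_sum_Suc_back: "gen_sum Y (Suc n) v K = gen_sum (\<lambda>u K. \<Sum>i<X u K. Y (u @ [i]) K) n v K"
proof (induction n arbitrary: v)
  case (Suc n)
  have "gen_sum Y (Suc (Suc n)) v K = (\<Sum>i<X v K. gen_sum Y (Suc n) (v @ [i]) K)" by (simp only: gen_sum.simps)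
  thus ?case by (simp only: Suc gen_sum.simps(2)[of _ n v K])
qed simp

lemma adm_gen_sum: "(\<And>v. adm (cone v) (Y v)) \<Longrightarrow> adm (cone v) (gen_sum Y n v)"
proof (induction n arbitrary: v)
  case 0 thus ?case by (simp add: gen_sum.simps(1)[abs_def])
next
  case (Suc n)
  show ?case unfolding gen_sum.simps[abs_def] by (intro adm_offspring_sum Suc)
qed

lemma gen_sum_nonneg: "(\<And>v K. 0 \<le> Y v K) \<Longrightarrow> 0 \<le> gen_sum Y n v K"
  by (induction n arbitrary: v) (auto intro: sum_nonneg)

lemma gen_sum_mono: "(\<And>v. Y v K \<le> Y' v K) \<Longrightarrow> gen_sum Y n v K \<le> gen_sum Y' n v K"
  by (induction n arbitrary: v) (auto intro: sum_mono)

lemma gen_sum_add: "gen_sum (\<lambda>v K. Y v K + Y' v K) n v K = gen_sum Y n v K + gen_sum Y' n v K"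
  by (induction n arbitrary: v) (auto simp: sum.distrib)

lemma gen_sum_cmult: "gen_sum (\<lambda>v K. c * Y v K) n v K = c * gen_sum Y n v K"
  by (induction n arbitrary: v) (auto simp: sum_distrib_left)

lemma gen_sum_level_cmult: "(\<And>u. length u = length v + n \<Longrightarrow> Y u K = c * Y' u K) \<Longrightarrow> gen_sum Y n v K = c * gen_sum Y' n v K"
  by (induction n arbitrary: v) (auto simp: sum_distrib_left)

text \<open>Distinct vertices of a generation carry independent centred terms, so the mixed terms
  vanish and the variance grows like the number of vertices, not like its square.\<close>

lemma gen_sum_mean_zero:
  assumes Y: "\<And>v. adm (cone v) (Y v)" "\<And>v. expectation (Y v) = 0"
    and s: "\<And>v. expectation (\<lambda>K. (Y v K)\<^sup>2) \<le> s (length v)"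
  shows "expectation (gen_sum Y n v) = 0 \<and> expectation (\<lambda>K. (gen_sum Y n v K)\<^sup>2) \<le> growth (length v) n * s (length v + n)"
proof (induction n arbitrary: v)
  case 0
  show ?case using Y s[of v] by (simp add: gen_sum.simps(1)[abs_def])
next
  case (Suc n)
  note A = adm_gen_sum[of Y, OF Y(1)]
  have E: "expectation (gen_sum Y n (v @ [i])) = 0" and
       S: "expectation (\<lambda>K. (gen_sum Y n (v @ [i]) K)\<^sup>2) \<le> growth (Suc (length v)) n * s (length v + Suc n)" for i
    using Suc.IH[of "v @ [i]"] by simp_all
  have "expectation (\<lambda>K. \<Sum>i<X v K. gen_sum Y n (v @ [i]) K) = 0"
    using E_offspring_sum_eq[of v "\<lambda>i. gen_sum Y n (v @ [i])" 0] A E by simp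
  moreover have "expectation (\<lambda>K. (\<Sum>i<X v K. gen_sum Y n (v @ [i]) K)\<^sup>2) \<le> m (length v) * (growth (Suc (length v)) n * s (length v + Suc n)) + pair_mean v * 0\<^sup>2"
    by (rule E_offspring_sum_square_le) (use A E S in auto)
  ultimately show ?case by (simp add: growth_Suc mult.assoc)
qed

text \<open>The normalised number of descendants of \<open>v\<close> in its \<open>n\<close>-th generation, a martingale in \<open>n\<close>.\<close>

definition W :: "nat \<Rightarrow> nat list \<Rightarrow> (nat list \<Rightarrow> nat) \<Rightarrow> real" where
  "W n v K = gen_sum (\<lambda>_ _. 1) n v K / growth (length v) n"

text \<open>\<open>V / (a\<^sup>2 - a)\<close> is the fixed point of
  \<open>y = y / a + V / a\<^sup>2\<close>, the recursion for the second moment of \<open>W\<close>;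
  the additional 1 covers the start \<open>W 0 = 1\<close>.\<close>

definition W_bound :: real where "W_bound = 1 + V / (a\<^sup>2 - a)"

lemma a_sq: "0 < a\<^sup>2 - a" using a(1) by (simp add: power2_eq_square)

lemma W_bound_ge_1: "1 \<le> W_bound" using V_nonneg a_sq by (simp add: W_bound_def)

lemma adm_W: "adm (cone v) (W n v)"
  unfolding W_def[abs_def] by (intro adm_divide adm_gen_sum adm_const)

lemma W_nonneg: "0 \<le> W n v K"
  unfolding W_def by (intro divide_nonneg_nonneg gen_sum_nonneg growth_nonneg) auto

lemma W_0 [simp]: "W 0 v K = 1" by (simp add: W_def)

lemma W_Suc: "W (Suc n) v K = (\<Sum>i<X v K. W n (v @ [i]) K) / m (length v)"
  by (simp add: W_def growth_Suc sum_divide_distrib mult.commute)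

lemma W_moments: "expectation (W n v) = 1 \<and> expectation (\<lambda>K. (W n v K)\<^sup>2) \<le> W_bound"
proof (induction n arbitrary: v)
  case 0
  have "W 0 v = (\<lambda>_. 1)" by (simp add: fun_eq_iff)
  thus ?case using W_bound_ge_1 by simp
next
  case (Suc n)
  let ?m = "m (length v)"
  have E: "expectation (W n (v @ [i])) = 1" and S: "expectation (\<lambda>K. (W n (v @ [i]) K)\<^sup>2) \<le> W_bound" for i
    using Suc.IH by auto
  have "expectation (\<lambda>K. \<Sum>i<X v K. W n (v @ [i]) K) = ?m * 1"
    by (rule E_offspring_sum_eq[OF adm_W E])
  hence 1: "expectation (W (Suc n) v) = 1" using m_pos[of "length v"] by (simp add: W_Suc[abs_def])
  have "expectation (\<lambda>K. (\<Sum>i<X v K. W n (v @ [i]) K)\<^sup>2) \<le> ?m * W_bound + pair_mean v * 1\<^sup>2"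
    by (rule E_offspring_sum_square_le[OF adm_W E S])
  also have "\<dots> \<le> ?m * W_bound + V" using pair_mean_bounds by simp
  finally have "expectation (\<lambda>K. (W (Suc n) v K)\<^sup>2) \<le> (?m * W_bound + V) / ?m\<^sup>2"
    unfolding W_Suc power_divide by (simp add: divide_right_mono)
  also have "\<dots> = W_bound / ?m + V / ?m\<^sup>2" using m_pos[of "length v"] by (simp add: field_simps power2_eq_square)
  also have "\<dots> \<le> W_bound / a + V / a\<^sup>2"
    using a V_nonneg W_bound_ge_1 m_pos[of "length v"]
    by (intro add_mono divide_left_mono power_mono mult_pos_pos zero_less_power) auto
  also have "\<dots> \<le> W_bound"
  proof -
    define e where "e = V / (a\<^sup>2 - a)"
    have "V = e * (a\<^sup>2 - a)" using a_sq by (simp add: e_def)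
    hence "V / a\<^sup>2 = e - e / a" using a(1) by (simp add: field_simps power2_eq_square)
    moreover have "W_bound / a = 1 / a + e / a" by (simp add: W_bound_def e_def add_divide_distrib)
    ultimately show ?thesis using a(1) by (simp add: W_bound_def e_def[symmetric])
  qed
  finally show ?case using 1 by simp
qed

section \<open>Fluctuations of the sums over pairs of siblings\<close>

definition pair_sum :: "nat \<Rightarrow> nat list \<Rightarrow> (nat list \<Rightarrow> nat) \<Rightarrow> real" where
  "pair_sum n v = cross v (\<lambda>i. W n (v @ [i]))"

lemma adm_pair_sum: "adm (cone v) (pair_sum n v)"
  unfolding pair_sum_def by (intro adm_cross adm_W)

lemma pair_sum_moments: "expectation (pair_sum n v) = pair_mean v" "expectation (\<lambda>K. (pair_sum n v K)\<^sup>2) \<le> (real (L (length v)))\<^sup>2 * V * W_bound\<^sup>2"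
proof -
  show "expectation (pair_sum n v) = pair_mean v"
    unfolding pair_sum_def using E_cross_eq[of v "\<lambda>i. W n (v @ [i])" 1] adm_W W_moments by simp
  have "expectation (\<lambda>K. (pair_sum n v K)\<^sup>2) \<le> expectation (\<lambda>K. (real (L (length v)))\<^sup>2 * cross v (\<lambda>i K. (W n (v @ [i]) K)\<^sup>2) K)"
    unfolding pair_sum_def
    by (rule E_mono[of "cone v"]) (intro adm_power2 adm_cross adm_mult adm_const adm_W cross_square_le)+
  also have "\<dots> = (real (L (length v)))\<^sup>2 * expectation (cross v (\<lambda>i K. (W n (v @ [i]) K)\<^sup>2))" by simp
  also have "expectation (cross v (\<lambda>i K. (W n (v @ [i]) K)\<^sup>2)) \<le> pair_mean v * W_bound\<^sup>2"
    using W_moments by (intro E_cross_le adm_power2 adm_W) auto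
  also have "\<dots> \<le> V * W_bound\<^sup>2" using pair_mean_bounds by (simp add: mult_right_mono)
  finally show "expectation (\<lambda>K. (pair_sum n v K)\<^sup>2) \<le> (real (L (length v)))\<^sup>2 * V * W_bound\<^sup>2"
    by (simp add: mult_left_mono mult.assoc)
qed

text \<open>Subtracting a multiple of \<open>W\<close> instead of the mean spares a separate bound on \<open>sup\<^sub>j W j\<close>: the
  sum of \<open>W (N - j)\<close> over generation \<open>j\<close> is a multiple of \<open>W N\<close>.\<close>

definition centred_pairs :: "nat \<Rightarrow> nat list \<Rightarrow> (nat list \<Rightarrow> nat) \<Rightarrow> real" where
  "centred_pairs n v K = pair_sum n v K - pair_mean v * W (Suc n) v K"

lemma adm_centred_pairs: "adm (cone v) (centred_pairs n v)"
  unfolding centred_pairs_def[abs_def] by (intro adm_diff adm_pair_sum adm_mult adm_const adm_W)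

lemma L_ge_1: "1 \<le> L (length v)" for v :: "nat list" using \<xi>_le[of v 0] \<xi>_pos[of v 0] by simp

text \<open>Comes from \<open>(x - y)\<^sup>2 \<le> 2 * x\<^sup>2 + 2 * y\<^sup>2\<close>, applied
  to the two parts of \<open>centred_pairs\<close>.\<close>

definition c\<^sub>D :: real where "c\<^sub>D = 2 * V * W_bound\<^sup>2 + 2 * V\<^sup>2 * W_bound"

lemma c\<^sub>D_nonneg: "0 \<le> c\<^sub>D" using V_nonneg W_bound_ge_1 by (simp add: c\<^sub>D_def)

lemma centred_pairs_moments: "expectation (centred_pairs n v) = 0" "expectation (\<lambda>K. (centred_pairs n v K)\<^sup>2) \<le> c\<^sub>D * (real (L (length v)))\<^sup>2"
proof -
  show "expectation (centred_pairs n v) = 0"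
    unfolding centred_pairs_def using pair_sum_moments(1)[of n v] W_moments[of "Suc n" v]
    by (subst E_diff[of "cone v"]) (auto intro: adm_pair_sum adm_mult adm_W)
  have "expectation (\<lambda>K. (centred_pairs n v K)\<^sup>2) \<le> expectation (\<lambda>K. 2 * (pair_sum n v K)\<^sup>2 + (2 * V\<^sup>2) * (W (Suc n) v K)\<^sup>2)"
  proof (rule E_mono[of "cone v"])
    fix K
    have "(centred_pairs n v K)\<^sup>2 \<le> 2 * (pair_sum n v K)\<^sup>2 + 2 * (pair_mean v * W (Suc n) v K)\<^sup>2"
      using zero_le_power2[of "pair_sum n v K + pair_mean v * W (Suc n) v K"] by (simp add: centred_pairs_def power2_diff power2_sum)
    also have "(pair_mean v * W (Suc n) v K)\<^sup>2 \<le> (V * W (Suc n) v K)\<^sup>2"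
      using pair_mean_bounds[of v] W_nonneg by (intro power_mono mult_right_mono mult_nonneg_nonneg) auto
    finally show "(centred_pairs n v K)\<^sup>2 \<le> 2 * (pair_sum n v K)\<^sup>2 + (2 * V\<^sup>2) * (W (Suc n) v K)\<^sup>2"
      by (simp add: power_mult_distrib)
  qed (intro adm_add adm_mult adm_const adm_power2 adm_centred_pairs adm_pair_sum adm_W)+
  also have "\<dots> = 2 * expectation (\<lambda>K. (pair_sum n v K)\<^sup>2) + (2 * V\<^sup>2) * expectation (\<lambda>K. (W (Suc n) v K)\<^sup>2)"
    by (subst E_add[of "cone v"]) (simp | intro adm_mult adm_const adm_power2 adm_pair_sum adm_W)+
  also have "\<dots> \<le> 2 * ((real (L (length v)))\<^sup>2 * V * W_bound\<^sup>2) + (2 * V\<^sup>2) * W_bound"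
    using pair_sum_moments(2)[of n v] W_moments[of "Suc n" v] by (intro add_mono mult_left_mono) auto
  also have "(2 * V\<^sup>2) * W_bound \<le> (2 * V\<^sup>2) * W_bound * (real (L (length v)))\<^sup>2"
    using mult_left_mono[of 1 "(real (L (length v)))\<^sup>2" "(2 * V\<^sup>2) * W_bound"] W_bound_ge_1 L_ge_1[of v]
    by (simp add: one_le_power)
  finally show "expectation (\<lambda>K. (centred_pairs n v K)\<^sup>2) \<le> c\<^sub>D * (real (L (length v)))\<^sup>2"
    by (simp add: c\<^sub>D_def algebra_simps)
qed

text \<open>The index \<open>N - 1 - j\<close> follows the children of generation \<open>j\<close>
  down to generation \<open>N\<close>, all relative to \<open>v\<close>. Summing the squares makes
  one bound control all generations at once.\<close>

definition fluct :: "nat \<Rightarrow> nat list \<Rightarrow> (nat list \<Rightarrow> nat) \<Rightarrow> real" where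
  "fluct N v K = (\<Sum>j<N. (gen_sum (centred_pairs (N - 1 - j)) j v K)\<^sup>2 / (growth (length v) j)\<^sup>2)"

definition fluct_mean :: "nat \<Rightarrow> real" where
  "fluct_mean k = c\<^sub>D * (\<Sum>j. (real (L (k + j)))\<^sup>2 / growth k j)"

lemma adm_fluct: "adm (cone v) (fluct N v)"
  unfolding fluct_def[abs_def] by (intro adm_sum adm_divide adm_power2 adm_gen_sum adm_centred_pairs)

lemma fluct_nonneg: "0 \<le> fluct N v K"
  by (auto simp: fluct_def intro!: sum_nonneg)

lemma E_fluct: "expectation (fluct N v) \<le> fluct_mean (length v)"
proof -
  let ?k = "length v"
  have "expectation (fluct N v) = (\<Sum>j<N. expectation (\<lambda>K. (gen_sum (centred_pairs (N - 1 - j)) j v K)\<^sup>2 / (growth ?k j)\<^sup>2))"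
    unfolding fluct_def[abs_def] by (rule E_sum[of _ "cone v"]) (intro adm_divide adm_power2 adm_gen_sum adm_centred_pairs)
  also have "\<dots> \<le> (\<Sum>j<N. c\<^sub>D * ((real (L (?k + j)))\<^sup>2 / growth ?k j))"
  proof (rule sum_mono)
    fix j
    have "expectation (\<lambda>K. (gen_sum (centred_pairs (N - 1 - j)) j v K)\<^sup>2) \<le> growth ?k j * (c\<^sub>D * (real (L (?k + j)))\<^sup>2)"
      using gen_sum_mean_zero[of "centred_pairs (N - 1 - j)" "\<lambda>k. c\<^sub>D * (real (L k))\<^sup>2" j v] adm_centred_pairs centred_pairs_moments by auto
    hence "expectation (\<lambda>K. (gen_sum (centred_pairs (N - 1 - j)) j v K)\<^sup>2) / (growth ?k j)\<^sup>2 \<le> growth ?k j * (c\<^sub>D * (real (L (?k + j)))\<^sup>2) / (growth ?k j)\<^sup>2"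
      by (rule divide_right_mono) simp
    also have "\<dots> = c\<^sub>D * ((real (L (?k + j)))\<^sup>2 / growth ?k j)"
      using growth_pos[of ?k j] by (simp add: power2_eq_square)
    finally show "expectation (\<lambda>K. (gen_sum (centred_pairs (N - 1 - j)) j v K)\<^sup>2 / (growth ?k j)\<^sup>2) \<le> \<dots>" by simp
  qed
  also have "\<dots> = c\<^sub>D * (\<Sum>j<N. (real (L (?k + j)))\<^sup>2 / growth ?k j)" by (simp add: sum_distrib_left)
  also have "\<dots> \<le> fluct_mean ?k"
    unfolding fluct_mean_def using summable_L[of ?k] c\<^sub>D_nonneg growth_nonneg
    by (intro mult_left_mono sum_le_suminf) (auto simp: growth_def[symmetric])
  finally show ?thesis .
qed

lemma fluct_mean_nonneg: "0 \<le> fluct_mean k"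
  unfolding fluct_mean_def using summable_L[of k] c\<^sub>D_nonneg growth_nonneg
  by (intro mult_nonneg_nonneg suminf_nonneg) (auto simp: growth_def[symmetric])

section \<open>Vertices with many descendants and small fluctuations\<close>

definition fluct_bound :: "nat \<Rightarrow> real" where "fluct_bound k = 8 * W_bound * (fluct_mean k + 1)"

definition good :: "nat \<Rightarrow> nat list \<Rightarrow> (nat list \<Rightarrow> nat) set" where
  "good N v = {K. 1 / 2 \<le> W N v K \<and> fluct N v K \<le> fluct_bound (length v)}"

lemma meas [measurable]: "W N v \<in> borel_measurable \<Omega>" "fluct N v \<in> borel_measurable \<Omega>"
  using adm_W adm_fluct by (auto simp: adm_def)

lemma good_sets [measurable]: "good N v \<in> sets \<Omega>"
proof -
  have "{K \<in> space \<Omega>. 1 / 2 \<le> W N v K \<and> fluct N v K \<le> fluct_bound (length v)} \<in> sets \<Omega>" by measurable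
  thus ?thesis by (simp add: good_def)
qed

text \<open>A Paley-Zygmund argument, in the form of a pointwise quadratic bound on
  \<open>W\<close>, gives \<open>1 / 2 \<le> W\<close> with probability at least
  \<open>1 / (4 * W_bound)\<close>. The factor \<open>8 * W_bound\<close> in
  \<open>fluct_bound\<close> is chosen so that, by Markov's inequality, large fluctuations cost at
  most half of this.\<close>

lemma prob_good: "1 / (8 * W_bound) \<le> prob (good N v)"
proof -
  have W_bound: "0 < W_bound" using W_bound_ge_1 by simp
  have sets1: "{K. 1 / 2 \<le> W N v K} \<in> sets \<Omega>" and sets2: "{K. fluct_bound (length v) < fluct N v K} \<in> sets \<Omega>"
  proof -
    have "{K \<in> space \<Omega>. 1 / 2 \<le> W N v K} \<in> sets \<Omega>" "{K \<in> space \<Omega>. fluct_bound (length v) < fluct N v K} \<in> sets \<Omega>" by measurable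
    thus "{K. 1 / 2 \<le> W N v K} \<in> sets \<Omega>" "{K. fluct_bound (length v) < fluct N v K} \<in> sets \<Omega>" by simp_all
  qed
  have "1 = expectation (W N v)" using W_moments by simp
  also have "\<dots> \<le> expectation (\<lambda>K. 1 / 2 + ((W N v K)\<^sup>2 / (4 * W_bound) + W_bound * indicator {K. 1 / 2 \<le> W N v K} K))"
  proof (rule integral_mono)
    fix K
    have "0 \<le> (W N v K - 2 * W_bound)\<^sup>2" by simp
    hence "W N v K \<le> (W N v K)\<^sup>2 / (4 * W_bound) + W_bound" using W_bound by (simp add: power2_eq_square field_simps)
    thus "W N v K \<le> 1 / 2 + ((W N v K)\<^sup>2 / (4 * W_bound) + W_bound * indicator {K. 1 / 2 \<le> W N v K} K)"
    proof (cases "1 / 2 \<le> W N v K")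
      case False
      have "0 \<le> (W N v K)\<^sup>2 / (4 * W_bound)" using W_bound by simp
      with False show ?thesis by simp
    qed simp
  qed (use adm_integrable[OF adm_W] adm_integrable[OF adm_power2[OF adm_W]] sets1 in \<open>auto intro!: Bochner_Integration.integrable_add simp: less_top[symmetric]\<close>)
  also have "\<dots> = 1 / 2 + (expectation (\<lambda>K. (W N v K)\<^sup>2) / (4 * W_bound) + W_bound * prob {K. 1 / 2 \<le> W N v K})"
    using adm_integrable[OF adm_power2[OF adm_W]] sets1 
    by (subst Bochner_Integration.integral_add | simp add: less_top[symmetric])+
  also have "expectation (\<lambda>K. (W N v K)\<^sup>2) / (4 * W_bound) \<le> 1 / 4"
    using W_moments[of N v] W_bound by (simp add: field_simps)
  finally have 1: "1 / (4 * W_bound) \<le> prob {K. 1 / 2 \<le> W N v K}" using W_bound by (simp add: field_simps)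
  have dpos: "0 < fluct_bound (length v)" using W_bound fluct_mean_nonneg by (simp add: fluct_bound_def add_nonneg_pos)
  have "prob {K. fluct_bound (length v) < fluct N v K} * fluct_bound (length v) = expectation (\<lambda>K. fluct_bound (length v) * indicator {K. fluct_bound (length v) < fluct N v K} K)"
    using sets2 by simp
  also have "\<dots> \<le> expectation (fluct N v)"
  proof (rule integral_mono)
    show "integrable \<Omega> (\<lambda>K. fluct_bound (length v) * indicator {K. fluct_bound (length v) < fluct N v K} K)"
      using sets2 by (intro integrable_mult_right integrable_real_indicator) (auto simp: less_top[symmetric])
    show "fluct_bound (length v) * indicator {K. fluct_bound (length v) < fluct N v K} K \<le> fluct N v K" for K
      using fluct_nonneg[of N v K] by (auto simp: indicator_def)
  qed (rule adm_integrable[OF adm_fluct])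
  also have "\<dots> \<le> fluct_mean (length v)" by (rule E_fluct)
  also have "\<dots> \<le> fluct_bound (length v) / (8 * W_bound)" using W_bound by (simp add: fluct_bound_def)
  finally have "prob {K. fluct_bound (length v) < fluct N v K} * fluct_bound (length v) \<le> 1 / (8 * W_bound) * fluct_bound (length v)" by simp
  hence 2: "prob {K. fluct_bound (length v) < fluct N v K} \<le> 1 / (8 * W_bound)" using dpos by (rule mult_right_le_imp_le)
  have "prob {K. 1 / 2 \<le> W N v K} \<le> prob (good N v \<union> {K. fluct_bound (length v) < fluct N v K})"
    using sets2 good_sets by (intro finite_measure_mono) (auto simp: good_def)
  also have "\<dots> \<le> prob (good N v) + prob {K. fluct_bound (length v) < fluct N v K}"
    using sets2 good_sets by (intro measure_Un_le) auto
  finally have "prob {K. 1 / 2 \<le> W N v K} \<le> prob (good N v) + prob {K. fluct_bound (length v) < fluct N v K}" .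
  moreover have "1 / (4 * W_bound) = 1 / (8 * W_bound) + 1 / (8 * W_bound)" by simp
  ultimately show ?thesis using 1 2 by linarith
qed

lemma gen_sum_W: "gen_sum (W n) j v K = W (n + j) v K * growth (length v) j"
proof (induction j arbitrary: v)
  case (Suc j)
  have "gen_sum (W n) (Suc j) v K = (\<Sum>i<X v K. W (n + j) (v @ [i]) K) * growth (Suc (length v)) j"
    by (simp add: Suc sum_distrib_right)
  also have "\<dots> = W (n + Suc j) v K * growth (length v) (Suc j)"
    using m_pos[of "length v"] by (simp add: W_Suc growth_Suc)
  finally show ?case .
qed simp

text \<open>Let \<open>t j\<close> be the normalised sum of \<open>W\<^sup>2\<close> over generation
  \<open>j\<close>. In expanding each square over the children, the diagonal terms give at most
  \<open>t (j + 1) / a\<close>; the pairs of siblings contribute a centred part, bounded through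
  \<open>fluct\<close>, and a multiple of \<open>W\<close>, together at most
  \<open>\<delta>\<close>. Going up from \<open>t N = w\<close> leaves a geometric series.\<close>

lemma good_second_moment:
  assumes "K \<in> good N v" "j \<le> N"
  shows "growth (length v) j * gen_sum (\<lambda>u K. (gen_sum (\<lambda>_ _. 1) (N - j) u K)\<^sup>2) j v K \<le>
    (a / (a - 1) * (4 * sqrt (fluct_bound (length v)) + 2 * (V + 1))) * (gen_sum (\<lambda>_ _. 1) N v K)\<^sup>2"
proof -
  let ?k = "length v"
  define w where "w = W N v K"
  have w: "1 / 2 \<le> w" using assms(1) by (simp add: good_def w_def)
  have f: "fluct N v K \<le> fluct_bound ?k" using assms(1) by (simp add: good_def)
  define \<delta> where "\<delta> = sqrt (fluct_bound ?k) + V * w"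
  define t where "t j = gen_sum (\<lambda>u K. (W (N - j) u K)\<^sup>2) j v K / growth ?k j" for j
  have \<delta>: "0 \<le> \<delta>" using f fluct_nonneg[of N v K] V_nonneg w by (auto simp: \<delta>_def intro!: add_nonneg_nonneg)
  have step: "t j \<le> t (Suc j) / a + \<delta>" if j: "j < N" for j
  proof -
    define n where "n = N - Suc j"
    have n: "N - j = Suc n" "N - 1 - j = n" "Suc n + j = N" using j by (auto simp: n_def)
    let ?m = "m (?k + j)"
    have m1: "1 \<le> ?m" using a(1) a(2)[of "?k + j"] by simp
    have eq: "(W (Suc n) u K)\<^sup>2 = (1 / ?m\<^sup>2) * ((\<Sum>i<X u K. (W n (u @ [i]) K)\<^sup>2) + (centred_pairs n u K + pair_mean u * W (Suc n) u K))" 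
      if "length u = ?k + j" for u
      using that by (simp add: W_Suc centred_pairs_def pair_sum_def cross_def power_divide)
    have "gen_sum (\<lambda>u K. (W (Suc n) u K)\<^sup>2) j v K = (1 / ?m\<^sup>2) * 
        gen_sum (\<lambda>u K. (\<Sum>i<X u K. (W n (u @ [i]) K)\<^sup>2) + (centred_pairs n u K + pair_mean u * W (Suc n) u K)) j v K"
      by (rule gen_sum_level_cmult) (rule eq)
    also have "\<dots> = (1 / ?m\<^sup>2) * (gen_sum (\<lambda>u K. (W n u K)\<^sup>2) (Suc j) v K + (gen_sum (centred_pairs n) j v K + gen_sum (\<lambda>u K. pair_mean u * W (Suc n) u K) j v K))"
      by (simp only: gen_sum_add gen_sum_Suc_back)
    finally have "t j = (1 / ?m\<^sup>2) * (gen_sum (\<lambda>u K. (W n u K)\<^sup>2) (Suc j) v K / growth ?k j) + 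
         (1 / ?m\<^sup>2) * (gen_sum (centred_pairs n) j v K / growth ?k j + gen_sum (\<lambda>u K. pair_mean u * W (Suc n) u K) j v K / growth ?k j)"
      unfolding t_def n by (simp add: add_divide_distrib distrib_left)
    also have "(1 / ?m\<^sup>2) * (gen_sum (\<lambda>u K. (W n u K)\<^sup>2) (Suc j) v K / growth ?k j) = t (Suc j) / ?m"
      using m_pos[of "?k + j"] by (simp add: t_def growth_Suc' n_def[symmetric] power2_eq_square del: gen_sum.simps)
    also have "t (Suc j) / ?m \<le> t (Suc j) / a"
      using a by (intro divide_left_mono) (auto simp: t_def m_pos intro!: divide_nonneg_nonneg gen_sum_nonneg growth_nonneg simp del: gen_sum.simps)
    also have "(1 / ?m\<^sup>2) * (gen_sum (centred_pairs n) j v K / growth ?k j + gen_sum (\<lambda>u K. pair_mean u * W (Suc n) u K) j v K / growth ?k j) \<le> 1 * \<delta>"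
    proof -
      have "(gen_sum (centred_pairs n) j v K / growth ?k j)\<^sup>2 \<le> fluct N v K"
        unfolding fluct_def power_divide n(2)[symmetric] using j by (intro member_le_sum) auto
      hence "gen_sum (centred_pairs n) j v K / growth ?k j \<le> sqrt (fluct_bound ?k)"
        using f by (intro real_le_rsqrt) simp
      moreover have "gen_sum (\<lambda>u K. pair_mean u * W (Suc n) u K) j v K \<le> gen_sum (\<lambda>u K. V * W (Suc n) u K) j v K"
        by (intro gen_sum_mono mult_right_mono pair_mean_bounds W_nonneg)
      hence "gen_sum (\<lambda>u K. pair_mean u * W (Suc n) u K) j v K / growth ?k j \<le> V * w"
        using growth_pos[of ?k j] by (simp add: gen_sum_cmult gen_sum_W n(3)[simplified] w_def divide_le_eq mult.assoc)
      ultimately have *: "gen_sum (centred_pairs n) j v K / growth ?k j + gen_sum (\<lambda>u K. pair_mean u * W (Suc n) u K) j v K / growth ?k j \<le> \<delta>"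
        by (simp add: \<delta>_def)
      have "1 / ?m\<^sup>2 \<le> 1" "0 \<le> 1 / ?m\<^sup>2" using m1 by (auto simp: one_le_power)
      hence "1 / ?m\<^sup>2 * (gen_sum (centred_pairs n) j v K / growth ?k j + gen_sum (\<lambda>u K. pair_mean u * W (Suc n) u K) j v K / growth ?k j) \<le> 1 / ?m\<^sup>2 * \<delta>"
        by (intro mult_left_mono[OF *])
      also have "\<dots> \<le> 1 * \<delta>" using \<open>1 / ?m\<^sup>2 \<le> 1\<close> \<delta> by (rule mult_right_mono)
      finally show ?thesis .
    qed
    finally show ?thesis by simp
  qed
  \<comment> \<open>The fixed point of \<open>y = y / a + \<delta> + w\<close>; the extra
    \<open>w\<close> makes it dominate the starting value \<open>t N = w\<close>.\<close>
  define B where "B = (\<delta> + w) * (a / (a - 1))"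
  have B: "\<delta> + w + B / a = B" using a(1) by (simp add: B_def field_simps)
  have tB: "t (N - i) \<le> B" if "i \<le> N" for i
    using that
  proof (induction i)
    case 0
    have "gen_sum (W 0) N v K = W N v K * growth ?k N" using gen_sum_W[of 0 N v K] by simp
    moreover have "gen_sum (\<lambda>u K. (W 0 u K)\<^sup>2) N v K = gen_sum (W 0) N v K"
      using gen_sum_level_cmult[of v N "\<lambda>u K. (W 0 u K)\<^sup>2" K 1 "W 0"] by simp
    ultimately have "t N = w" using growth_pos[of ?k N] by (simp add: t_def w_def)
    moreover have "0 \<le> B / a" using \<delta> w a(1) by (simp add: B_def)
    ultimately show ?case using B \<delta> by simp
  next
    case (Suc i)
    have "t (N - Suc i) \<le> t (Suc (N - Suc i)) / a + \<delta>" using Suc.prems by (intro step) simp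
    also have "Suc (N - Suc i) = N - i" using Suc.prems by simp
    also have "t (N - i) / a \<le> B / a" using Suc a(1) by (intro divide_right_mono) auto
    finally show ?case using B w by simp
  qed
  have "t j \<le> B" using tB[of "N - j"] assms(2) by simp
  also have "B \<le> (a / (a - 1) * (4 * sqrt (fluct_bound ?k) + 2 * (V + 1))) * w\<^sup>2"
  proof -
    \<comment> \<open>The bound must be relative to the squared size of generation \<open>N\<close>;
      \<open>w \<ge> 1 / 2\<close> raises the lower powers of \<open>w\<close> to the
      second.\<close>
    have "1 / 4 \<le> w\<^sup>2" using power_mono[OF w, of 2] by (simp add: power2_eq_square)
    hence "sqrt (fluct_bound ?k) * (1 / 4) \<le> sqrt (fluct_bound ?k) * w\<^sup>2"
      using f fluct_nonneg[of N v K] by (intro mult_left_mono) auto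
    moreover have "(V + 1) * (w * (1 / 2)) \<le> (V + 1) * (w * w)"
      using w V_nonneg by (intro mult_left_mono) auto
    ultimately have "\<delta> + w \<le> (4 * sqrt (fluct_bound ?k) + 2 * (V + 1)) * w\<^sup>2"
      by (simp add: \<delta>_def power2_eq_square algebra_simps)
    hence "B \<le> ((4 * sqrt (fluct_bound ?k) + 2 * (V + 1)) * w\<^sup>2) * (a / (a - 1))"
      unfolding B_def using a(1) by (intro mult_right_mono) auto
    thus ?thesis by (simp only: mult.commute mult.left_commute)
  qed
  finally have main: "t j \<le> (a / (a - 1) * (4 * sqrt (fluct_bound ?k) + 2 * (V + 1))) * w\<^sup>2" .
  let ?M = "growth ?k j" and ?R = "growth (?k + j) (N - j)"
  have MR: "growth ?k N = ?M * ?R" using growth_add[of ?k j "N - j"] assms(2) by simp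
  have "gen_sum (\<lambda>u K. (gen_sum (\<lambda>_ _. 1) (N - j) u K)\<^sup>2) j v K = ?R\<^sup>2 * gen_sum (\<lambda>u K. (W (N - j) u K)\<^sup>2) j v K"
    by (rule gen_sum_level_cmult) (use growth_pos[of "?k + j" "N - j"] in \<open>simp add: W_def power_divide\<close>)
  hence "?M * gen_sum (\<lambda>u K. (gen_sum (\<lambda>_ _. 1) (N - j) u K)\<^sup>2) j v K = (growth ?k N)\<^sup>2 * t j"
    using growth_pos[of ?k j] by (simp add: MR t_def power2_eq_square)
  also have "\<dots> \<le> (growth ?k N)\<^sup>2 * ((a / (a - 1) * (4 * sqrt (fluct_bound ?k) + 2 * (V + 1))) * w\<^sup>2)"
    by (rule mult_left_mono[OF main]) simp
  also have "\<dots> = (a / (a - 1) * (4 * sqrt (fluct_bound ?k) + 2 * (V + 1))) * (gen_sum (\<lambda>_ _. 1) N v K)\<^sup>2"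
    using growth_pos[of ?k N] by (simp add: w_def W_def power_divide)
  finally show ?thesis .
qed

lemma adm_depends: "adm A f \<Longrightarrow> depends_on A f"
  by (simp add: adm_def)

section \<open>Almost surely some vertex is good for infinitely many generations\<close>

definition good_inf :: "nat list \<Rightarrow> (nat list \<Rightarrow> nat) set" where
  "good_inf v = (\<Inter>k. \<Union>N\<in>{k..}. good N v)"

lemma good_inf_sets [measurable]: "good_inf v \<in> sets \<Omega>"
  unfolding good_inf_def by (intro sets.countable_INT image_subsetI sets.countable_UN) auto

text \<open>The decreasing unions \<open>G k\<close> each contain the single event
  \<open>good k v\<close>. Asking one vertex to be good for infinitely many \<open>N\<close> keeps
  the constant of the flows independent of \<open>N\<close>.\<close>

lemma prob_good_inf: "1 / (8 * W_bound) \<le> prob (good_inf v)"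
proof -
  define G where "G k = (\<Union>N\<in>{k..}. good N v)" for k
  have G: "G k \<in> sets \<Omega>" for k unfolding G_def by (intro sets.countable_UN) auto
  have "decseq G" unfolding G_def by (rule decseq_SucI) force
  hence "(\<lambda>k. prob (G k)) \<longlonglongrightarrow> prob (\<Inter>k. G k)"
    using G by (intro finite_Lim_measure_decseq) auto
  moreover have "1 / (8 * W_bound) \<le> prob (G k)" for k
  proof -
    have "prob (good k v) \<le> prob (G k)"
      using G by (intro finite_measure_mono) (auto simp: G_def)
    thus ?thesis using prob_good[of k v] by simp
  qed
  ultimately have "1 / (8 * W_bound) \<le> prob (\<Inter>k. G k)" by (intro LIMSEQ_le_const) auto
  thus ?thesis by (simp add: good_inf_def G_def)
qed

lemma good_depends: "(\<And>w. w \<in> cone v \<Longrightarrow> K w = K' w) \<Longrightarrow> K \<in> good N v \<longleftrightarrow> K' \<in> good N v"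
proof -
  assume *: "\<And>w. w \<in> cone v \<Longrightarrow> K w = K' w"
  have "W N v K = W N v K'" "fluct N v K = fluct N v K'"
    by (rule depends_onD[OF adm_depends[OF adm_W] *], assumption)
      (rule depends_onD[OF adm_depends[OF adm_fluct] *], assumption)
  thus ?thesis by (simp add: good_def)
qed

lemma adm_good_inf: "adm (cone v) (indicator (good_inf v))"
  unfolding adm_def depends_on_def
proof (intro conjI allI impI)
  show "\<exists>c. \<forall>K. \<bar>indicator (good_inf v) K\<bar> \<le> (c :: real)" by (intro exI[of _ 1]) (auto simp: indicator_def)
  fix K K' :: "nat list \<Rightarrow> nat" assume "\<forall>i\<in>cone v. K i = K' i"
  hence "K \<in> good N v \<longleftrightarrow> K' \<in> good N v" for N by (intro good_depends) auto
  thus "indicator (good_inf v) K = (indicator (good_inf v) K' :: real)" by (simp add: good_inf_def indicator_def)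
qed auto

definition n_good :: "nat \<Rightarrow> nat list \<Rightarrow> (nat list \<Rightarrow> nat) \<Rightarrow> real" where
  "n_good = gen_sum (\<lambda>u. indicator (good_inf u))"

lemma adm_n_good: "adm (cone v) (n_good n v)"
  unfolding n_good_def by (intro adm_gen_sum adm_good_inf)

lemma n_good_nonneg: "0 \<le> n_good n v K"
  unfolding n_good_def by (intro gen_sum_nonneg) auto

definition bad :: "nat list \<Rightarrow> (nat list \<Rightarrow> nat) set" where
  "bad v = {K. \<forall>n. n_good n v K = 0}"

lemma bad_sets [measurable]: "bad v \<in> sets \<Omega>"
proof -
  have [measurable]: "n_good n v \<in> borel_measurable \<Omega>" for n using adm_n_good by (auto simp: adm_def)
  have "{K \<in> space \<Omega>. \<forall>n. n_good n v K = 0} \<in> sets \<Omega>" by measurable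
  thus ?thesis by (simp add: bad_def)
qed

lemma adm_bad: "adm (cone v) (indicator (bad v))"
  unfolding adm_def depends_on_def
proof (intro conjI allI impI)
  show "\<exists>c. \<forall>K. \<bar>indicator (bad v) K\<bar> \<le> (c :: real)" by (intro exI[of _ 1]) (auto simp: indicator_def)
  fix K K' :: "nat list \<Rightarrow> nat" assume "\<forall>i\<in>cone v. K i = K' i"
  hence "n_good n v K = n_good n v K'" for n
    by (intro depends_onD[OF adm_depends[OF adm_n_good]]) auto
  thus "indicator (bad v) K = (indicator (bad v) K' :: real)" by (simp add: bad_def indicator_def)
qed auto

lemma bad_child: "K \<in> bad v \<Longrightarrow> i < X v K \<Longrightarrow> K \<in> bad (v @ [i])"
proof -
  assume K: "K \<in> bad v" and i: "i < X v K"
  have "n_good n (v @ [i]) K = 0" for n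
  proof -
    have "n_good (Suc n) v K = 0" using K by (simp add: bad_def)
    hence "(\<Sum>i<X v K. n_good n (v @ [i]) K) = 0" by (simp add: n_good_def)
    thus ?thesis using i n_good_nonneg by (simp add: sum_nonneg_eq_0_iff)
  qed
  thus ?thesis by (simp add: bad_def)
qed

lemma bad_not_good: "bad v \<inter> good_inf v = {}"
proof -
  have "n_good 0 v K = 0 \<Longrightarrow> K \<notin> good_inf v" for K by (simp add: n_good_def indicator_eq_0_iff)
  thus ?thesis by (auto simp: bad_def)
qed

lemma prob_bad_le: "prob (bad v) \<le> 1 - 1 / (8 * W_bound)"
proof -
  have "prob (bad v) + prob (good_inf v) = prob (bad v \<union> good_inf v)"
    by (rule finite_measure_Union[symmetric]) (auto simp: bad_not_good)
  also have "\<dots> \<le> 1" by simp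
  finally show ?thesis using prob_good_inf[of v] by simp
qed

text \<open>Cauchy-Schwarz for \<open>X - 1\<close>, which vanishes unless there are two children,
  has mean at least \<open>a - 1\<close> and second moment at most \<open>V\<close>. It is used in
  the linearised form with a parameter \<open>l\<close>.\<close>

lemma V_pos: "0 < V" and prob_branch: "(a - 1)\<^sup>2 / V \<le> expectation (\<lambda>K. of_bool (2 \<le> X v K))"
proof -
  note i = adm_integrable[OF adm_offspring]
  have E1: "a - 1 \<le> expectation (\<lambda>K. real (X v K) - 1)" for v
    using a(2)[of "length v"] mean_eq[of v] i[of real] by simp
  have "expectation (\<lambda>K. real (X [] K) - 1) \<le> expectation (\<lambda>K. real (X [] K) * (real (X [] K) - 1))"
  proof (rule integral_mono[OF i[of "\<lambda>x. real x - 1"] i[of "\<lambda>x. real x * (real x - 1)"]])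
    fix K have "1 * (real (X [] K) - 1) \<le> real (X [] K) * (real (X [] K) - 1)"
      using \<xi>_pos[of "[]" "K []"] by (intro mult_right_mono) auto
    thus "real (X [] K) - 1 \<le> real (X [] K) * (real (X [] K) - 1)" by simp
  qed
  thus V: "0 < V" using E1[of "[]"] a(1) pair_mean_eq[of "[]"] pair_mean_bounds[of "[]"] by linarith
  \<comment> \<open>With this value the second-moment term uses up exactly half of
    \<open>a - 1\<close>.\<close>
  define l where "l = (a - 1) / (2 * V)"
  have l: "0 < l" using V a(1) by (simp add: l_def)
  define p :: real where "p = expectation (\<lambda>K. of_bool (2 \<le> X v K))"
  have "a - 1 \<le> expectation (\<lambda>K. real (X v K) - 1)" by (rule E1)
  also have "\<dots> \<le> expectation (\<lambda>K. l * (real (X v K) * (real (X v K) - 1)) + of_bool (2 \<le> X v K) / (4 * l))"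
  proof (rule integral_mono[OF i[of "\<lambda>x. real x - 1"] i[of "\<lambda>x. l * (real x * (real x - 1)) + of_bool (2 \<le> x) / (4 * l)"]])
    fix K
    let ?x = "real (X v K)"
    show "?x - 1 \<le> l * (?x * (?x - 1)) + of_bool (2 \<le> X v K) / (4 * l)"
    proof (cases "2 \<le> X v K")
      case True
      have "0 \<le> (2 * l * (?x - 1) - 1)\<^sup>2" by simp
      hence "?x - 1 \<le> l * ((?x - 1) * (?x - 1)) + 1 / (4 * l)" using l by (simp add: field_simps power2_eq_square)
      moreover have "l * ((?x - 1) * (?x - 1)) \<le> l * (?x * (?x - 1))"
        using l True by (intro mult_left_mono mult_right_mono) auto
      ultimately show ?thesis using True by simp
    next
      case False
      hence "X v K = 1" using \<xi>_pos[of v "K v"] by simp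
      thus ?thesis by simp
    qed
  qed
  also have "\<dots> = l * pair_mean v + expectation (\<lambda>K. of_bool (2 \<le> X v K)) / (4 * l)"
    using E_add[of "{v}" "\<lambda>K. l * (real (X v K) * (real (X v K) - 1))" "\<lambda>K. of_bool (2 \<le> X v K) / (4 * l)",
      OF adm_offspring[of v "\<lambda>x. l * (real x * (real x - 1))"] adm_offspring[of v "\<lambda>x. of_bool (2 \<le> x) / (4 * l)"]] pair_mean_eq[of v]
    by simp
  finally have "a - 1 \<le> l * pair_mean v + p / (4 * l)" by (simp only: p_def)
  moreover have "l * pair_mean v \<le> l * V" using l pair_mean_bounds by (simp add: mult_left_mono)
  moreover have "l * V = (a - 1) / 2" using V by (simp add: l_def)
  \<comment> \<open>Here \<open>centred_pairs\<close> is a real variable bound by the statement; it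
    stands for \<open>l * V\<close>.\<close>
  moreover have "A / 2 \<le> C" if "A \<le> B + C" "B \<le> centred_pairs" "centred_pairs = A / 2" for A B C centred_pairs :: real
    using that by linarith
  ultimately have "(a - 1) / 2 \<le> p / (4 * l)" by blast
  hence "(a - 1) / 2 * (4 * l) \<le> p" using l by (subst (asm) pos_le_divide_eq) auto
  moreover have "(a - 1) / 2 * (4 * l) = (a - 1)\<^sup>2 / V" using V by (simp add: l_def power2_eq_square field_simps)
  ultimately show "(a - 1)\<^sup>2 / V \<le> expectation (\<lambda>K. of_bool (2 \<le> X v K))" by (simp only: p_def)
qed

text \<open>All children of a bad vertex are bad. If there are at least two, the first two are bad
  independently: one factor is bounded by \<open>x\<close>, the other by
  \<open>prob_bad_le\<close>.\<close>

lemma prob_bad_step: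
  assumes x: "\<And>v. prob (bad v) \<le> x" shows "prob (bad v) \<le> x * (1 - (a - 1)\<^sup>2 / V * (1 / (8 * W_bound)))"
proof -
  let ?c = "1 / (8 * W_bound)"
  let ?v0 = "v @ [0]" and ?v1 = "v @ [1]"
  define p :: real where "p = expectation (\<lambda>K. of_bool (2 \<le> X v K))"
  have x0: "0 \<le> x" using x[of v] measure_nonneg[of \<Omega> "bad v"] by linarith
  have c: "0 \<le> ?c" using W_bound_ge_1 by simp
  have A0: "adm (cone ?v0) (indicator (bad ?v0))" and A1: "adm (cone ?v1) (indicator (bad ?v1))"
    by (rule adm_bad)+
  have A01: "adm (cone ?v0 \<union> cone ?v1) (\<lambda>K. indicator (bad ?v0) K * indicator (bad ?v1) K)"
    by (intro adm_mult adm_mono[OF A0] adm_mono[OF A1]) auto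
  have X1: "adm {v} (\<lambda>K. of_bool (X v K = 1))" and X2: "adm {v} (\<lambda>K. of_bool (2 \<le> X v K))"
    by (rule adm_offspring)+
  have Y1: "adm UNIV (\<lambda>K. of_bool (X v K = 1))" and Y2: "adm UNIV (\<lambda>K. of_bool (2 \<le> X v K))"
    and Y3: "adm UNIV (indicator (bad w))" for w
    using adm_mono[OF X1] adm_mono[OF X2] adm_mono[OF adm_bad] by simp_all
  have d: "{v} \<inter> cone ?v0 = {}" "{v} \<inter> (cone ?v0 \<union> cone ?v1) = {}" using cone_snoc[of v] by auto
  have p1: "expectation (\<lambda>K. of_bool (X v K = 1)) = 1 - p"
  proof -
    have "of_bool (X v K = 1) = 1 - (of_bool (2 \<le> X v K) :: real)" for K using \<xi>_pos[of v "K v"] by (auto simp: of_bool_def)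
    hence "expectation (\<lambda>K. of_bool (X v K = 1) :: real) = expectation (\<lambda>K. 1 - of_bool (2 \<le> X v K))" by presburger
    also have "\<dots> = 1 - p" unfolding p_def by (subst E_diff[of "{v}"]) (auto intro: X2)
    finally show ?thesis .
  qed
  have p_le: "p \<le> 1" unfolding p_def
    using E_mono[OF X2 adm_const[of "{v}" 1]] by simp
  have b01: "expectation (\<lambda>K. indicator (bad ?v0) K * indicator (bad ?v1) K) = prob (bad ?v0) * prob (bad ?v1)"
    using E_mult[OF A0 A1 cone_disjoint] by simp
  have "prob (bad v) = expectation (indicator (bad v))" by simp
  also have "\<dots> \<le> expectation (\<lambda>K. of_bool (X v K = 1) * indicator (bad ?v0) K + 
      of_bool (2 \<le> X v K) * (indicator (bad ?v0) K * indicator (bad ?v1) K))"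
  proof (rule E_mono[OF adm_mono[OF adm_bad[of v]]])
    show "adm UNIV (\<lambda>K. of_bool (X v K = 1) * indicator (bad ?v0) K + 
      of_bool (2 \<le> X v K) * (indicator (bad ?v0) K * indicator (bad ?v1) K))"
      by (intro adm_add adm_mult Y1 Y2 Y3)
    fix K
    consider "X v K = 1" | "2 \<le> X v K" using \<xi>_pos[of v "K v"] by linarith
    thus "indicator (bad v) K \<le> of_bool (X v K = 1) * indicator (bad ?v0) K + 
      of_bool (2 \<le> X v K) * (indicator (bad ?v0) K * indicator (bad ?v1) K :: real)"
    proof cases
      case 1 thus ?thesis using bad_child[of K v 0] by (auto simp: indicator_def)
    next
      case 2 thus ?thesis using bad_child[of K v 0] bad_child[of K v 1] by (auto simp: indicator_def)
    qed
  qed auto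
  also have "\<dots> = expectation (\<lambda>K. of_bool (X v K = 1) * indicator (bad ?v0) K) + 
      expectation (\<lambda>K. of_bool (2 \<le> X v K) * (indicator (bad ?v0) K * indicator (bad ?v1) K))"
    by (rule E_add[of UNIV]) (intro adm_add adm_mult Y1 Y2 Y3)+
  also have "\<dots> = (1 - p) * prob (bad ?v0) + p * (prob (bad ?v0) * prob (bad ?v1))"
    using E_mult[OF X1 A0 d(1)] E_mult[OF X2 A01 d(2)] p1 b01 by (simp add: p_def)
  also have "\<dots> \<le> (1 - p) * x + p * (x * (1 - ?c))"
  proof (intro add_mono mult_left_mono)
    show "prob (bad ?v0) * prob (bad ?v1) \<le> x * (1 - ?c)"
      using x0 by (intro mult_mono x prob_bad_le) auto
    show "0 \<le> p" unfolding p_def by (intro Bochner_Integration.integral_nonneg) auto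
  qed (use p_le x in auto)
  also have "\<dots> = x * (1 - p * ?c)" by (simp add: algebra_simps)
  also have "\<dots> \<le> x * (1 - (a - 1)\<^sup>2 / V * ?c)"
    using x0 c prob_branch[of v] unfolding p_def[symmetric]
    by (intro mult_left_mono diff_left_mono mult_right_mono) auto
  finally show ?thesis .
qed

text \<open>The bound in \<open>prob_bad_step\<close> is uniform in \<open>v\<close>, so it can be
  iterated; its factor is less than 1.\<close>

lemma prob_bad_zero: "prob (bad v) = 0"
proof -
  define \<theta> where "\<theta> = 1 - (a - 1)\<^sup>2 / V * (1 / (8 * W_bound))"
  have le: "prob (bad v) \<le> \<theta> ^ n" for n v
  proof (induction n arbitrary: v)
    case (Suc n)
    thus ?case using prob_bad_step[of "\<theta> ^ n" v] by (simp add: \<theta>_def mult.commute)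
  qed simp
  have "\<theta> < 1" using V_pos a(1) W_bound_ge_1 by (simp add: \<theta>_def)
  moreover have "0 \<le> \<theta>" using order_trans[OF measure_nonneg le[of v 1]] by simp
  ultimately have "(\<lambda>n. \<theta> ^ n) \<longlonglongrightarrow> 0" by (intro LIMSEQ_realpow_zero)
  hence "prob (bad v) \<le> 0" by (rule LIMSEQ_le_const) (use le in auto)
  thus ?thesis using measure_nonneg[of \<Omega> "bad v"] by linarith
qed

section \<open>From a good vertex to a flow\<close>

lemma gen_sum_level:
  assumes u: "u \<in> level (\<lambda>v. X v K) k"
  shows "(\<Sum>w\<in>level (\<lambda>v. X v K) (k + n). of_bool (take k w = u) * f w) = gen_sum (\<lambda>w _. f w) n u K"
proof (induction n arbitrary: f)
  case 0
  have "(\<Sum>w\<in>level (\<lambda>v. X v K) k. of_bool (take k w = u) * f w) = (\<Sum>w\<in>level (\<lambda>v. X v K) k. if w = u then f w else 0)"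
    by (intro sum.cong refl) (auto simp: length_level)
  thus ?case using u by simp
next
  case (Suc n)
  have "(\<Sum>w\<in>level (\<lambda>v. X v K) (k + Suc n). of_bool (take k w = u) * f w) =
     (\<Sum>w\<in>level (\<lambda>v. X v K) (k + n). of_bool (take k w = u) * (\<Sum>i<X w K. f (w @ [i])))"
    unfolding add_Suc_right sum_level_Suc
    by (intro sum.cong refl) (auto simp: length_level sum_distrib_left)
  also have "\<dots> = gen_sum (\<lambda>w _. \<Sum>i<X w K. f (w @ [i])) n u K" by (rule Suc)
  also have "\<dots> = gen_sum (\<lambda>w _. f w) (Suc n) u K"
    unfolding gen_sum_Suc_back by (induction n arbitrary: u) auto
  finally show ?case .
qed

lemma gen_sum_cong: "(\<And>u. Y u K = Y' u K) \<Longrightarrow> gen_sum Y n v K = gen_sum Y' n v K"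
  by (induction n arbitrary: v) auto

text \<open>The unit mass runs down to \<open>u\<close> and is then divided in proportion to the
  number of truncated descendants in generation \<open>k + n\<close>, so that it is uniform there.
  By \<open>X_le\<close> the truncated tree is part of the tree of \<open>K\<close>; elsewhere the
  flow is zero.\<close>

lemma good_flow:
  assumes u: "u \<in> level (\<lambda>v. X v K) k" and K: "K \<in> good n u" and X_le: "\<And>v. X v K \<le> K v"
  shows "\<exists>\<mu>. spreading_flow (growth 0) K (growth 0 k * (a / (a - 1) * (4 * sqrt (fluct_bound k) + 2 * (V + 1)))) (k + n) \<mu>"
proof -
  define K' where "K' = (\<lambda>v. X v K)"
  define Z where "Z i v = gen_sum (\<lambda>_ _. 1) i v K" for i v
  define C where "C = a / (a - 1) * (4 * sqrt (fluct_bound k) + 2 * (V + 1))"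
  have lu: "length u = k" and uV: "u \<in> verts (family_tree K')" using u by (auto simp: level_def K'_def)
  have Z_Suc: "Z (Suc i) v = (\<Sum>j<K' v. Z i (v @ [j]))" for i v by (simp add: Z_def K'_def)
  have "1 / 2 \<le> Z n u / growth k n" using K by (simp add: good_def W_def Z_def lu)
  hence Z_pos: "0 < Z n u" using growth_pos[of k n] by (smt (verit) divide_nonpos_pos half_gt_zero_iff)
  define \<mu> where "\<mu> w = (if w \<notin> verts (family_tree K') then 0
     else if length w \<le> k then of_bool (take (length w) u = w)
     else of_bool (take k w = u) * Z (k + n - length w) w / Z n u)" for w
  have \<mu>_late: "\<mu> w = of_bool (take k w = u) * Z (k + n - length w) w / Z n u" 
    if "w \<in> verts (family_tree K')" "k \<le> length w" for w
  proof (cases "length w = k")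
    case True
    thus ?thesis using that Z_pos lu by (auto simp: \<mu>_def)
  qed (use that in \<open>auto simp: \<mu>_def\<close>)
  have flow: "\<mu> v = (\<Sum>i<K v. \<mu> (v @ [i]))" if v: "length v < k + n" for v
  proof (cases "v \<in> verts (family_tree K')")
    case False
    thus ?thesis by (simp add: \<mu>_def)
  next
    case vV: True
    have "(\<Sum>i<K v. \<mu> (v @ [i])) = (\<Sum>i<K' v. \<mu> (v @ [i]))"
      by (rule sum.mono_neutral_right) (use X_le[of v] in \<open>auto simp: \<mu>_def K'_def\<close>)
    also have "\<dots> = \<mu> v"
    proof (cases "length v < k")
      case True
      have "\<mu> (v @ [i]) = (if i = u ! length v then of_bool (take (length v) u = v) else 0)" if "i < K' v" for i
        using that True vV lu by (auto simp: \<mu>_def take_Suc_conv_app_nth)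
      hence "(\<Sum>i<K' v. \<mu> (v @ [i])) = (\<Sum>i<K' v. if i = u ! length v then of_bool (take (length v) u = v) else 0)"
        by (intro sum.cong) auto
      also have "\<dots> = (if u ! length v < K' v then of_bool (take (length v) u = v) else 0)" by simp
      also have "\<dots> = \<mu> v"
        using uV True vV lu by (auto simp: \<mu>_def verts_family_tree)
      finally show ?thesis .
    next
      case False
      define i where "i = k + n - Suc (length v)"
      have i: "k + n - length v = Suc i" using v by (simp add: i_def)
      have "(\<Sum>j<K' v. \<mu> (v @ [j])) = (\<Sum>j<K' v. of_bool (take k v = u) * Z i (v @ [j]) / Z n u)"
        using False vV by (intro sum.cong refl) (auto simp: \<mu>_late i_def)
      also have "\<dots> = \<mu> v" using False vV
        by (subst \<mu>_late) (auto simp: i Z_Suc sum_divide_distrib)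
      finally show ?thesis .
    qed
    finally show ?thesis ..
  qed
  have sum_K': "(\<Sum>v\<in>level K j. (\<mu> v)\<^sup>2) = (\<Sum>v\<in>level K' j. (\<mu> v)\<^sup>2)" for j
  proof (rule sum.mono_neutral_right)
    show "level K' j \<subseteq> level K j"
      using X_le by (auto simp: level_def verts_family_tree K'_def intro: less_le_trans)
    show "\<forall>v\<in>level K j - level K' j. (\<mu> v)\<^sup>2 = 0" by (auto simp: \<mu>_def level_def)
  qed (rule finite_level)
  have late: "growth 0 (k + i) * (\<Sum>v\<in>level K' (k + i). (\<mu> v)\<^sup>2) \<le> growth 0 k * C" if i: "i \<le> n" for i
  proof -
    have "(\<mu> v)\<^sup>2 = of_bool (take k v = u) * ((Z (n - i) v)\<^sup>2 / (Z n u)\<^sup>2)" if v: "v \<in> level K' (k + i)" for v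
      using v i by (subst \<mu>_late) (auto simp: level_def power_divide)
    hence "(\<Sum>v\<in>level K' (k + i). (\<mu> v)\<^sup>2) = gen_sum (\<lambda>v _. (Z (n - i) v)\<^sup>2 / (Z n u)\<^sup>2) i u K"
      using gen_sum_level[OF u, of "\<lambda>v. (Z (n - i) v)\<^sup>2 / (Z n u)\<^sup>2" i] by (simp add: K'_def)
    also have "\<dots> = 1 / (Z n u)\<^sup>2 * gen_sum (\<lambda>v K. (gen_sum (\<lambda>_ _. 1) (n - i) v K)\<^sup>2) i u K"
      unfolding gen_sum_cmult[symmetric] by (rule gen_sum_cong) (simp add: Z_def)
    finally have eq: "(\<Sum>v\<in>level K' (k + i). (\<mu> v)\<^sup>2) = \<dots>" .
    have "growth k i * gen_sum (\<lambda>v K. (gen_sum (\<lambda>_ _. 1) (n - i) v K)\<^sup>2) i u K \<le> C * (Z n u)\<^sup>2"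
      using good_second_moment[OF K i] by (simp add: lu C_def Z_def)
    hence "growth k i * (\<Sum>v\<in>level K' (k + i). (\<mu> v)\<^sup>2) \<le> C"
      unfolding eq using Z_pos by (simp add: field_simps)
    hence "growth 0 k * (growth k i * (\<Sum>v\<in>level K' (k + i). (\<mu> v)\<^sup>2)) \<le> growth 0 k * C"
      by (rule mult_left_mono[OF _ growth_nonneg])
    thus ?thesis by (simp add: growth_add mult.assoc)
  qed
  have early: "growth 0 j * (\<Sum>v\<in>level K' j. (\<mu> v)\<^sup>2) \<le> growth 0 k * C" if j: "j \<le> k" for j
  proof -
    have one: "(\<Sum>v\<in>level K' j. (\<mu> v)\<^sup>2) = 1" if j: "j \<le> k" for j
    proof -
      have "(\<Sum>v\<in>level K' j. (\<mu> v)\<^sup>2) = (\<Sum>v\<in>level K' j. if v = take j u then 1 else 0)"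
        using j by (intro sum.cong refl) (auto simp: \<mu>_def level_def)
      also have "\<dots> = (if take j u \<in> level K' j then 1 else 0)" by simp
      also have "\<dots> = 1" using uV j lu by (simp add: level_def take_in_family_tree)
      finally show ?thesis .
    qed
    have "growth 0 j \<le> growth 0 k"
    proof -
      have "1 \<le> growth j (k - j)" unfolding growth_def
        by (rule prod_ge_1) (rule order_trans[OF less_imp_le[OF a(1)] a(2)])
      thus ?thesis using growth_add[of 0 j "k - j"] j mult_left_mono[of 1 "growth j (k - j)" "growth 0 j"] growth_nonneg by simp
    qed
    \<comment> \<open>Generation \<open>k\<close> carries the whole unit at the single vertex
      \<open>u\<close>, so the case \<open>i = 0\<close> of \<open>late\<close> already contains
      this bound.\<close>
    also have "growth 0 k \<le> growth 0 k * C" using late[of 0] one[of k] by simp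
    finally show ?thesis using one[OF j] by simp
  qed
  have "growth 0 j * (\<Sum>v\<in>level K j. (\<mu> v)\<^sup>2) \<le> growth 0 k * C" if "j \<le> k + n" for j
  proof (cases "j \<le> k")
    case False
    then obtain i where "j = k + i" by (metis le_add_diff_inverse nat_le_linear)
    thus ?thesis using late[of i] that by (simp add: sum_K')
  qed (use early[of j] in \<open>simp add: sum_K'\<close>)
  moreover have "\<mu> [] = 1" by (simp add: \<mu>_def)
  ultimately show ?thesis using flow unfolding C_def[symmetric] spreading_flow_def by (intro exI[of _ \<mu>] conjI allI impI)
qed

text \<open>The constant depends only on the generation of a good vertex, which is fixed before
  \<open>N\<close>; \<open>good_inf\<close> then supplies arbitrarily late \<open>N\<close>.\<close>

lemma AE_spreading_flow:
  assumes le: "\<And>v. AE k in M v. \<xi> v k \<le> k"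
  shows "AE K in \<Omega>. \<exists>C. \<forall>N\<^sub>0. \<exists>N\<ge>N\<^sub>0. \<exists>\<mu>. spreading_flow (growth 0) K C N \<mu>"
proof -
  have "AE K in \<Omega>. K \<notin> bad []"
    by (rule AE_not_in) (simp add: null_setsI emeasure_eq_measure prob_bad_zero)
  moreover have "AE K in \<Omega>. \<forall>v. X v K \<le> K v"
    unfolding AE_all_countable
  proof
    fix v show "AE K in \<Omega>. X v K \<le> K v"
      by (rule AE_PiM_component[of UNIV M v "\<lambda>k. \<xi> v k \<le> k"]) (simp_all add: prob le)
  qed
  ultimately show ?thesis
  proof eventually_elim
    case (elim K)
    obtain n where n: "n_good n [] K \<noteq> 0" using elim(1) by (auto simp: bad_def)
    have "(\<Sum>w\<in>level (\<lambda>v. X v K) n. indicator (good_inf w) K) = n_good n [] K"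
    proof -
      have "n_good n [] K = gen_sum (\<lambda>w _. indicator (good_inf w) K) n [] K"
        unfolding n_good_def by (rule gen_sum_cong) simp
      also have "\<dots> = (\<Sum>w\<in>level (\<lambda>v. X v K) (0 + n). of_bool (take 0 w = []) * indicator (good_inf w) K)"
        by (rule gen_sum_level[symmetric]) simp
      finally show ?thesis by simp
    qed
    with n have "(\<Sum>w\<in>level (\<lambda>v. X v K) n. indicator (good_inf w) K) \<noteq> (0 :: real)" by simp
    then obtain u where "u \<in> level (\<lambda>v. X v K) n" "indicator (good_inf u) K \<noteq> (0 :: real)"
      by (rule sum.not_neutral_contains_not_neutral)
    hence "\<exists>u\<in>level (\<lambda>v. X v K) n. K \<in> good_inf u" by (auto simp: indicator_eq_0_iff)
    then obtain u where u: "u \<in> level (\<lambda>v. X v K) n" "K \<in> good_inf u" by blast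
    show ?case
    proof (intro exI[of _ "growth 0 n * (a / (a - 1) * (4 * sqrt (fluct_bound n) + 2 * (V + 1)))"] allI)
      fix N\<^sub>0
      obtain i where i: "i \<ge> N\<^sub>0" "K \<in> good i u" using u(2) by (auto simp: good_inf_def)
      show "\<exists>N\<ge>N\<^sub>0. \<exists>\<mu>. spreading_flow (growth 0) K (growth 0 n * (a / (a - 1) * (4 * sqrt (fluct_bound n) + 2 * (V + 1)))) N \<mu>"
        by (rule exI[of _ "n + i"], rule conjI[OF _ good_flow[OF u(1) i(2)]]) (use elim(2) i(1) in auto)
    qed
  qed
qed

end

section \<open>Truncation of the offspring and proof of the theorem\<close>

text \<open>A rejected number becomes 1: the truncated tree keeps a child at every vertex, and the
  value contributes nothing to the factorial moment.\<close>

definition cut_off :: "real \<Rightarrow> nat \<Rightarrow> nat" where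
  "cut_off c x = (if 1 \<le> x \<and> real x \<le> c then x else 1)"

lemma cut_off_ge_1: "1 \<le> cut_off c x" and cut_off_le: "1 \<le> x \<Longrightarrow> cut_off c x \<le> x"
  by (auto simp: cut_off_def)

lemma cut_off_le_floor: "1 \<le> c \<Longrightarrow> cut_off c x \<le> nat \<lfloor>c\<rfloor>"
  by (auto simp: cut_off_def intro: le_nat_floor)

lemma cut_off_factorial_moment_le: "real (cut_off c x) * (real (cut_off c x) - 1) \<le> real x * (real x - 1)"
proof -
  have "0 \<le> real x * (real x - 1)" by (cases x) auto
  thus ?thesis by (auto simp: cut_off_def)
qed

text \<open>Only \<open>x > c\<close> loses anything, namely \<open>x - 1\<close>, which is then at
  most \<open>x * (x - 1) / c\<close>. In the mean the loss is therefore at most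
  \<open>V / c\<close>.\<close>

lemma cut_off_ge: assumes "1 \<le> c" shows "real x - real x * (real x - 1) / c \<le> real (cut_off c x)"
proof (cases "1 \<le> x \<and> real x \<le> c")
  case True
  hence "0 \<le> real x * (real x - 1) / c" using assms by (intro divide_nonneg_pos mult_nonneg_nonneg) auto
  thus ?thesis using True by (simp add: cut_off_def)
next
  case False
  show ?thesis
  proof (cases "x = 0")
    case False
    hence "1 * (real x - 1) \<le> real x / c * (real x - 1)"
      using assms \<open>\<not> (1 \<le> x \<and> real x \<le> c)\<close> by (intro mult_right_mono) (auto simp: le_divide_eq)
    thus ?thesis using False \<open>\<not> (1 \<le> x \<and> real x \<le> c)\<close> by (simp add: cut_off_def)
  qed (simp add: cut_off_def)
qed

lemma cut_off_expectation:
  assumes c: "1 \<le> c" and i1: "integrable (measure_pmf p) real"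
    and i2: "integrable (measure_pmf p) (\<lambda>k. real k * (real k - 1))"
    and V: "measure_pmf.expectation p (\<lambda>k. real k * (real k - 1)) \<le> V"
  shows "measure_pmf.expectation p real - V / c \<le> measure_pmf.expectation p (\<lambda>k. real (cut_off c k))"
    and "measure_pmf.expectation p (\<lambda>k. real (cut_off c k) * (real (cut_off c k) - 1)) \<le> V"
proof -
  let ?E = "measure_pmf.expectation p"
  have b: "cut_off c k \<le> nat \<lfloor>c\<rfloor>" for k using cut_off_le_floor[OF c] .
  have j1: "integrable (measure_pmf p) (\<lambda>k. real (cut_off c k))"
    by (rule measure_pmf.integrable_const_bound[of _ "real (nat \<lfloor>c\<rfloor>)"]) (use b in \<open>auto intro!: AE_I2\<close>)
  have "?E real - ?E (\<lambda>k. real k * (real k - 1)) / c = ?E (\<lambda>k. real k - real k * (real k - 1) / c)"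
    using i1 i2 by simp
  also have "\<dots> \<le> ?E (\<lambda>k. real (cut_off c k))"
    using i1 i2 j1 by (intro integral_mono cut_off_ge c) auto
  finally have "?E real - ?E (\<lambda>k. real k * (real k - 1)) / c \<le> ?E (\<lambda>k. real (cut_off c k))" .
  moreover have "?E (\<lambda>k. real k * (real k - 1)) / c \<le> V / c" using V c by (intro divide_right_mono) auto
  ultimately show "?E real - V / c \<le> ?E (\<lambda>k. real (cut_off c k))" by linarith
  have "?E (\<lambda>k. real (cut_off c k) * (real (cut_off c k) - 1)) \<le> ?E (\<lambda>k. real k * (real k - 1))"
  proof (rule integral_mono[OF _ i2 cut_off_factorial_moment_le])
    show "integrable (measure_pmf p) (\<lambda>k. real (cut_off c k) * (real (cut_off c k) - 1))"
    proof (rule Bochner_Integration.integrable_bound[OF i2])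
      have "0 \<le> real (cut_off c k) * (real (cut_off c k) - 1)" for k using cut_off_ge_1[of c k] by simp
      thus "AE k in measure_pmf p. norm (real (cut_off c k) * (real (cut_off c k) - 1)) \<le> norm (real k * (real k - 1))"
        using cut_off_factorial_moment_le[of c] by (intro AE_I2) (smt (verit) real_norm_def)
    qed simp
  qed
  thus "?E (\<lambda>k. real (cut_off c k) * (real (cut_off c k) - 1)) \<le> V" using V by simp
qed

text \<open>The comparison of the two trees is available only along infinitely many generations,
  which depend on the sampled tree.\<close>

lemma frequently_le_limit:
  fixes f g :: "nat \<Rightarrow> real"
  assumes "f \<longlonglongrightarrow> a" "g \<longlonglongrightarrow> b" and fr: "\<And>N\<^sub>0. \<exists>N\<ge>N\<^sub>0. f N \<le> g N"
  shows "a \<le> b"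
proof (rule ccontr)
  assume "\<not> a \<le> b"
  hence "b < (a + b) / 2" "(a + b) / 2 < a" by auto
  hence "\<forall>\<^sub>F n in sequentially. g n < (a + b) / 2" "\<forall>\<^sub>F n in sequentially. (a + b) / 2 < f n"
    using order_tendstoD(2)[OF assms(2)] order_tendstoD(1)[OF assms(1)] by blast+
  hence "\<forall>\<^sub>F n in sequentially. g n < f n" by eventually_elim simp
  then obtain N\<^sub>0 where "\<And>n. n \<ge> N\<^sub>0 \<Longrightarrow> g n < f n" by (auto simp: eventually_sequentially)
  with fr[of N\<^sub>0] show False by force
qed

lemma spreading_flow_mono:
  assumes "spreading_flow M K C N \<mu>" "0 \<le> c" "\<And>j. M' j \<le> c * M j"
  shows "spreading_flow M' K (c * C) N \<mu>"
proof -
  have "M' j * (\<Sum>v\<in>level K j. (\<mu> v)\<^sup>2) \<le> c * C" if "j \<le> N" for j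
  proof -
    have "M' j * (\<Sum>v\<in>level K j. (\<mu> v)\<^sup>2) \<le> (c * M j) * (\<Sum>v\<in>level K j. (\<mu> v)\<^sup>2)"
      by (intro mult_right_mono assms sum_nonneg) auto
    also have "\<dots> = c * (M j * (\<Sum>v\<in>level K j. (\<mu> v)\<^sup>2))" by simp
    also have "\<dots> \<le> c * C" using assms(1,2) that by (intro mult_left_mono) (auto simp: spreading_flow_def)
    finally show ?thesis .
  qed
  with assms(1) show ?thesis by (simp add: spreading_flow_def)
qed

lemma AE_offspring_flow:
  assumes no_death: "\<And>n. pmf (q (Suc n)) 0 = 0"
    and i1: "\<And>n. integrable (measure_pmf (q (Suc n))) real"
    and i2: "\<And>n. integrable (measure_pmf (q (Suc n))) (\<lambda>k. real k * (real k - 1))"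
    and \<alpha>: "1 < \<alpha>" "\<And>n. \<alpha> \<le> measure_pmf.expectation (q (Suc n)) real"
    and V: "0 < V" "\<And>n. measure_pmf.expectation (q (Suc n)) (\<lambda>k. real k * (real k - 1)) \<le> V"
  shows "AE K in offspring_measure q. \<exists>C. \<forall>N\<^sub>0. \<exists>N\<ge>N\<^sub>0. \<exists>\<mu>.
    spreading_flow (\<lambda>j. \<Prod>i<j. measure_pmf.expectation (q (Suc i)) real) K C N \<mu>"
proof -
  define M where "M n = measure_pmf.expectation (q (Suc n)) real" for n
  \<comment> \<open>Halfway between 1 and \<open>\<alpha>\<close>, which leaves
    \<open>(\<alpha> - 1) / 2\<close> for the loss of mean through truncation.\<close>
  define a where "a = (1 + \<alpha>) / 2"
  have a: "1 < a" using \<alpha> by (simp add: a_def)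
  \<comment> \<open>The squared truncation levels grow at rate \<open>r\<^sup>2 = sqrt a\<close>,
    strictly slower than the lower bound \<open>a ^ j\<close> for the generation sizes.\<close>
  define r where "r = sqrt (sqrt a)"
  have r: "1 < r" "r\<^sup>2 < a"
  proof -
    show "1 < r" using a by (simp add: r_def)
    have "r\<^sup>2 = sqrt a" using a by (simp add: r_def)
    thus "r\<^sup>2 < a" using a real_less_lsqrt[of a a] by (simp add: power2_eq_square)
  qed
  \<comment> \<open>The 1 ensures \<open>1 \<le> c k\<close>, the second summand keeps the truncated
    means above \<open>a\<close>, and the third makes the geometric series of the losses
    \<open>V / c k\<close> at most \<open>1 / 2\<close>.\<close>
  define l where "l = 1 + 2 * V / (\<alpha> - 1) + 2 * V / (1 - 1 / r)"
  have r': "0 < 1 - 1 / r" using r by simp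
  have l1: "1 \<le> l" and l2: "V / l \<le> (\<alpha> - 1) / 2" and l3: "V / l / (1 - 1 / r) \<le> 1 / 2"
  proof -
    have p: "0 \<le> 2 * V / (\<alpha> - 1)" "0 \<le> 2 * V / (1 - 1 / r)"
      using V(1) \<alpha>(1) r' by (auto intro!: divide_nonneg_nonneg)
    thus l1: "1 \<le> l" unfolding l_def by linarith
    have "2 * V / (\<alpha> - 1) \<le> l" "2 * V / (1 - 1 / r) \<le> l" using p unfolding l_def by linarith+
    hence "2 * V \<le> l * (\<alpha> - 1)" "2 * V \<le> l * (1 - 1 / r)" using \<alpha>(1) r' by (simp_all add: pos_divide_le_eq)
    moreover have "V / l \<le> (\<alpha> - 1) / 2 \<longleftrightarrow> 2 * V \<le> l * (\<alpha> - 1)" using l1 by (simp add: field_simps)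
    moreover have "V / l / (1 - 1 / r) \<le> 1 / 2 \<longleftrightarrow> 2 * V \<le> l * (1 - 1 / r)"
      using l1 r' by (simp add: divide_le_eq pos_divide_le_eq mult.commute)
    ultimately show "V / l \<le> (\<alpha> - 1) / 2" "V / l / (1 - 1 / r) \<le> 1 / 2" by auto
  qed
  define c where "c k = l * r ^ k" for k :: nat
  have c_ge: "l \<le> c k" "1 \<le> c k" for k
  proof -
    have "l * 1 \<le> l * r ^ k" using l1 r by (intro mult_left_mono one_le_power) auto
    hence "l \<le> c k" by (simp add: c_def)
    thus "l \<le> c k" "1 \<le> c k" using l1 by simp_all
  qed
  define m where "m k = measure_pmf.expectation (q (Suc k)) (\<lambda>x. real (cut_off (c k) x))" for k
  have m_ge: "M k - V / c k \<le> m k" for k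
    unfolding M_def m_def by (rule cut_off_expectation(1)[OF c_ge(2) i1 i2 V(2)])
  have Vc: "V / c k \<le> V / l" for k 
  proof -
    have "0 < l" "0 < c k" using l1 c_ge(2)[of k] by linarith+
    thus ?thesis using V(1) c_ge(1)[of k] by (intro divide_left_mono) auto
  qed
  have m_a: "a \<le> m k" for k
  proof -
    have "\<alpha> - (\<alpha> - 1) / 2 \<le> M k - V / c k"
      unfolding M_def by (rule diff_mono[OF \<alpha>(2) order_trans[OF Vc l2]])
    moreover have "a = \<alpha> - (\<alpha> - 1) / 2" by (simp add: a_def field_simps)
    ultimately show ?thesis using m_ge[of k] by simp
  qed
  define L where "L k = nat \<lfloor>c k\<rfloor>" for k
  have prod_a: "a ^ j \<le> (\<Prod>i<j. m (k + i))" for k j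
    using prod_mono[of "{..<j}" "\<lambda>_. a" "\<lambda>i. m (k + i)"] m_a a by simp
  interpret bounded_branching "\<lambda>v. measure_pmf (q (Suc (length v)))" "\<lambda>v. cut_off (c (length v))" m L a V
  proof
    fix k
    show "summable (\<lambda>j. (real (L (k + j)))\<^sup>2 / (\<Prod>i<j. m (k + i)))"
    proof (rule summable_comparison_test')
      show "summable (\<lambda>j. (c k)\<^sup>2 * (r\<^sup>2 / a) ^ j)"
        using r a by (intro summable_mult summable_geometric) auto
      fix j
      have "real (L (k + j)) \<le> c (k + j)" unfolding L_def using c_ge(2)[of "k + j"] by simp
      also have "\<dots> = c k * r ^ j" by (simp add: c_def power_add)
      finally have "(real (L (k + j)))\<^sup>2 \<le> (c k * r ^ j)\<^sup>2" by (intro power_mono) auto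
      hence "(real (L (k + j)))\<^sup>2 / (\<Prod>i<j. m (k + i)) \<le> (c k * r ^ j)\<^sup>2 / a ^ j"
        using prod_a[of j k] a by (intro frac_le) auto
      also have "\<dots> = (c k)\<^sup>2 * (r\<^sup>2 / a) ^ j"
        by (simp add: power_mult_distrib power_divide power_mult[symmetric] mult.commute)
      finally have *: "(real (L (k + j)))\<^sup>2 / (\<Prod>i<j. m (k + i)) \<le> (c k)\<^sup>2 * (r\<^sup>2 / a) ^ j" .
      show "norm ((real (L (k + j)))\<^sup>2 / (\<Prod>i<j. m (k + i))) \<le> (c k)\<^sup>2 * (r\<^sup>2 / a) ^ j"
      proof -
        have "0 \<le> (\<Prod>i<j. m (k + i))" using order_trans[OF _ prod_a[of j k]] a by simp
        hence "norm ((real (L (k + j)))\<^sup>2 / (\<Prod>i<j. m (k + i))) = (real (L (k + j)))\<^sup>2 / (\<Prod>i<j. m (k + i))" by simp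
        with * show ?thesis by (simp only:)
      qed
    qed
  qed (auto simp: m_def L_def m_a[unfolded m_def] a measure_pmf.prob_space_axioms
      intro: cut_off_ge_1[unfolded One_nat_def] cut_off_le_floor c_ge cut_off_expectation(2)[OF c_ge(2) i1 i2 V(2)])
  have le: "AE k in measure_pmf (q (Suc (length v))). cut_off (c (length v)) k \<le> k" for v :: "nat list"
    unfolding AE_measure_pmf_iff
  proof
    fix k assume "k \<in> set_pmf (q (Suc (length v)))"
    hence "k \<noteq> 0" using no_death[of "length v"] by (metis set_pmf_iff)
    thus "cut_off (c (length v)) k \<le> k" by (intro cut_off_le) simp
  qed
  have M1: "1 \<le> M i" for i using \<alpha>(1) \<alpha>(2)[of i] by (simp add: M_def)
  \<comment> \<open>Since \<open>1 \<le> M i\<close>, the relative loss of mean in generation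
    \<open>i\<close> is at most \<open>V / c i\<close>. By the Weierstrass product inequality the
    total loss is at most a factor 2.\<close>
  have prod_M: "(\<Prod>i<j. M i) \<le> 2 * growth 0 j" for j
  proof -
    have eps: "0 \<le> V / c i" "V / c i \<le> 1" for i
    proof -
      show "0 \<le> V / c i" using V(1) c_ge(2)[of i] by simp
      have "x / y * y = x" if "0 < y" for x y :: real using that by simp
      from this[OF r', of "V / l"] have "V / l = V / l / (1 - 1 / r) * (1 - 1 / r)" by (rule sym)
      also have "\<dots> \<le> 1 / 2 * 1" using l3 r' r by (intro mult_mono) auto
      finally have "V / l \<le> 1 / 2 * 1" .
      hence "V / l \<le> 1" by (rule order_trans) simp
      with Vc[of i] show "V / c i \<le> 1" by (rule order_trans)
    qed
    have "(\<Sum>i<j. V / c i) \<le> 1 / 2"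
    proof -
      have "(\<Sum>i<j. V / c i) = V / l * (\<Sum>i<j. (1 / r) ^ i)"
        by (simp add: c_def sum_distrib_left power_one_over divide_simps)
      also have "(\<Sum>i<j. (1 / r) ^ i) \<le> 1 / (1 - 1 / r)"
        using r by (subst suminf_geometric[symmetric]) (auto intro!: sum_le_suminf summable_geometric)
      hence "V / l * (\<Sum>i<j. (1 / r) ^ i) \<le> V / l * (1 / (1 - 1 / r))"
        using V(1) l1 by (intro mult_left_mono) auto
      also have "\<dots> \<le> 1 / 2" using l3 by simp
      finally show ?thesis .
    qed
    hence "1 / 2 \<le> (\<Prod>i<j. 1 - V / c i)"
    proof -
      have "1 - (\<Sum>i<j. V / c i) \<le> (\<Prod>i<j. 1 - V / c i)"
        by (rule Weierstrass_prod_ineq) (use eps in auto)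
      thus ?thesis using \<open>(\<Sum>i<j. V / c i) \<le> 1 / 2\<close> by linarith
    qed
    hence "(\<Prod>i<j. M i) * (1 / 2) \<le> (\<Prod>i<j. M i) * (\<Prod>i<j. 1 - V / c i)"
      by (intro mult_left_mono prod_nonneg) (use order_trans[OF zero_le_one M1] in auto)
    also have "\<dots> = (\<Prod>i<j. M i * (1 - V / c i))" by (simp add: prod.distrib)
    also have "\<dots> \<le> (\<Prod>i<j. m i)"
    proof (intro prod_mono conjI)
      fix i
      show "0 \<le> M i * (1 - V / c i)" using M1[of i] eps[of i] by simp
      have "M i * (1 - V / c i) = M i - M i * (V / c i)" by (simp add: algebra_simps)
      also have "\<dots> \<le> M i - 1 * (V / c i)" using M1[of i] eps[of i] by (intro diff_left_mono mult_right_mono)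
      finally show "M i * (1 - V / c i) \<le> m i" using m_ge[of i] by simp
    qed
    finally show ?thesis by (simp add: growth_def)
  qed
  have "AE K in offspring_measure q. \<exists>C. \<forall>N\<^sub>0. \<exists>N\<ge>N\<^sub>0. \<exists>\<mu>. spreading_flow (growth 0) K C N \<mu>"
    unfolding offspring_measure_def by (rule AE_spreading_flow[OF le])
  thus ?thesis
  proof eventually_elim
    case (elim K)
    then obtain C where C: "\<And>N\<^sub>0. \<exists>N\<ge>N\<^sub>0. \<exists>\<mu>. spreading_flow (growth 0) K C N \<mu>" by blast
    have "spreading_flow (\<lambda>j. \<Prod>i<j. M i) K (2 * C) N \<mu>" if "spreading_flow (growth 0) K C N \<mu>" for N \<mu>
      by (rule spreading_flow_mono[OF that, of 2]) (use prod_M in auto)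
    with C show ?case unfolding M_def by blast
  qed
qed

theorem theorem6p1:
  fixes q :: "nat \<Rightarrow> nat pmf" and \<Delta> :: "'v rooted_graph"
  assumes no_death: "\<And>n. n \<ge> 1 \<Longrightarrow> gen_fun (q n) 0 = 0"
    and Delta: "infinite_tree \<Delta>"
    and mean_gt_1: "(INF n\<in>{1..}. gen_fun_deriv_1 1 (q n)) > 1"
    and second_moment: "(SUP n\<in>{1..}. gen_fun_deriv_1 2 (q n)) < \<infinity>"
    and growth: "(SUP n. ereal (real (card (generation \<Delta> n))) / mean_size q n) < \<infinity>"
  shows "AE K in offspring_measure q.
           \<exists>C::real. C > 0 \<and>
             (\<forall>F B. real_distribution F \<longrightarrow> closed B \<longrightarrow>
                path_prob (family_tree K) B F \<ge> C * path_prob \<Delta> B F)"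
proof -
  interpret inf_tree \<Delta> by unfold_locales (rule Delta)
  have no_death': "pmf (q (Suc n)) 0 = 0" for n
    using no_death[of "Suc n"] powser_zero[of "pmf (q (Suc n))"] by (simp add: gen_fun_def)
  have fin2: "gen_fun_deriv_1 2 (q (Suc n)) < \<infinity>" for n
    using second_moment SUP_lessD[of "\<lambda>n. gen_fun_deriv_1 2 (q n)" "{1..}" \<infinity> "Suc n"] by simp
  note mom = gen_fun_moments[OF fin2]
  define M where "M n = measure_pmf.expectation (q (Suc n)) real" for n
  obtain \<alpha> where \<alpha>: "1 < ereal \<alpha>" "ereal \<alpha> < (INF n\<in>{1..}. gen_fun_deriv_1 1 (q n))"
    using ereal_dense2[OF mean_gt_1] by blast
  have \<alpha>_le: "\<alpha> \<le> M n" for n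
    using less_INF_D[OF \<alpha>(2), of "Suc n"] mom(4)[of n] by (simp add: M_def)
  obtain V\<^sub>0 where V\<^sub>0: "(SUP n\<in>{1..}. gen_fun_deriv_1 2 (q n)) < ereal V\<^sub>0"
    using ereal_dense2[OF second_moment] by blast
  \<comment> \<open>The maximum with 1 provides a positive bound, as required for the choice of the
    truncation levels.\<close>
  have V_le: "measure_pmf.expectation (q (Suc n)) (\<lambda>k. real k * (real k - 1)) \<le> max V\<^sub>0 1" for n
    using SUP_lessD[OF V\<^sub>0, of "Suc n"] mom(2)[of n] by simp
  obtain A where A: "(SUP n. ereal (real (card (generation \<Delta> n))) / mean_size q n) < ereal A"
    using ereal_dense2[OF growth] by blast
  have M_pos: "0 < (\<Prod>i<n. M i)" for n
  proof (intro prod_pos)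
    fix i
    have "1 < \<alpha>" using \<alpha>(1) by simp
    thus "0 < M i" using \<alpha>_le[of i] by linarith
  qed
  have card_le: "real (card (level degree n)) \<le> A * (\<Prod>i<n. M i)" for n
  proof -
    have "mean_size q n = (\<Prod>i<n. gen_fun_deriv_1 1 (q (Suc i)))"
      unfolding mean_size_def by (rule prod.reindex_bij_witness[of _ Suc "\<lambda>j. j - 1"]) auto
    also have "\<dots> = ereal (\<Prod>i<n. M i)" by (simp only: mom(4) M_def prod_ereal)
    finally have eq: "mean_size q n = ereal (\<Prod>i<n. M i)" .
    have "ereal (real (card (generation \<Delta> n))) / mean_size q n < ereal A"
      using SUP_lessD[OF A, of n] by simp
    also have "ereal (real (card (generation \<Delta> n))) / mean_size q n =
        ereal (real (card (generation \<Delta> n)) / (\<Prod>i<n. M i))"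
      unfolding eq ereal_divide using less_imp_neq[OF M_pos[of n]] by (metis (no_types, lifting))
    finally have "real (card (level degree n)) / (\<Prod>i<n. M i) < A" by (simp add: card_level)
    thus ?thesis using M_pos[of n] by (simp add: divide_less_eq)
  qed
  have A0: "0 \<le> A" using card_le[of 0] by simp
  have "AE K in offspring_measure q. \<exists>C. \<forall>N\<^sub>0. \<exists>N\<ge>N\<^sub>0. \<exists>\<mu>. spreading_flow (\<lambda>j. \<Prod>i<j. M i) K C N \<mu>"
    unfolding M_def
    by (rule AE_offspring_flow[of q \<alpha> "max V\<^sub>0 1"]) (use no_death' mom \<alpha> \<alpha>_le V_le in \<open>auto simp: M_def\<close>)
  thus ?thesis
  proof eventually_elim
    case (elim K)
    then obtain C where C: "\<And>N\<^sub>0. \<exists>N\<ge>N\<^sub>0. \<exists>\<mu>. spreading_flow (\<lambda>j. \<Prod>i<j. M i) K C N \<mu>" by blast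
    \<comment> \<open>Fixed before \<open>F\<close> and \<open>B\<close>, so the constant depends on
      the two trees only; the maximum provides \<open>1 \<le> C'\<close> for
      \<open>hit_comparison\<close>.\<close>
    define C' where "C' = max 1 (A * C)"
    have C': "1 \<le> C'" by (simp add: C'_def)
    show ?case
    proof (intro exI[of _ "1 / (2 * C')"] conjI allI impI)
      show "0 < 1 / (2 * C')" using C' by simp
      fix F :: "real measure" and B :: "(nat \<Rightarrow> real) set"
      assume F: "real_distribution F" and B: "closed B"
      have "path_prob (family_tree degree) B F \<le> 2 * C' * path_prob (family_tree K) B F"
      proof (rule frequently_le_limit)
        show "(\<lambda>N. hit F (thicken B N) degree N [] (\<lambda>_. 0)) \<longlonglongrightarrow> path_prob (family_tree degree) B F"
          by (rule path_prob_limit[OF F B])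
        show "(\<lambda>N. 2 * C' * hit F (thicken B N) K N [] (\<lambda>_. 0)) \<longlonglongrightarrow> 2 * C' * path_prob (family_tree K) B F"
          by (intro tendsto_mult_left path_prob_limit F B)
        fix N\<^sub>0
        obtain N \<mu> where N: "N \<ge> N\<^sub>0" and \<mu>: "spreading_flow (\<lambda>j. \<Prod>i<j. M i) K C N \<mu>" using C by blast
        interpret truncated_event F "thicken B N" N by (rule thicken_truncated_event[OF F])
        have "spreading_flow (\<lambda>j. real (card (level degree j))) K (A * C) N \<mu>"
          by (rule spreading_flow_mono[OF \<mu> A0 card_le])
        hence "spreading_flow (\<lambda>j. real (card (level degree j))) K C' N \<mu>"
          unfolding spreading_flow_def C'_def by (auto intro: max.coboundedI2)
        hence "hit F (thicken B N) degree N [] (\<lambda>_. 0) \<le> 2 * C' * hit F (thicken B N) K N [] (\<lambda>_. 0)"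
          using C' by (rule hit_comparison)
        thus "\<exists>N\<ge>N\<^sub>0. hit F (thicken B N) degree N [] (\<lambda>_. 0) \<le> 2 * C' * hit F (thicken B N) K N [] (\<lambda>_. 0)"
          using N by blast
      qed
      thus "1 / (2 * C') * path_prob \<Delta> B F \<le> path_prob (family_tree K) B F"
        using C' by (simp add: path_prob_degree[OF F B] field_simps)
    qed
  qed
qed

end
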